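(* Let $m\ge 3$ and $n\ge 2$ be integers. For $\ell=1,\dots,m$ let $\beta_\ell\in(0,1)$ be such that $$\sum_{\ell=1}^m\beta_\ell<2\quad\text{and}\quad \sum_{\ell\ne j}\beta_\ell>\beta_j\quad\text{for every }j=1,2,\dots,m.$$ Then, given $m$ distinct points $P_1,\dots,P_m\in\mathbb{R}^n$, there exists a solution $w\in C^0(\mathbb{R}^n\setminus\{P_1,\dots,P_m\})$ to $$(-\Delta)^{\frac n2}w=e^{nw}+\gamma_n\sum_{\ell=1}^m\beta_\ell\,\delta_{P_\ell}\quad\text{in }\mathbb{R}^n$$ satisfying the asymptotic behavior $$w(x)=-2\log|x|+O(1)\quad\text{as }|x|\to\infty.$$
   Context: $\delta_P$ is the Dirac measure at $P$, and $\gamma_n:=\frac{(n-1)!}{2}|S^n|$, where $|S^n|$ is the $n$-dimensional measure of the unit sphere $S^n\subset\mathbb{R}^{n+1}$; this constant is such that $\frac{1}{\gamma_n}(-\Delta)^{n/2}\log\frac{1}{|x|}=\delta_0$ in $\mathbb{R}^n$. The equation is understood in the sense of distributions, i.e. $w$ and $e^{nw}$ are locally integrable and $\int_{\mathbb{R}^n} w\,(-\Delta)^{n/2}\varphi\,dx=\int_{\mathbb{R}^n}e^{nw}\varphi\,dx+\gamma_n\sum_{\ell}\beta_\ell\varphi(P_\ell)$ for all $\varphi\in C_c^\infty(\mathbb{R}^n)$, where for odd $n$ the operator $(-\Delta)^{n/2}$ is the (nonlocal) operator with Fourier symbol $|\xi|^n$. *)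

theory Defs
  imports "HOL-Analysis.Analysis" "HOL-Library.Landau_Symbols"
begin

primrec times_cont_diff :: "nat \<Rightarrow> (real^'n \<Rightarrow> real) \<Rightarrow> bool" where
  "times_cont_diff 0 f \<longleftrightarrow> continuous_on UNIV f"
| "times_cont_diff (Suc k) f \<longleftrightarrow>
     (\<forall>x. f differentiable (at x)) \<and>
     (\<forall>v. times_cont_diff k (\<lambda>x. frechet_derivative f (at x) v))"

definition test_function :: "(real^'n \<Rightarrow> real) \<Rightarrow> bool" where
  "test_function \<phi> \<longleftrightarrow> (\<forall>k. times_cont_diff k \<phi>) \<and> compact (closure {x. \<phi> x \<noteq> 0})"

definition partial_deriv :: "'n \<Rightarrow> (real^'n \<Rightarrow> real) \<Rightarrow> real^'n \<Rightarrow> real" where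
  "partial_deriv i f x = frechet_derivative f (at x) (axis i 1)"

definition laplacian :: "(real^'n \<Rightarrow> real) \<Rightarrow> real^'n \<Rightarrow> real" where
  "laplacian f x = (\<Sum>i\<in>UNIV. partial_deriv i (partial_deriv i f) x)"

text \<open>The Fourier transform is normalised so that \<open>- laplacian\<close> has symbol \<open>\<bar>\<xi>\<bar>\<^sup>2\<close>.\<close>

definition fourier :: "(real^'n \<Rightarrow> complex) \<Rightarrow> real^'n \<Rightarrow> complex" where
  "fourier f \<xi> = (LINT x|lborel. f x * cis (- (x \<bullet> \<xi>)))"

definition inv_fourier :: "(real^'n \<Rightarrow> complex) \<Rightarrow> real^'n \<Rightarrow> complex" where
  "inv_fourier g x = (LINT \<xi>|lborel. g \<xi> * cis (x \<bullet> \<xi>)) / of_real ((2 * pi) ^ CARD('n))"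

text \<open>\<open>(-\<Delta>)\<^bsup>n/2\<^esup>\<close> on \<open>\<real>\<^sup>n\<close>, acting on test functions: an iterated Laplacian if \<open>n\<close> is even, and
  the operator with Fourier symbol \<open>\<bar>\<xi>\<bar>\<^sup>n\<close> if \<open>n\<close> is odd. In the latter case the result is real
  for real \<open>\<phi>\<close>, because the symbol is even; \<open>Re\<close> only changes the type.\<close>

definition half_n_laplacian :: "(real^'n \<Rightarrow> real) \<Rightarrow> real^'n \<Rightarrow> real" where
  "half_n_laplacian \<phi> =
     (if even CARD('n) then ((\<lambda>f x. - laplacian f x) ^^ (CARD('n) div 2)) \<phi>
      else (\<lambda>x. Re (inv_fourier
              (\<lambda>\<xi>. of_real (norm \<xi> ^ CARD('n)) * fourier (\<lambda>y. of_real (\<phi> y)) \<xi>) x)))"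

text \<open>Surface measure on the unit sphere of a Euclidean space, defined by polar coordinates:
  the measure of \<open>A\<close> is the dimension times the volume of the cone over \<open>A\<close> within the unit ball.\<close>

definition sphere_measure :: "'a::euclidean_space set \<Rightarrow> real" where
  "sphere_measure A = DIM('a) * measure lborel {t *\<^sub>R x | t x. 0 < t \<and> t \<le> 1 \<and> x \<in> A}"

text \<open>\<open>\<gamma>\<^sub>n\<close>, with the dimension \<open>n = CARD('n)\<close> passed as a type; \<open>real^('n + 1)\<close> is \<open>\<real>\<^bsup>n+1\<^esup>\<close>.\<close>

definition gamma_const :: "'n::finite itself \<Rightarrow> real" where
  "gamma_const _ = fact (CARD('n) - 1) / 2 * sphere_measure (sphere 0 1 :: (real^('n + 1)) set)"

lemma sphere_measure_sphere:
  "sphere_measure (sphere 0 1 :: 'a::euclidean_space set) = DIM('a) * unit_ball_vol DIM('a)"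
proof -
  have "{t *\<^sub>R x | t x. 0 < t \<and> t \<le> 1 \<and> x \<in> sphere (0::'a) 1} = cball 0 1 - {0}"
  proof (intro set_eqI iffI)
    fix y :: 'a assume "y \<in> cball 0 1 - {0}"
    then have "y = norm y *\<^sub>R (y /\<^sub>R norm y) \<and> 0 < norm y \<and> norm y \<le> 1 \<and> y /\<^sub>R norm y \<in> sphere 0 1"
      by simp
    then show "y \<in> {t *\<^sub>R x | t x. 0 < t \<and> t \<le> 1 \<and> x \<in> sphere (0::'a) 1}"
      by blast
  qed auto
  moreover have "measure lborel (cball (0::'a) 1 - {0}) = measure lborel (cball (0::'a) 1)"
    by (intro measure_Diff_null_set) auto
  ultimately show ?thesis
    by (simp add: sphere_measure_def content_cball)
qed

lemma gamma_const_eq: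
  "gamma_const TYPE('n::finite) =
     fact (CARD('n) - 1) * pi powr ((real CARD('n) + 1) / 2) / Gamma ((real CARD('n) + 1) / 2)"
proof -
  define s where "s = (real CARD('n) + 1) / 2"
  have "s > 0" unfolding s_def by (simp add: add_pos_nonneg)
  then have "Gamma (s + 1) = s * Gamma s" by (intro Gamma_plus1) auto
  then have "2 * s * unit_ball_vol (2 * s) = 2 * (pi powr s / Gamma s)"
    using \<open>s > 0\<close> by (simp add: unit_ball_vol_def)
  moreover have "real DIM(real^('n + 1)) = 2 * s" by (simp add: s_def)
  ultimately show ?thesis
    by (simp only: gamma_const_def sphere_measure_sphere s_def [symmetric]) simp
qed

definition locally_integrable :: "(real^'n \<Rightarrow> real) \<Rightarrow> bool" where
  "locally_integrable f \<longleftrightarrow> (\<forall>K. compact K \<longrightarrow> set_integrable lborel K f)"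

text \<open>\<open>w\<close> solves \<open>(-\<Delta>)\<^bsup>n/2\<^esup> w = e\<^bsup>nw\<^esup> + \<gamma>\<^sub>n \<Sum>\<^sub>\<ell> \<beta>\<^sub>\<ell> \<delta>\<^bsub>P\<^sub>\<ell>\<^esub>\<close> in the sense of distributions. For odd \<open>n\<close> the
  function \<open>half_n_laplacian \<phi>\<close> need not have compact support, so integrability of its product with
  \<open>w\<close> is not automatic; it is required because the Bochner integral of a non-integrable function
  is \<open>0\<close>.\<close>

definition distributional_solution ::
  "nat \<Rightarrow> (nat \<Rightarrow> real) \<Rightarrow> (nat \<Rightarrow> real^'n) \<Rightarrow> (real^'n \<Rightarrow> real) \<Rightarrow> bool" where
  "distributional_solution m \<beta> P w \<longleftrightarrow>
     locally_integrable w \<and>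
     locally_integrable (\<lambda>x. exp (real CARD('n) * w x)) \<and>
     (\<forall>\<phi>. test_function \<phi> \<longrightarrow>
        integrable lborel (\<lambda>x. w x * half_n_laplacian \<phi> x) \<and>
        (LINT x|lborel. w x * half_n_laplacian \<phi> x) =
          (LINT x|lborel. exp (real CARD('n) * w x) * \<phi> x)
          + gamma_const TYPE('n) * (\<Sum>l=1..m. \<beta> l * \<phi> (P l)))"

end

theory Submission
  imports Defs "HOL-Probability.Characteristic_Functions" "HOL-Complex_Analysis.Great_Picard"
    "HOL-Real_Asymp.Real_Asymp"
begin

text \<open>
  In the unknown density \<open>p\<close> proportional to \<open>exp (n w)\<close> the equation says that \<open>p\<close>, relative to the measure
  \<open>weight dx\<close>, is proportional to \<open>exp (2 s \<integral> lker x y p(y) dy)\<close>, the Euler-Lagrange equation of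
  \<open>F(f) = \<integral> f ln f - s \<integral>\<integral> lker f f\<close> over probability densities. By Gibbs' variational principle and
  Jensen's inequality, \<open>F\<close> is bounded below, with control of the entropy, as soon as
  \<open>\<integral> exp (s' lker x y)\<close> is bounded uniformly in \<open>y\<close> for some \<open>s' > s\<close>. The hypothesis
  \<open>\<beta>\<^sub>j < \<Sum>\<^bsub>l \<noteq> j\<^esub> \<beta>\<^sub>l\<close> is exactly \<open>s + n \<beta>\<^sub>j < n\<close>, which gives this bound although the measure has
  density \<open>\<bar>x - P\<^sub>j\<bar>\<close> to the power \<open>-n \<beta>\<^sub>j\<close> at \<open>P\<^sub>j\<close>. No lower semicontinuity is needed: for a near-minimiser
  \<open>f\<close> the density \<open>g \<propto> exp (2 s \<integral> lker f)\<close> is bounded and close to \<open>f\<close> in \<open>L\<^sup>1\<close>, and the potentials of a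
  bounded family of densities are precompact.

  For the distributional equation, \<open>(-\<Delta>)\<^bsup>n/2\<^esup>\<close> is treated as the Fourier multiplier \<open>\<bar>\<xi>\<bar>\<^sup>n\<close> for even and
  odd \<open>n\<close> alike, and the fundamental solution comes from writing \<open>ln \<bar>x\<bar>\<close> as a superposition of Gaussians
  (Frullani's integral).
\<close>

section \<open>Minimising the free energy of a logarithmic-type kernel\<close>

text \<open>The solution is sought as \<open>w = (2 - S) * v + (sum of \<beta> l * lker x (P l)) - 2
  * ln (bracket x) + c\<close>, with \<open>S\<close> the sum of the \<open>\<beta> l\<close> and
  \<open>v\<close> the \<open>lker\<close>-potential of a probability density \<open>p\<close>.
  Paired with \<open>hnl f\<close>, every \<open>lker\<close>-potential of unit mass yields
  \<open>gamma_const\<close> times a value or mean of \<open>f\<close> plus one and the same term in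
  \<open>ln (bracket x)\<close>; since \<open>(2 - S) + S = 2\<close>, the third summand of
  \<open>w\<close> cancels these terms. The decay \<open>-2 ln |x|\<close> thus fixes the total mass
  of the right-hand side at twice \<open>gamma_const\<close>, leaves the positive share
  \<open>2 - S\<close> for \<open>exp (n w)\<close> and determines the coupling
  \<open>2 s = n (2 - S)\<close>. In odd dimension the image of a test function is not compactly
  supported. That it can be paired with logarithms at all rests on its decay of order
  \<open>n + 1\<close>; that additive constants pair to zero rests on its vanishing integral, which
  has to be extracted from the vanishing of the symbol at the origin.\<close>

lemma mult_ln_bound:
  fixes a B :: real
  assumes "0 \<le> a" "a \<le> B"
  shows "\<bar>a * ln a\<bar> \<le> 1 + B\<^sup>2"
proof (cases "a = 0")
  case False
  then have a: "a > 0" using assms by simp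
  have "a * ln a \<le> a * (a - 1)" using a by (intro mult_left_mono ln_le_minus_one) auto
  also have "\<dots> \<le> B\<^sup>2" using assms a mult_mono[of a B a B] by (simp add: algebra_simps power2_eq_square)
  finally have 1: "a * ln a \<le> B\<^sup>2" .
  have "ln (1 / a) \<le> 1 / a - 1" using a by (intro ln_le_minus_one) auto
  then have "a * (- ln a) \<le> a * (1 / a - 1)" using a by (intro mult_left_mono) (auto simp: ln_div)
  then have "a * ln a \<ge> -1" using a by (simp add: algebra_simps)
  with 1 show ?thesis by (simp add: abs_le_iff) (smt (verit) zero_le_power2)
qed simp

text \<open>Fenchel-Young inequality for the conjugate pair \<open>a * ln a - a\<close> and
  \<open>exp v\<close>, with the convention \<open>ln 0 = 0\<close>. Integrated it is Gibbs'
  principle (\<open>gibbs\<close>); with \<open>v = ln b\<close> it is the tangent line of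
  \<open>a * ln a\<close> at \<open>b\<close> (\<open>xlnx_convex\<close>).\<close>

lemma young_exp_ln:
  fixes a v :: real
  assumes "0 \<le> a"
  shows "a * v \<le> a * ln a - a + exp v"
proof (cases "a = 0")
  case False
  then have a: "a > 0" using assms by simp
  have "1 + (v - ln a) \<le> exp (v - ln a)" by (rule exp_ge_add_one_self)
  then have "a * (1 + (v - ln a)) \<le> a * exp (v - ln a)" using a by simp
  also have "\<dots> = exp v" using a by (simp add: exp_diff)
  finally show ?thesis by (simp add: algebra_simps)
qed simp

text \<open>\<open>ln u <= u - 1\<close> at \<open>u = sqrt (b / a)\<close>. The linear terms
  \<open>- a + b\<close> integrate to zero for two probability densities, so this is the pointwise
  form of: the squared Hellinger distance is at most the relative entropy.\<close>

lemma hellinger_le: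
  fixes a b :: real
  assumes "0 \<le> a" "0 < b"
  shows "(sqrt a - sqrt b)\<^sup>2 \<le> a * ln a - a * ln b - a + b"
proof (cases "a = 0")
  case False
  then have a: "a > 0" using assms by simp
  have "ln (sqrt (b / a)) \<le> sqrt (b / a) - 1" using a assms by (intro ln_le_minus_one) auto
  then have "2 * a * ln (sqrt (b / a)) \<le> 2 * a * (sqrt (b / a) - 1)" using a by simp
  also have "2 * a * ln (sqrt (b / a)) = a * ln b - a * ln a"
    using a assms by (simp add: ln_sqrt ln_div field_simps)
  also have "a * sqrt (b / a) = sqrt a * sqrt b"
    using a by (simp add: real_sqrt_divide field_simps)
  then have "2 * a * (sqrt (b / a) - 1) = 2 * (sqrt a * sqrt b) - 2 * a"
    by (simp add: algebra_simps)
  finally show ?thesis using a assms by (simp add: power2_eq_square algebra_simps)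
qed (use assms in simp)

text \<open>Factor \<open>a - b = (sqrt a - sqrt b) * (sqrt a + sqrt b)\<close> and split the
  product by the arithmetic-geometric mean inequality with weight \<open>\<eta>\<close>. The weight
  stays free so that \<open>L1_emap\<close> can balance the two terms.\<close>

lemma abs_diff_le_hellinger:
  fixes a b \<eta> :: real
  assumes "0 \<le> a" "0 \<le> b" "0 < \<eta>"
  shows "\<bar>a - b\<bar> \<le> (sqrt a - sqrt b)\<^sup>2 / (2 * \<eta>) + \<eta> * (a + b)"
proof -
  let ?p = "\<bar>sqrt a - sqrt b\<bar>" and ?q = "sqrt a + sqrt b"
  have "a - b = (sqrt a - sqrt b) * ?q"
    using assms by (simp add: algebra_simps)
  then have e: "\<bar>a - b\<bar> = ?p * ?q" using assms by (simp add: abs_mult)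
  have "0 \<le> (?p - \<eta> * ?q)\<^sup>2" by simp
  then have "2 * \<eta> * (?p * ?q) \<le> ?p\<^sup>2 + \<eta>\<^sup>2 * ?q\<^sup>2" unfolding power2_diff power_mult_distrib by (simp only: mult_ac)
  then have "?p * ?q \<le> (?p\<^sup>2 + \<eta>\<^sup>2 * ?q\<^sup>2) / (2 * \<eta>)" using assms by (simp add: field_simps)
  also have "\<dots> = ?p\<^sup>2 / (2 * \<eta>) + \<eta> * (?q\<^sup>2 / 2)"
    using assms by (simp add: field_simps power2_eq_square)
  also have "?q\<^sup>2 / 2 \<le> a + b"
  proof -
    have "0 \<le> (sqrt a - sqrt b)\<^sup>2" by simp
    then show ?thesis using assms by (simp add: power2_diff power2_sum)
  qed
  finally show ?thesis using e assms by (simp add: mult_left_mono)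
qed

lemma abs_exp_diff_le:
  fixes a b c :: real
  assumes "a \<le> c" "b \<le> c"
  shows "\<bar>exp a - exp b\<bar> \<le> exp c * \<bar>a - b\<bar>"
proof -
  have *: "exp y - exp x \<le> exp c * (y - x)" if "x \<le> y" "y \<le> c" for x y :: real
  proof -
    have "1 + (x - y) \<le> exp (x - y)" by (rule exp_ge_add_one_self)
    then have "exp y * (1 + (x - y)) \<le> exp y * exp (x - y)" by simp
    also have "\<dots> = exp x" by (simp add: exp_diff)
    finally have "exp y - exp x \<le> exp y * (y - x)" by (simp add: algebra_simps)
    also have "\<dots> \<le> exp c * (y - x)" using that by (intro mult_right_mono) auto
    finally show ?thesis .
  qed
  from *[of a b] *[of b a] assms show ?thesis
    by (cases "a \<le> b") (auto simp: abs_if)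
qed

lemma null_sandwich:
  fixes a b :: "nat \<Rightarrow> real"
  assumes "b \<longlonglongrightarrow> 0" "\<forall>\<^sub>F j in sequentially. a j \<le> b j" "\<And>j. 0 \<le> a j"
  shows "a \<longlonglongrightarrow> 0"
  using assms by (intro tendsto_sandwich[of "\<lambda>_. 0" a _ b]) auto

text \<open>\<open>s\<close> is the coupling constant of the free energy, \<open>s'\<close> an
  exponent for which \<open>exp (s' * k x y)\<close> is integrable uniformly in \<open>x\<close>.
  The gap \<open>s < s'\<close> makes the free energy coercive: up to a constant, the interaction
  costs at most the fraction \<open>s / s'\<close> of the entropy.\<close>

locale exp_kernel = finite_measure M for M :: "'a measure" +
  fixes k :: "'a \<Rightarrow> 'a \<Rightarrow> real" and s s' C :: real
  assumes space_UNIV: "space M = UNIV"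
    and k_meas [measurable]: "(\<lambda>p. k (fst p) (snd p)) \<in> borel_measurable (M \<Otimes>\<^sub>M M)"
    and k_nonneg: "0 \<le> k x y" and k_sym: "k x y = k y x"
    and s_pos: "0 < s" and s_less: "s < s'"
    and exp_bound: "(\<integral>\<^sup>+y. ennreal (exp (s' * k x y)) \<partial>M) \<le> ennreal C"
    and M_pos: "0 < measure M UNIV"
begin

section \<open>Potentials of bounded functions\<close>

definition pot :: "('a \<Rightarrow> real) \<Rightarrow> 'a \<Rightarrow> real" where
  "pot f x = (\<integral>y. k x y * f y \<partial>M)"

text \<open>The bound holds everywhere and not just almost everywhere. On a finite measure it makes
  products, exponentials and potentials of such functions integrable, and it suits potentials, which
  are evaluated at every point.\<close>

definition bdd :: "('a \<Rightarrow> real) \<Rightarrow> bool" where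
  "bdd f \<longleftrightarrow> f \<in> borel_measurable M \<and> (\<exists>B. \<forall>x. \<bar>f x\<bar> \<le> B)"

text \<open>Bound for the integral of \<open>k x\<close>, uniform in \<open>x\<close>; it comes from
  \<open>s' * k <= exp (s' * k)\<close>.\<close>

definition K :: real where "K = C / s'"

sublocale MM: pair_sigma_finite M M ..

lemma k_meas1 [measurable]: "k x \<in> borel_measurable M"
proof -
  have "(\<lambda>y. (\<lambda>p. k (fst p) (snd p)) (x, y)) \<in> borel_measurable M"
    using space_UNIV by (intro measurable_compose[OF _ k_meas]) auto
  then show ?thesis by simp
qed

lemma s'_pos: "0 < s'" using s_pos s_less by simp

lemma C_pos: "0 < C"
proof (rule ccontr)
  fix x :: 'a
  assume "\<not> 0 < C"
  have "emeasure M UNIV = (\<integral>\<^sup>+y. 1 \<partial>M)" using space_UNIV by simp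
  also have "\<dots> \<le> (\<integral>\<^sup>+y. ennreal (exp (s' * k x y)) \<partial>M)"
    using s'_pos k_nonneg by (intro nn_integral_mono) auto
  also have "\<dots> \<le> ennreal C" by (rule exp_bound)
  also have "\<dots> = 0" using \<open>\<not> 0 < C\<close> by (simp add: ennreal_neg)
  finally show False using M_pos by (simp add: measure_def)
qed

lemma exp_k_int: "integrable M (\<lambda>y. exp (s' * k x y))"
  using exp_bound[of x] by (intro integrableI_nonneg) (auto simp: less_top[symmetric] top_unique)

lemma exp_k_le: "(\<integral>y. exp (s' * k x y) \<partial>M) \<le> C"
proof -
  have "ennreal (\<integral>y. exp (s' * k x y) \<partial>M) \<le> ennreal C"
    using exp_bound[of x] by (subst nn_integral_eq_integral[symmetric]) (auto simp: exp_k_int)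
  then show ?thesis using C_pos by (simp add: ennreal_le_iff)
qed

lemma k_le_exp: "k x y \<le> exp (s' * k x y) / s'"
proof -
  have "s' * k x y \<le> exp (s' * k x y)" using exp_ge_add_one_self[of "s' * k x y"] by linarith
  then show ?thesis using s'_pos by (simp add: field_simps)
qed

lemma k_int: "integrable M (k x)"
proof (rule Bochner_Integration.integrable_bound)
  show "integrable M (\<lambda>y. exp (s' * k x y) / s')" using exp_k_int by simp
qed (use k_nonneg k_le_exp s'_pos in auto)

lemma k_int_le: "(\<integral>y. k x y \<partial>M) \<le> K"
proof -
  have "(\<integral>y. k x y \<partial>M) \<le> (\<integral>y. exp (s' * k x y) / s' \<partial>M)"
    by (intro integral_mono k_int integrable_divide exp_k_int k_le_exp)
  also have "\<dots> \<le> K" using exp_k_le s'_pos by (simp add: K_def divide_right_mono)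
  finally show ?thesis .
qed

lemma bddI: "f \<in> borel_measurable M \<Longrightarrow> (\<And>x. \<bar>f x\<bar> \<le> B) \<Longrightarrow> bdd f"
  by (auto simp: bdd_def)

lemma bdd_meas [measurable_dest]: "bdd f \<Longrightarrow> f \<in> borel_measurable M"
  by (simp add: bdd_def)

lemma bddE:
  assumes "bdd f"
  obtains B where "0 \<le> B" "\<And>x. \<bar>f x\<bar> \<le> B"
proof -
  from assms obtain B where "\<forall>x. \<bar>f x\<bar> \<le> B" by (auto simp: bdd_def)
  moreover from this have "0 \<le> B" by (meson abs_ge_zero order_trans)
  ultimately show ?thesis using that by auto
qed

lemma bdd_const: "bdd (\<lambda>_. c)" by (rule bddI[of _ "\<bar>c\<bar>"]) auto

lemma bdd_add: assumes "bdd f" "bdd g" shows "bdd (\<lambda>x. f x + g x)"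
proof -
  obtain A where A: "0 \<le> A" "\<And>x. \<bar>f x\<bar> \<le> A" using assms(1) by (elim bddE) blast
  obtain B where B: "0 \<le> B" "\<And>x. \<bar>g x\<bar> \<le> B" using assms(2) by (elim bddE) blast
  show ?thesis using assms
    by (intro bddI[of _ "A + B"]) (auto intro!: order_trans[OF abs_triangle_ineq] add_mono A B dest: bdd_meas)
qed

lemma bdd_mult: assumes "bdd f" "bdd g" shows "bdd (\<lambda>x. f x * g x)"
proof -
  obtain A where A: "0 \<le> A" "\<And>x. \<bar>f x\<bar> \<le> A" using assms(1) by (elim bddE) blast
  obtain B where B: "0 \<le> B" "\<And>x. \<bar>g x\<bar> \<le> B" using assms(2) by (elim bddE) blast
  show ?thesis using assms
    by (intro bddI[of _ "A * B"]) (auto simp: abs_mult intro!: mult_mono A B dest: bdd_meas)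
qed

lemma bdd_cmult: "bdd f \<Longrightarrow> bdd (\<lambda>x. c * f x)" by (intro bdd_mult bdd_const)
lemma bdd_diff: "bdd f \<Longrightarrow> bdd g \<Longrightarrow> bdd (\<lambda>x. f x - g x)"
  using bdd_add[of f "\<lambda>x. (-1) * g x"] bdd_cmult[of g "-1"] by simp
lemma bdd_div: "bdd f \<Longrightarrow> bdd (\<lambda>x. f x / c)" using bdd_cmult[of f "1/c"] by simp

lemma bdd_abs: assumes "bdd f" shows "bdd (\<lambda>x. \<bar>f x\<bar>)"
  using bdd_meas[OF assms] assms by (auto simp: bdd_def)

lemma bdd_exp: assumes "bdd f" shows "bdd (\<lambda>x. exp (f x))"
proof -
  obtain A where A: "0 \<le> A" "\<And>x. \<bar>f x\<bar> \<le> A" using assms(1) by (elim bddE) blast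
  show ?thesis using A(2) bdd_meas[OF assms] by (intro bddI[of _ "exp A"]) (auto intro: order_trans[OF abs_ge_self])
qed

lemma bdd_xlnx: assumes "bdd f" "\<And>x. 0 \<le> f x" shows "bdd (\<lambda>x. f x * ln (f x))"
proof -
  obtain A where A: "0 \<le> A" "\<And>x. \<bar>f x\<bar> \<le> A" using assms(1) by (elim bddE) blast
  then have "f x \<le> A" for x using abs_le_D1 by blast
  then show ?thesis using bdd_meas[OF assms(1)] assms(2)
    by (intro bddI[of _ "1 + A\<^sup>2"]) (auto intro!: mult_ln_bound)
qed

lemma bdd_int: assumes "bdd f" shows "integrable M f"
proof -
  obtain A where A: "0 \<le> A" "\<And>x. \<bar>f x\<bar> \<le> A" using assms(1) by (elim bddE) blast
  show ?thesis using A(2) bdd_meas[OF assms] by (intro integrable_const_bound[of _ A]) auto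
qed

lemma kf_int: assumes "bdd f" shows "integrable M (\<lambda>y. k x y * f y)"
proof -
  obtain A where A: "0 \<le> A" "\<And>x. \<bar>f x\<bar> \<le> A" using assms(1) by (elim bddE) blast
  have [measurable]: "f \<in> borel_measurable M" using assms by (rule bdd_meas)
  show ?thesis
    by (rule Bochner_Integration.integrable_bound[OF integrable_mult_right[OF k_int, of A]])
       (use A k_nonneg in \<open>auto simp: abs_mult mult.commute intro!: mult_mono\<close>)
qed

lemma pot_meas [measurable]: assumes [measurable]: "f \<in> borel_measurable M" shows "pot f \<in> borel_measurable M"
  unfolding pot_def by measurable

lemma pot_mono_bound:
  assumes "f \<in> borel_measurable M" "\<And>x. \<bar>f x\<bar> \<le> B"
  shows "\<bar>pot f x\<bar> \<le> B * K"
proof -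
  have b: "bdd f" using assms by (rule bddI)
  have "0 \<le> B" using assms(2) by (meson abs_ge_zero order_trans)
  have "\<bar>pot f x\<bar> \<le> (\<integral>y. \<bar>k x y * f y\<bar> \<partial>M)"
    unfolding pot_def by (rule integral_abs_bound)
  also have "\<dots> \<le> (\<integral>y. B * k x y \<partial>M)"
    using b assms k_nonneg
    by (intro integral_mono integrable_abs kf_int integrable_mult_right k_int)
       (auto simp: abs_mult mult.commute \<open>0 \<le> B\<close> intro!: mult_mono)
  also have "\<dots> \<le> B * K" using k_int_le[of x] \<open>0 \<le> B\<close> by (simp add: mult_left_mono)
  finally show ?thesis .
qed

lemma bdd_pot: assumes "bdd f" shows "bdd (pot f)"
proof -
  obtain A where A: "0 \<le> A" "\<And>x. \<bar>f x\<bar> \<le> A" using assms(1) by (elim bddE) blast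
  show ?thesis using bdd_meas[OF assms] A by (intro bddI[of _ "A * K"] pot_mono_bound) auto
qed

lemma pot_add: "bdd f \<Longrightarrow> bdd g \<Longrightarrow> pot (\<lambda>x. f x + g x) x = pot f x + pot g x"
  unfolding pot_def by (simp add: distrib_left kf_int)
lemma pot_cmult: "pot (\<lambda>x. c * f x) x = c * pot f x"
proof -
  have "pot (\<lambda>x. c * f x) x = (\<integral>y. c * (k x y * f y) \<partial>M)"
    unfolding pot_def by (simp add: algebra_simps)
  then show ?thesis by (simp add: pot_def)
qed
lemma pot_diff: "bdd f \<Longrightarrow> bdd g \<Longrightarrow> pot (\<lambda>x. f x - g x) x = pot f x - pot g x"
  unfolding pot_def by (simp add: right_diff_distrib kf_int)

lemma pot_nonneg: "(\<And>x. 0 \<le> f x) \<Longrightarrow> 0 \<le> pot f x"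
  unfolding pot_def using k_nonneg by (intro Bochner_Integration.integral_nonneg) auto

lemma pair_k_int: "integrable (M \<Otimes>\<^sub>M M) (\<lambda>p. k (fst p) (snd p))"
proof -
  have "(\<integral>\<^sup>+p. ennreal (k (fst p) (snd p)) \<partial>(M \<Otimes>\<^sub>M M)) = (\<integral>\<^sup>+x. \<integral>\<^sup>+y. ennreal (k x y) \<partial>M \<partial>M)"
    using nn_integral_fst[of "\<lambda>p. ennreal (k (fst p) (snd p))" M] by simp
  also have "\<dots> \<le> (\<integral>\<^sup>+x. ennreal K \<partial>M)"
    using k_int k_nonneg k_int_le by (intro nn_integral_mono) (auto simp: nn_integral_eq_integral ennreal_leI)
  also have "\<dots> < \<infinity>" using emeasure_finite by (simp add: ennreal_mult_less_top less_top[symmetric] ennreal_mult_eq_top_iff)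
  finally show ?thesis using k_nonneg by (intro integrableI_nonneg) auto
qed

lemma pair_kfg_int:
  assumes "bdd f" "bdd g"
  shows "integrable (M \<Otimes>\<^sub>M M) (\<lambda>p. k (fst p) (snd p) * f (fst p) * g (snd p))"
proof -
  obtain A where A: "0 \<le> A" "\<And>x. \<bar>f x\<bar> \<le> A" using assms(1) by (elim bddE) blast
  obtain B where B: "0 \<le> B" "\<And>x. \<bar>g x\<bar> \<le> B" using assms(2) by (elim bddE) blast
  have [measurable]: "f \<in> borel_measurable M" "g \<in> borel_measurable M" using assms by (auto dest: bdd_meas)
  show ?thesis
  proof (rule Bochner_Integration.integrable_bound[OF integrable_mult_left[OF pair_k_int, of "A * B"]])
    show "AE p in M \<Otimes>\<^sub>M M. norm (k (fst p) (snd p) * f (fst p) * g (snd p)) \<le> norm (k (fst p) (snd p) * (A * B))"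
      using A B k_nonneg by (intro AE_I2) (auto simp: abs_mult mult.assoc intro!: mult_mono)
  qed measurable
qed

lemma pot_sym:
  assumes "bdd f" "bdd g"
  shows "(\<integral>x. f x * pot g x \<partial>M) = (\<integral>x. g x * pot f x \<partial>M)"
proof -
  have "(\<integral>x. f x * pot g x \<partial>M) = (\<integral>x. \<integral>y. k x y * f x * g y \<partial>M \<partial>M)"
    unfolding pot_def by (subst integral_mult_right_zero[symmetric]) (simp add: mult_ac)
  also have "\<dots> = (\<integral>y. \<integral>x. k x y * f x * g y \<partial>M \<partial>M)"
    using pair_kfg_int[OF assms] by (subst MM.Fubini_integral[symmetric]) (auto simp: case_prod_beta')
  also have "\<dots> = (\<integral>y. \<integral>x. g y * (k y x * f x) \<partial>M \<partial>M)"
    by (intro Bochner_Integration.integral_cong refl) (simp add: k_sym mult_ac)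
  also have "\<dots> = (\<integral>x. g x * pot f x \<partial>M)"
    unfolding pot_def by simp
  finally show ?thesis .
qed


section \<open>Entropy, interaction energy and coercivity\<close>

definition dens :: "('a \<Rightarrow> real) \<Rightarrow> bool" where
  "dens f \<longleftrightarrow> bdd f \<and> (\<forall>x. 0 \<le> f x) \<and> (\<integral>x. f x \<partial>M) = 1"

definition ent :: "('a \<Rightarrow> real) \<Rightarrow> real" where
  "ent f = (\<integral>x. f x * ln (f x) \<partial>M)"

definition free_energy :: "('a \<Rightarrow> real) \<Rightarrow> real" where
  "free_energy f = ent f - s * (\<integral>x. f x * pot f x \<partial>M)"

lemma densD: "dens f \<Longrightarrow> bdd f" "dens f \<Longrightarrow> 0 \<le> f x" "dens f \<Longrightarrow> (\<integral>x. f x \<partial>M) = 1"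
  by (auto simp: dens_def)

text \<open>\<open>young_exp_ln\<close> with \<open>v = V x - ln c\<close>, integrated: the linear
  term contributes \<open>-1\<close> and the exponential at most \<open>1\<close>. Allowing any
  upper bound \<open>c\<close> of the partition function matches the locale, where only the bound
  \<open>C\<close> is given.\<close>

lemma gibbs:
  assumes f: "dens f" and V: "integrable M (\<lambda>x. exp (V x))" "integrable M (\<lambda>x. f x * V x)"
    and c: "(\<integral>x. exp (V x) \<partial>M) \<le> c" "0 < c"
  shows "(\<integral>x. f x * V x \<partial>M) \<le> ent f + ln c"
proof -
  have fi: "integrable M f" "integrable M (\<lambda>x. f x * ln (f x))"
    using f by (auto intro!: bdd_int bdd_xlnx dest: densD)
  have "(\<integral>x. f x * V x - ln c * f x \<partial>M) \<le> (\<integral>x. f x * ln (f x) - f x + exp (V x) / c \<partial>M)"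
  proof (intro integral_mono Bochner_Integration.integrable_diff Bochner_Integration.integrable_add
      integrable_divide integrable_mult_right fi V)
    fix x
    have "f x * (V x - ln c) \<le> f x * ln (f x) - f x + exp (V x - ln c)"
      using densD(2)[OF f] by (rule young_exp_ln)
    then show "f x * V x - ln c * f x \<le> f x * ln (f x) - f x + exp (V x) / c"
      using c by (simp add: exp_diff algebra_simps)
  qed
  also have "\<dots> = ent f - 1 + (\<integral>x. exp (V x) \<partial>M) / c"
    using fi V densD(3)[OF f] by (simp add: ent_def)
  also have "\<dots> \<le> ent f" using c by simp
  also have "(\<integral>x. f x * V x - ln c * f x \<partial>M) = (\<integral>x. f x * V x \<partial>M) - ln c"
    using fi V densD(3)[OF f] by simp
  finally show ?thesis by simp
qed

text \<open>Gibbs' principle with \<open>V = s' * k x\<close>. Bounded entropy thus bounds the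
  potential uniformly, although the density itself may be arbitrarily large.\<close>

lemma pot_le_ent:
  assumes "dens f" shows "s' * pot f x \<le> ent f + ln C"
proof -
  have i: "integrable M (\<lambda>y. s' * (k x y * f y))"
    using assms by (intro integrable_mult_right kf_int densD)
  have "(\<integral>y. f y * (s' * k x y) \<partial>M) \<le> ent f + ln C"
    using i by (intro gibbs assms exp_k_int exp_k_le C_pos) (simp add: mult_ac)
  also have "(\<integral>y. f y * (s' * k x y) \<partial>M) = (\<integral>y. s' * (k x y * f y) \<partial>M)"
    by (simp add: mult_ac)
  finally show ?thesis by (simp add: pot_def)
qed

lemma exp_kf_int: assumes "bdd f" shows "integrable M (\<lambda>y. exp (s' * k x y) * f y)"
proof -
  obtain A where A: "0 \<le> A" "\<And>x. \<bar>f x\<bar> \<le> A" using assms(1) by (elim bddE) blast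
  have [measurable]: "f \<in> borel_measurable M" using assms by (rule bdd_meas)
  show ?thesis
    by (rule Bochner_Integration.integrable_bound[OF integrable_mult_right[OF exp_k_int[of x], of A]])
       (use A in \<open>auto simp: abs_mult mult.commute intro!: mult_mono\<close>)
qed

lemma exp_pot_le:
  assumes "dens f"
  shows "exp (s' * pot f x) \<le> (\<integral>y. exp (s' * k x y) * f y \<partial>M)"
proof -
  let ?m = "s' * pot f x"
  note f = densD[OF assms]
  have "exp ?m = (\<integral>y. exp ?m * (f y + (s' * (k x y * f y) - ?m * f y)) \<partial>M)"
    using kf_int[OF f(1)] bdd_int[OF f(1)] f(3) by (simp add: pot_def)
  also have "\<dots> \<le> (\<integral>y. exp (s' * k x y) * f y \<partial>M)" \<comment> \<open>Jensen: the tangent of \<open>exp\<close> at the mean\<close>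
  proof (intro integral_mono exp_kf_int f integrable_mult_right Bochner_Integration.integrable_add
      Bochner_Integration.integrable_diff kf_int bdd_int)
    fix y
    have "exp ?m * (1 + (s' * k x y - ?m)) \<le> exp ?m * exp (s' * k x y - ?m)"
      by (intro mult_left_mono) auto
    also have "\<dots> = exp (s' * k x y)" by (simp add: exp_diff)
    finally have "exp ?m * (1 + (s' * k x y - ?m)) * f y \<le> exp (s' * k x y) * f y"
      using f(2) by (rule mult_right_mono)
    then show "exp ?m * (f y + (s' * (k x y * f y) - ?m * f y)) \<le> exp (s' * k x y) * f y"
      by (simp add: algebra_simps)
  qed
  finally show ?thesis .
qed

text \<open>Jensen moves the average over \<open>f\<close> outside the exponential. After Tonelli
  the inner integral is the one in \<open>exp_bound\<close>, whose bound does not depend on the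
  point, so only the mass of \<open>f\<close> remains.\<close>

lemma int_exp_pot_le:
  assumes "dens f"
  shows "(\<integral>x. exp (s' * pot f x) \<partial>M) \<le> C"
proof -
  note f = densD[OF assms]
  have [measurable]: "f \<in> borel_measurable M" using f by (intro bdd_meas)
  have ei: "integrable M (\<lambda>x. exp (s' * pot f x))" using f by (intro bdd_int bdd_exp bdd_cmult bdd_pot)
  have "ennreal (\<integral>x. exp (s' * pot f x) \<partial>M) = (\<integral>\<^sup>+x. ennreal (exp (s' * pot f x)) \<partial>M)"
    using ei by (simp add: nn_integral_eq_integral)
  also have "\<dots> \<le> (\<integral>\<^sup>+x. \<integral>\<^sup>+y. ennreal (exp (s' * k x y) * f y) \<partial>M \<partial>M)"
    using f exp_pot_le[OF assms]
    by (intro nn_integral_mono) (simp add: nn_integral_eq_integral exp_kf_int ennreal_leI)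
  also have "\<dots> = (\<integral>\<^sup>+y. \<integral>\<^sup>+x. ennreal (exp (s' * k x y) * f y) \<partial>M \<partial>M)"
    by (rule MM.Fubini'[symmetric]) (simp add: case_prod_beta')
  also have "\<dots> = (\<integral>\<^sup>+y. ennreal (f y) * (\<integral>\<^sup>+x. ennreal (exp (s' * k y x)) \<partial>M) \<partial>M)"
    using f by (subst nn_integral_cmult[symmetric]) (auto simp: ennreal_mult k_sym mult.commute)
  also have "\<dots> \<le> (\<integral>\<^sup>+y. ennreal (f y) * ennreal C \<partial>M)"
    by (intro nn_integral_mono mult_left_mono exp_bound) auto
  also have "\<dots> = ennreal C"
    using f bdd_int[OF f(1)] by (simp add: nn_integral_multc nn_integral_eq_integral)
  finally show ?thesis using C_pos by (simp add: ennreal_le_iff)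
qed

text \<open>Gibbs' principle a second time, now with the density's own potential,
  \<open>V = s' * pot f\<close>; \<open>int_exp_pot_le\<close> bounds the partition
  function.\<close>

lemma inter_le_ent:
  assumes "dens f"
  shows "s' * (\<integral>x. f x * pot f x \<partial>M) \<le> ent f + ln C"
proof -
  note f = densD[OF assms]
  have "(\<integral>x. f x * (s' * pot f x) \<partial>M) \<le> ent f + ln C"
    using f by (intro gibbs assms int_exp_pot_le C_pos bdd_int bdd_exp bdd_mult bdd_const bdd_pot)
  then show ?thesis by (simp add: mult.left_commute)
qed

lemma inter_nonneg: "dens f \<Longrightarrow> 0 \<le> (\<integral>x. f x * pot f x \<partial>M)"
  by (intro Bochner_Integration.integral_nonneg mult_nonneg_nonneg pot_nonneg densD)

text \<open>The interaction absorbs only the fraction \<open>s / s'\<close> of the entropy, so a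
  positive multiple of the entropy survives. This coercivity bounds the entropy along minimising
  sequences.\<close>

lemma ent_le_free_energy:
  assumes "dens f"
  shows "(1 - s / s') * ent f \<le> free_energy f + s / s' * ln C"
proof -
  have "s / s' * (s' * (\<integral>x. f x * pot f x \<partial>M)) \<le> s / s' * (ent f + ln C)"
    using s_pos s'_pos by (intro mult_left_mono inter_le_ent assms) auto
  moreover have "s / s' * (s' * (\<integral>x. f x * pot f x \<partial>M)) = s * (\<integral>x. f x * pot f x \<partial>M)"
    using s'_pos by simp
  ultimately show ?thesis unfolding free_energy_def by (simp add: algebra_simps)
qed

lemma free_energy_bdd_below: "bdd_below (free_energy ` Collect dens)"
proof (rule bdd_belowI2)
  fix f assume "f \<in> Collect dens"
  then have f: "dens f" by simp
  have "0 \<le> ent f + ln C"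
    using inter_le_ent[OF f] inter_nonneg[OF f] s'_pos by (smt (verit) mult_nonneg_nonneg)
  moreover have "0 \<le> 1 - s / s'" using s_pos s_less by simp
  ultimately have "0 \<le> (1 - s / s') * (ent f + ln C)" by simp
  with ent_le_free_energy[OF f] show "- ln C \<le> free_energy f" by (simp add: algebra_simps)
qed

lemma dens_ex: "dens (\<lambda>_. 1 / measure M UNIV)"
  unfolding dens_def using M_pos space_UNIV by (simp add: bdd_const)

text \<open>The Gibbs density of the potential \<open>v\<close>. Critical densities of the free
  energy satisfy \<open>f = emap (pot f)\<close>; the factor 2 is the derivative of the quadratic
  interaction term.\<close>

definition emap :: "('a \<Rightarrow> real) \<Rightarrow> 'a \<Rightarrow> real" where
  "emap v x = exp (2 * s * v x) / (\<integral>y. exp (2 * s * v y) \<partial>M)"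

lemma exp_int_ge:
  assumes "bdd v" "\<And>x. 0 \<le> v x"
  shows "measure M UNIV \<le> (\<integral>y. exp (2 * s * v y) \<partial>M)"
proof -
  have "(\<integral>y. 1 \<partial>M) \<le> (\<integral>y. exp (2 * s * v y) \<partial>M)"
    using assms s_pos by (intro integral_mono bdd_int bdd_exp bdd_cmult bdd_const) auto
  then show ?thesis using space_UNIV by simp
qed

text \<open>As \<open>v\<close> is nonnegative, the partition function is at least the mass of
  \<open>M\<close>, so an upper bound on the potential alone bounds the density.\<close>

lemma emap_le:
  assumes "bdd v" "\<And>x. 0 \<le> v x" "v x \<le> c"
  shows "emap v x \<le> exp (2 * s * c) / measure M UNIV"
  unfolding emap_def
  using exp_int_ge[OF assms(1,2)] M_pos assms s_pos
  by (intro frac_le) auto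

lemma emap_pos:
  assumes "bdd v" "\<And>x. 0 \<le> v x"
  shows "0 < emap v x"
  unfolding emap_def using exp_int_ge[OF assms(1,2)] M_pos by auto

lemma dens_emap:
  assumes "bdd v" "\<And>x. 0 \<le> v x"
  shows "dens (emap v)"
proof -
  have b: "bdd (emap v)" unfolding emap_def using assms by (intro bdd_div bdd_exp bdd_cmult)
  have "(\<integral>x. emap v x \<partial>M) = 1" unfolding emap_def
    using exp_int_ge[OF assms] M_pos by simp
  with b emap_pos[OF assms] show ?thesis by (auto simp: dens_def less_imp_le)
qed

text \<open>For a density \<open>f\<close>, the relative entropy of \<open>f\<close> with respect to
  \<open>emap (pot f)\<close>, with the logarithm of \<open>emap\<close> written out and the mass 1
  of \<open>f\<close> inserted.\<close>

definition kl :: "('a \<Rightarrow> real) \<Rightarrow> real" where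
  "kl f = ent f - 2 * s * (\<integral>x. f x * pot f x \<partial>M) + ln (\<integral>y. exp (2 * s * pot f y) \<partial>M)"

lemma hellinger_kl:
  assumes "dens f"
  shows "(\<integral>x. (sqrt (f x) - sqrt (emap (pot f) x))\<^sup>2 \<partial>M) \<le> kl f"
    and "integrable M (\<lambda>x. (sqrt (f x) - sqrt (emap (pot f) x))\<^sup>2)"
proof -
  note f = densD[OF assms]
  let ?g = "emap (pot f)" let ?Z = "\<integral>y. exp (2 * s * pot f y) \<partial>M"
  have p: "bdd (pot f)" "\<And>x. 0 \<le> pot f x" using f by (auto intro: bdd_pot pot_nonneg)
  note g = densD[OF dens_emap[OF p]]
  have Z: "?Z > 0" using exp_int_ge[OF p] M_pos by linarith
  have lng: "ln (?g x) = 2 * s * pot f x - ln ?Z" for x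
    using Z by (simp add: emap_def ln_div)
  have [measurable]: "f \<in> borel_measurable M" "?g \<in> borel_measurable M" using f g by (auto intro: bdd_meas)
  have pf: "bdd (\<lambda>x. f x * pot f x)" by (intro bdd_mult f p)
  have le: "(sqrt (f x) - sqrt (?g x))\<^sup>2 \<le> f x * ln (f x) - (2 * s * (f x * pot f x) - ln ?Z * f x) - f x + ?g x" for x
    using hellinger_le[OF f(2)[of x] emap_pos[OF p, of x]] lng[of x] by (simp add: algebra_simps)
  have int: "integrable M (\<lambda>x. f x * ln (f x) - (2 * s * (f x * pot f x) - ln ?Z * f x) - f x + ?g x)"
    using f g pf by (intro bdd_int bdd_diff bdd_add bdd_xlnx bdd_cmult)
  show hi: "integrable M (\<lambda>x. (sqrt (f x) - sqrt (?g x))\<^sup>2)"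
  proof (rule Bochner_Integration.integrable_bound[OF int], measurable, rule AE_I2)
    fix x
    show "norm ((sqrt (f x) - sqrt (?g x))\<^sup>2) \<le> norm (f x * ln (f x) - (2 * s * (f x * pot f x) - ln ?Z * f x) - f x + ?g x)"
      using le[of x] by (smt (verit) real_norm_def zero_le_power2)
  qed
  have "(\<integral>x. (sqrt (f x) - sqrt (?g x))\<^sup>2 \<partial>M) \<le> (\<integral>x. f x * ln (f x) - (2 * s * (f x * pot f x) - ln ?Z * f x) - f x + ?g x \<partial>M)"
    by (intro integral_mono hi int le)
  also have "\<dots> = ent f - (2 * s * (\<integral>x. f x * pot f x \<partial>M) - ln ?Z) - 1 + 1"
    using f g pf by (simp add: ent_def bdd_int bdd_xlnx)
  finally show "(\<integral>x. (sqrt (f x) - sqrt (?g x))\<^sup>2 \<partial>M) \<le> kl f" by (simp add: kl_def)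
qed

text \<open>Two tangent-line inequalities at the mixture \<open>?m\<close>, weighted with
  \<open>1 - t\<close> and \<open>t\<close>; their linear terms cancel.\<close>

lemma xlnx_convex:
  fixes a b t :: real
  assumes "0 \<le> a" "0 \<le> b" "0 \<le> t" "t \<le> 1"
  shows "((1 - t) * a + t * b) * ln ((1 - t) * a + t * b) \<le> (1 - t) * (a * ln a) + t * (b * ln b)"
proof -
  let ?m = "(1 - t) * a + t * b"
  have m: "0 \<le> ?m" using assms by simp
  show ?thesis
  proof (cases "?m = 0")
    case True
    then have "(1 - t) * a = 0" "t * b = 0" using assms
      by (smt (verit) mult_nonneg_nonneg)+
    then show ?thesis using True by auto
  next
    case False
    with m have m: "?m > 0" by simp
    have "a * ln ?m \<le> a * ln a - a + ?m" "b * ln ?m \<le> b * ln b - b + ?m"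
      using young_exp_ln[of a "ln ?m"] young_exp_ln[of b "ln ?m"] assms m by simp_all
    then have "(1 - t) * (a * ln ?m) + t * (b * ln ?m) \<le> (1 - t) * (a * ln a - a + ?m) + t * (b * ln b - b + ?m)"
      using assms by (intro add_mono mult_left_mono) auto
    then show ?thesis by (simp add: algebra_simps)
  qed
qed

text \<open>Along the segment from \<open>f\<close> to \<open>emap (pot f)\<close> the free energy decreases to first order at rate
  \<open>kl f\<close>, so this rate is small at a near-minimiser.\<close>

lemma kl_bound:
  assumes f: "dens f" and t: "0 < t" "t \<le> 1"
    and near: "\<And>h. dens h \<Longrightarrow> free_energy f \<le> free_energy h + t\<^sup>2"
    and bounds: "\<And>x. pot f x \<le> c" "\<And>x. pot (emap (pot f)) x \<le> c"
  shows "kl f \<le> t * (1 + 2 * s * c)"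
proof -
  note ff = densD[OF f]
  let ?g = "emap (pot f)" let ?Z = "\<integral>y. exp (2 * s * pot f y) \<partial>M"
  have p: "bdd (pot f)" "\<And>x. 0 \<le> pot f x" using ff by (auto intro: bdd_pot pot_nonneg)
  note g' = dens_emap[OF p] note g = densD[OF g']
  have Z: "?Z > 0" using exp_int_ge[OF p] M_pos by linarith
  have pg: "bdd (pot ?g)" "\<And>x. 0 \<le> pot ?g x" using g by (auto intro: bdd_pot pot_nonneg)
  let ?h = "\<lambda>x. (1 - t) * f x + t * ?g x"
  have hb: "bdd ?h" by (intro bdd_add bdd_cmult ff g)
  have h: "dens ?h"
    unfolding dens_def using hb ff g t by (auto simp: bdd_int)
  note b = bdd_int bdd_mult bdd_xlnx ff g p pg
  have "ent ?h \<le> (\<integral>x. (1 - t) * (f x * ln (f x)) + t * (?g x * ln (?g x)) \<partial>M)"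
    unfolding ent_def using t ff g densD(2)[OF h]
    by (intro integral_mono bdd_int bdd_xlnx bdd_add bdd_cmult hb xlnx_convex) auto
  also have "\<dots> = (1 - t) * ent f + t * ent ?g"
    by (simp add: ent_def b)
  finally have E: "ent ?h \<le> (1 - t) * ent f + t * ent ?g" .
  have "?g x * ln (?g x) = 2 * s * (?g x * pot f x) - ln ?Z * ?g x" for x
    using Z by (simp add: emap_def ln_div algebra_simps diff_divide_distrib)
  then have Eg: "ent ?g = 2 * s * (\<integral>x. ?g x * pot f x \<partial>M) - ln ?Z"
    using g by (simp add: ent_def b)
  let ?ff = "\<integral>x. f x * pot f x \<partial>M" and ?gf = "\<integral>x. ?g x * pot f x \<partial>M"
    and ?fg = "\<integral>x. f x * pot ?g x \<partial>M" and ?gg = "\<integral>x. ?g x * pot ?g x \<partial>M"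
  have fg: "?fg = ?gf" by (rule pot_sym[OF ff(1) g(1)])
  have ph: "pot ?h x = (1 - t) * pot f x + t * pot ?g x" for x
    by (simp add: pot_add bdd_cmult ff g pot_cmult)
  have "(\<integral>x. ?h x * pot ?h x \<partial>M) =
      (\<integral>x. (1 - t)\<^sup>2 * (f x * pot f x) + (1 - t) * t * (?g x * pot f x) + (1 - t) * t * (f x * pot ?g x) + t\<^sup>2 * (?g x * pot ?g x) \<partial>M)"
    by (intro Bochner_Integration.integral_cong refl) (unfold ph, simp add: power2_eq_square algebra_simps)
  also have "\<dots> = (1 - t)\<^sup>2 * ?ff + (1 - t) * t * ?gf + (1 - t) * t * ?fg + t\<^sup>2 * ?gg"
    by (simp add: b)
  finally have I: "(\<integral>x. ?h x * pot ?h x \<partial>M) = ?ff + 2 * t * (?gf - ?ff) + t\<^sup>2 * (?ff - 2 * ?gf + ?gg)"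
    unfolding fg by (simp add: power2_eq_square algebra_simps)
  have "?ff \<ge> 0" "?gg \<ge> 0" using inter_nonneg f g' by auto
  have "?gf \<le> (\<integral>x. c * ?g x \<partial>M)"
    using bounds g by (intro integral_mono b bdd_int bdd_cmult) (auto simp: mult.commute intro!: mult_right_mono)
  then have gfc: "?gf \<le> c" using g by simp
  \<comment> \<open>Substituting \<open>Eg\<close> turns the first-order coefficient into exactly
    \<open>- kl f\<close>. Of the quadratic remainder only \<open>?gf\<close> has the wrong sign,
    and it is at most \<open>c\<close>.\<close>
  have "free_energy ?h \<le> (1 - t) * ent f + t * ent ?g - s * (?ff + 2 * t * (?gf - ?ff) + t\<^sup>2 * (?ff - 2 * ?gf + ?gg))"
    unfolding free_energy_def I using E by simp
  also have "\<dots> = free_energy f - t * kl f - s * t\<^sup>2 * (?ff - 2 * ?gf + ?gg)"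
    unfolding Eg free_energy_def kl_def by (simp add: algebra_simps)
  also have "\<dots> \<le> free_energy f - t * kl f + s * t\<^sup>2 * (2 * c)"
  proof -
    have "s * t\<^sup>2 * (- (2 * c)) \<le> s * t\<^sup>2 * (?ff - 2 * ?gf + ?gg)"
      using s_pos \<open>?ff \<ge> 0\<close> \<open>?gg \<ge> 0\<close> gfc by (intro mult_left_mono) auto
    then show ?thesis by simp
  qed
  \<comment> \<open>Both the slack allowed by \<open>near\<close> and the remainder are of order
    \<open>t\<^sup>2\<close>, so one factor \<open>t\<close> can be divided out.\<close>
  finally have "free_energy f - t\<^sup>2 \<le> free_energy f - t * kl f + s * t\<^sup>2 * (2 * c)"
    using near[OF h] by simp
  then have "t * kl f \<le> t * (t * (1 + 2 * s * c))" by (simp add: power2_eq_square algebra_simps)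
  then show ?thesis using t by simp
qed

section \<open>Stability of potentials and the passage to the limit\<close>

lemma pot_L1:
  assumes "bdd f"
  shows "(\<integral>x. \<bar>pot f x\<bar> \<partial>M) \<le> K * (\<integral>x. \<bar>f x\<bar> \<partial>M)"
proof -
  let ?a = "\<lambda>x. \<bar>f x\<bar>"
  have a: "bdd ?a" using assms by (rule bdd_abs)
  have "(\<integral>x. \<bar>pot f x\<bar> \<partial>M) \<le> (\<integral>x. 1 * pot ?a x \<partial>M)"
  proof (intro integral_mono bdd_int bdd_abs bdd_pot bdd_mult bdd_const a assms)
    fix x
    have "\<bar>pot f x\<bar> \<le> (\<integral>y. \<bar>k x y * f y\<bar> \<partial>M)"
      unfolding pot_def by (rule integral_abs_bound)
    also have "\<dots> = pot ?a x" unfolding pot_def using k_nonneg by (simp add: abs_mult)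
    finally show "\<bar>pot f x\<bar> \<le> 1 * pot ?a x" by simp
  qed
  \<comment> \<open>By symmetry of the kernel the potential moves onto the constant 1, where
    \<open>k_int_le\<close> applies.\<close>
  also have "\<dots> = (\<integral>x. ?a x * pot (\<lambda>_. 1) x \<partial>M)" by (intro pot_sym bdd_const a)
  also have "\<dots> \<le> (\<integral>x. K * ?a x \<partial>M)"
  proof (intro integral_mono bdd_int bdd_mult bdd_pot bdd_const a)
    fix x
    have "pot (\<lambda>_. 1) x \<le> K" using k_int_le by (simp add: pot_def)
    then show "\<bar>f x\<bar> * pot (\<lambda>_. 1) x \<le> K * \<bar>f x\<bar>"
      using mult_right_mono[OF _ abs_ge_zero[of "f x"], of "pot (\<lambda>_. 1) x" K] by (simp only: mult.commute)
  qed
  finally show ?thesis by simp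
qed


lemma pot_converge_L1:
  assumes "\<And>j. bdd (h j)" "bdd g" "(\<lambda>j. \<integral>x. \<bar>h j x - g x\<bar> \<partial>M) \<longlonglongrightarrow> 0"
  shows "(\<lambda>j. \<integral>x. \<bar>pot (h j) x - pot g x\<bar> \<partial>M) \<longlonglongrightarrow> 0"
proof (rule null_sandwich)
  show "(\<lambda>j. K * (\<integral>x. \<bar>h j x - g x\<bar> \<partial>M)) \<longlonglongrightarrow> 0"
    using tendsto_mult_left[OF assms(3), of K] by simp
  show "\<forall>\<^sub>F j in sequentially. (\<integral>x. \<bar>pot (h j) x - pot g x\<bar> \<partial>M) \<le> K * (\<integral>x. \<bar>h j x - g x\<bar> \<partial>M)"
    using pot_L1[OF bdd_diff[OF assms(1,2)]] assms by (intro always_eventually allI) (simp add: pot_diff)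
qed auto

lemma L1_triangle_zero:
  assumes "\<And>j. bdd (h j)" "bdd f" "bdd g"
    "(\<lambda>j. \<integral>x. \<bar>h j x - f x\<bar> \<partial>M) \<longlonglongrightarrow> 0" "(\<lambda>j. \<integral>x. \<bar>h j x - g x\<bar> \<partial>M) \<longlonglongrightarrow> 0"
  shows "AE x in M. f x = g x"
proof -
  have i: "integrable M (\<lambda>x. \<bar>f x - g x\<bar>)" using assms by (intro bdd_int bdd_abs bdd_diff)
  have "(\<integral>x. \<bar>f x - g x\<bar> \<partial>M) \<le> (\<integral>x. \<bar>h j x - f x\<bar> \<partial>M) + (\<integral>x. \<bar>h j x - g x\<bar> \<partial>M)" for j
  proof -
    have "(\<integral>x. \<bar>f x - g x\<bar> \<partial>M) \<le> (\<integral>x. \<bar>h j x - f x\<bar> + \<bar>h j x - g x\<bar> \<partial>M)"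
      using assms by (intro integral_mono i bdd_int bdd_add bdd_abs bdd_diff) auto
    also have "\<dots> = (\<integral>x. \<bar>h j x - f x\<bar> \<partial>M) + (\<integral>x. \<bar>h j x - g x\<bar> \<partial>M)"
      using assms by (intro Bochner_Integration.integral_add bdd_int bdd_abs bdd_diff)
    finally show ?thesis .
  qed
  then have "(\<integral>x. \<bar>f x - g x\<bar> \<partial>M) \<le> 0 + 0"
    by (intro tendsto_lowerbound[OF tendsto_add[OF assms(4,5)]]) auto
  moreover have "0 \<le> (\<integral>x. \<bar>f x - g x\<bar> \<partial>M)" by (intro Bochner_Integration.integral_nonneg) auto
  ultimately have "(\<integral>x. \<bar>f x - g x\<bar> \<partial>M) = 0" by simp
  then have "AE x in M. \<bar>f x - g x\<bar> = 0"
    using i by (subst (asm) integral_nonneg_eq_0_iff_AE) auto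
  then show ?thesis by simp
qed

lemma near_minimizer:
  assumes t: "0 < t" "t \<le> 1"
  obtains f where "dens f" "\<And>h. dens h \<Longrightarrow> free_energy f \<le> free_energy h + t\<^sup>2"
proof -
  let ?S = "free_energy ` Collect dens"
  have "?S \<noteq> {}" using dens_ex by auto
  then obtain f where "dens f" "free_energy f < Inf ?S + t\<^sup>2"
    using t free_energy_bdd_below cInf_less_iff[of ?S "Inf ?S + t\<^sup>2"] by auto
  moreover have "Inf ?S \<le> free_energy h" if "dens h" for h
    using that free_energy_bdd_below by (intro cInf_lower) auto
  ultimately show ?thesis by (intro that[of f]) (auto intro: less_imp_le order_trans)
qed

text \<open>Take \<open>\<eta> = t\<close> in \<open>abs_diff_le_hellinger\<close>: a relative
  entropy of order \<open>t\<^sup>2\<close> then yields an L1 distance of order \<open>t\<close>.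
  The 2 is the total mass of the two densities.\<close>

lemma L1_emap:
  assumes f: "dens f" and t: "0 < t" "kl f \<le> t\<^sup>2 * c"
  shows "(\<integral>x. \<bar>f x - emap (pot f) x\<bar> \<partial>M) \<le> t * (c / 2 + 2)"
proof -
  note ff = densD[OF f]
  let ?g = "emap (pot f)"
  have p: "bdd (pot f)" "\<And>x. 0 \<le> pot f x" using ff by (auto intro: bdd_pot pot_nonneg)
  note g = densD[OF dens_emap[OF p]]
  note h = hellinger_kl[OF f]
  have "(\<integral>x. \<bar>f x - ?g x\<bar> \<partial>M) \<le> (\<integral>x. (sqrt (f x) - sqrt (?g x))\<^sup>2 / (2 * t) + t * (f x + ?g x) \<partial>M)"
    using t ff g
    by (intro integral_mono abs_diff_le_hellinger Bochner_Integration.integrable_add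
        integrable_divide h(2) bdd_int bdd_abs bdd_diff bdd_cmult bdd_add) auto
  also have "\<dots> = (\<integral>x. (sqrt (f x) - sqrt (?g x))\<^sup>2 \<partial>M) / (2 * t) + t * 2"
    using ff g h(2) by (simp add: bdd_int)
  also have "\<dots> \<le> t\<^sup>2 * c / (2 * t) + t * 2"
    using h(1) t by (intro add_right_mono divide_right_mono) auto
  also have "\<dots> = t * (c / 2 + 2)" using t by (simp add: power2_eq_square field_simps)
  finally show ?thesis .
qed

text \<open>Compactness of the potentials is an assumption here, so that this argument stays purely
  measure-theoretic; the metric enters in \<open>continuous_exp_kernel\<close>.\<close>

theorem fixed_point:
  assumes cpt: "\<And>B g. (\<And>j. g j \<in> borel_measurable M) \<Longrightarrow> (\<And>j x. 0 \<le> g j x) \<Longrightarrow> (\<And>j x. g j x \<le> B) \<Longrightarrow>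
    \<exists>r v. strict_mono (r :: nat \<Rightarrow> nat) \<and> (\<forall>x. (\<lambda>j. pot (g (r j)) x) \<longlonglongrightarrow> v x)"
  obtains g where "dens g" "\<And>x. pot (emap (pot g)) x = pot g x"
proof -
  \<comment> \<open>A chain of bounds valid for every \<open>f j\<close>: \<open>c0\<close> for the
    free energy (compare with the constant density, slack at most 1), \<open>e0\<close> for the
    entropy, \<open>c1\<close> for the potential, \<open>B\<close> for the density
    \<open>g j\<close>; \<open>c\<close> bounds the potentials of both \<open>f j\<close> and
    \<open>g j\<close>.\<close>
  define c0 where "c0 = free_energy (\<lambda>_. 1 / measure M UNIV) + 1"
  define e0 where "e0 = (c0 + s / s' * ln C) / (1 - s / s')"
  define c1 where "c1 = (e0 + ln C) / s'"
  define B where "B = exp (2 * s * c1) / measure M UNIV"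
  define c where "c = max c1 (B * K)"
  define t where "t = (\<lambda>j. 1 / real (Suc j))"
  have t: "0 < t j" "t j \<le> 1" for j by (auto simp: t_def)
  \<comment> \<open>The slack is a fourth power because its order is halved twice:
    \<open>kl_bound\<close>, applied with \<open>(t j)\<^sup>2\<close>, leaves a relative entropy of
    order \<open>(t j)\<^sup>2\<close>, and \<open>L1_emap\<close> leaves an L1 distance of order
    \<open>t j\<close>.\<close>
  have "\<exists>f. dens f \<and> (\<forall>h. dens h \<longrightarrow> free_energy f \<le> free_energy h + ((t j)\<^sup>2)\<^sup>2)" for j
    using near_minimizer[of "(t j)\<^sup>2"] t[of j] by (metis power_le_one zero_less_power less_imp_le)
  then obtain f where f: "\<And>j. dens (f j)"
      and fmin: "\<And>j h. dens h \<Longrightarrow> free_energy (f j) \<le> free_energy h + ((t j)\<^sup>2)\<^sup>2"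
    by metis
  note ff = densD[OF f]
  have p: "bdd (pot (f j))" "0 \<le> pot (f j) x" for j x using ff by (auto intro: bdd_pot pot_nonneg)
  have pc1: "pot (f j) x \<le> c1" for j x
  proof -
    have "((t j)\<^sup>2)\<^sup>2 \<le> 1" using t[of j] by (intro power_le_one) auto
    with fmin[OF dens_ex, of j] have "free_energy (f j) \<le> c0" by (simp add: c0_def)
    with ent_le_free_energy[OF f, of j] have "(1 - s / s') * ent (f j) \<le> c0 + s / s' * ln C" by linarith
    moreover have "0 < 1 - s / s'" using s_pos s_less by simp
    ultimately have "ent (f j) \<le> e0" by (simp add: e0_def field_simps)
    with pot_le_ent[OF f, of j x] show ?thesis using s'_pos by (simp add: c1_def field_simps)
  qed
  \<comment> \<open>Only \<open>g\<close> is bounded uniformly in \<open>j\<close>, so compactness is applied to the potentials of \<open>g\<close>, not of \<open>f\<close>.\<close>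
  define g where "g j = emap (pot (f j))" for j
  have g: "dens (g j)" for j unfolding g_def by (intro dens_emap p)
  note gg = densD[OF g]
  have gB: "g j x \<le> B" for j x unfolding g_def B_def by (intro emap_le p pc1)
  have pgB: "pot (g j) x \<le> B * K" for j x
    using pot_mono_bound[of "g j" B x] gg(2) gB bdd_meas[OF gg(1)] by auto
  obtain r v where r: "strict_mono (r :: nat \<Rightarrow> nat)" and v: "\<And>x. (\<lambda>j. pot (g (r j)) x) \<longlonglongrightarrow> v x"
    using cpt[of g B] gg(2) gB bdd_meas[OF gg(1)] by blast
  have t0: "t \<longlonglongrightarrow> 0" unfolding t_def by (rule LIMSEQ_inverse_real_of_nat[unfolded inverse_eq_divide])
  have fg: "(\<lambda>j. \<integral>x. \<bar>f j x - g j x\<bar> \<partial>M) \<longlonglongrightarrow> 0"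
  proof (rule null_sandwich)
    show "\<forall>\<^sub>F j in sequentially. (\<integral>x. \<bar>f j x - g j x\<bar> \<partial>M) \<le> t j * ((1 + 2 * s * c) / 2 + 2)"
    proof (intro always_eventually allI)
      fix j
      have "kl (f j) \<le> (t j)\<^sup>2 * (1 + 2 * s * c)"
        using t[of j] pc1 pgB by (intro kl_bound f fmin) (auto simp: c_def g_def le_max_iff_disj power_le_one)
      then show "(\<integral>x. \<bar>f j x - g j x\<bar> \<partial>M) \<le> t j * ((1 + 2 * s * c) / 2 + 2)"
        unfolding g_def using t by (intro L1_emap f)
    qed
    show "(\<lambda>j. t j * ((1 + 2 * s * c) / 2 + 2)) \<longlonglongrightarrow> 0"
      using tendsto_mult_right[OF t0] by simp
  qed auto
  have [measurable]: "pot (g j) \<in> borel_measurable M" for j using bdd_meas[OF gg(1)] by measurable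
  have vm [measurable]: "v \<in> borel_measurable M" by (rule borel_measurable_LIMSEQ_real[OF v]) measurable
  have v0: "0 \<le> v x" "v x \<le> B * K" for x
    using tendsto_lowerbound[OF v, of 0 x] tendsto_upperbound[OF v, of x "B * K"] pgB gg(2)
    by (auto simp: pot_nonneg)
  have bv: "bdd v" using v0 by (intro bddI[of _ "B * K"] vm) auto
  have "(\<lambda>j. \<integral>x. \<bar>pot (g (r j)) x - v x\<bar> \<partial>M) \<longlonglongrightarrow> (\<integral>x. 0 \<partial>M)"
  proof (rule integral_dominated_convergence[where w = "\<lambda>_. B * K + B * K"])
    show "AE x in M. (\<lambda>j. \<bar>pot (g (r j)) x - v x\<bar>) \<longlonglongrightarrow> 0"
      using v by (intro AE_I2 tendsto_rabs_zero) (simp add: LIM_zero_iff)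
    show "AE x in M. norm \<bar>pot (g (r j)) x - v x\<bar> \<le> B * K + B * K" for j
    proof (rule AE_I2)
      fix x
      have "0 \<le> pot (g (r j)) x" using gg(2) by (rule pot_nonneg)
      then show "norm \<bar>pot (g (r j)) x - v x\<bar> \<le> B * K + B * K"
        using v0[of x] pgB[of "r j" x] by auto
    qed
  qed auto
  then have pgv: "(\<lambda>j. \<integral>x. \<bar>pot (g (r j)) x - v x\<bar> \<partial>M) \<longlonglongrightarrow> 0" by simp
  \<comment> \<open>The potentials of \<open>f (r j)\<close> inherit the limit \<open>v\<close> in
    L1, since \<open>f j\<close> and \<open>g j\<close> are L1-close and \<open>pot\<close> is
    L1-continuous.\<close>
  have pfv: "(\<lambda>j. \<integral>x. \<bar>pot (f (r j)) x - v x\<bar> \<partial>M) \<longlonglongrightarrow> 0"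
  proof (rule null_sandwich)
    have 2: "(\<lambda>j. K * (\<integral>x. \<bar>f (r j) x - g (r j) x\<bar> \<partial>M)) \<longlonglongrightarrow> K * 0"
      using LIMSEQ_subseq_LIMSEQ[OF fg r] by (intro tendsto_mult_left) (simp add: o_def)
    show "(\<lambda>j. K * (\<integral>x. \<bar>f (r j) x - g (r j) x\<bar> \<partial>M) + (\<integral>x. \<bar>pot (g (r j)) x - v x\<bar> \<partial>M)) \<longlonglongrightarrow> 0"
      using tendsto_add[OF 2 pgv] by simp
    show "\<forall>\<^sub>F j in sequentially. (\<integral>x. \<bar>pot (f (r j)) x - v x\<bar> \<partial>M) \<le>
        K * (\<integral>x. \<bar>f (r j) x - g (r j) x\<bar> \<partial>M) + (\<integral>x. \<bar>pot (g (r j)) x - v x\<bar> \<partial>M)"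
    proof (intro always_eventually allI)
      fix j
      note b = bdd_int bdd_add bdd_abs bdd_diff bdd_pot ff(1) gg(1) bv
      have "(\<integral>x. \<bar>pot (f (r j)) x - v x\<bar> \<partial>M)
          \<le> (\<integral>x. \<bar>pot (\<lambda>x. f (r j) x - g (r j) x) x\<bar> + \<bar>pot (g (r j)) x - v x\<bar> \<partial>M)"
        by (intro integral_mono b) (simp add: pot_diff b)
      also have "\<dots> = (\<integral>x. \<bar>pot (\<lambda>x. f (r j) x - g (r j) x) x\<bar> \<partial>M) + (\<integral>x. \<bar>pot (g (r j)) x - v x\<bar> \<partial>M)"
        by (intro Bochner_Integration.integral_add b)
      finally show "(\<integral>x. \<bar>pot (f (r j)) x - v x\<bar> \<partial>M) \<le>
          K * (\<integral>x. \<bar>f (r j) x - g (r j) x\<bar> \<partial>M) + (\<integral>x. \<bar>pot (g (r j)) x - v x\<bar> \<partial>M)"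
        using pot_L1[OF bdd_diff[OF ff(1)[of "r j"] gg(1)[of "r j"]]] by linarith
    qed
  qed auto
  define a where "a j x = exp (2 * s * pot (f (r j)) x)" for j x
  define a' where "a' x = exp (2 * s * v x)" for x
  define Z where "Z j = (\<integral>x. a j x \<partial>M)" for j
  define Z' where "Z' = (\<integral>x. a' x \<partial>M)"
  have ba: "bdd (a j)" "bdd a'" for j unfolding a_def a'_def by (intro bdd_exp bdd_cmult p bv)+
  have Zge: "measure M UNIV \<le> Z j" "measure M UNIV \<le> Z'" for j
    unfolding Z_def Z'_def a_def a'_def by (intro exp_int_ge p bv v0)+
  have Zp: "0 < Z j" "0 < Z'" for j using Zge(1)[of j] Zge(2) M_pos by linarith+
  have aa: "(\<lambda>j. \<integral>x. \<bar>a j x - a' x\<bar> \<partial>M) \<longlonglongrightarrow> 0"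
  proof (rule null_sandwich)
    show "(\<lambda>j. (exp (2 * s * c) * (2 * s)) * (\<integral>x. \<bar>pot (f (r j)) x - v x\<bar> \<partial>M)) \<longlonglongrightarrow> 0"
      using tendsto_mult_left[OF pfv] by simp
    show "\<forall>\<^sub>F j in sequentially. (\<integral>x. \<bar>a j x - a' x\<bar> \<partial>M) \<le>
        (exp (2 * s * c) * (2 * s)) * (\<integral>x. \<bar>pot (f (r j)) x - v x\<bar> \<partial>M)"
    proof (intro always_eventually allI)
      fix j
      have "(\<integral>x. \<bar>a j x - a' x\<bar> \<partial>M) \<le> (\<integral>x. (exp (2 * s * c) * (2 * s)) * \<bar>pot (f (r j)) x - v x\<bar> \<partial>M)"
      proof (intro integral_mono bdd_int bdd_abs bdd_diff bdd_cmult ba p bv)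
        fix x
        have "\<bar>a j x - a' x\<bar> \<le> exp (2 * s * c) * \<bar>2 * s * pot (f (r j)) x - 2 * s * v x\<bar>"
          unfolding a_def a'_def using s_pos pc1 v0 by (intro abs_exp_diff_le) (auto simp: c_def le_max_iff_disj)
        also have "\<bar>2 * s * pot (f (r j)) x - 2 * s * v x\<bar> = 2 * s * \<bar>pot (f (r j)) x - v x\<bar>"
          using s_pos by (simp add: right_diff_distrib[symmetric] abs_mult)
        finally show "\<bar>a j x - a' x\<bar> \<le> exp (2 * s * c) * (2 * s) * \<bar>pot (f (r j)) x - v x\<bar>"
          by (simp add: mult_ac)
      qed
      then show "(\<integral>x. \<bar>a j x - a' x\<bar> \<partial>M) \<le> (exp (2 * s * c) * (2 * s)) * (\<integral>x. \<bar>pot (f (r j)) x - v x\<bar> \<partial>M)"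
        by simp
    qed
  qed auto
  have ZZ: "\<bar>Z j - Z'\<bar> \<le> (\<integral>x. \<bar>a j x - a' x\<bar> \<partial>M)" for j
  proof -
    have "Z j - Z' = (\<integral>x. a j x - a' x \<partial>M)" unfolding Z_def Z'_def by (simp add: ba bdd_int)
    then show ?thesis using integral_abs_bound by metis
  qed
  have g_eq: "g (r j) x = a j x / Z j" for j x by (simp add: g_def emap_def a_def Z_def)
  have v_eq: "emap v x = a' x / Z'" for x by (simp add: emap_def a'_def Z'_def)
  have bev: "bdd (emap v)" using dens_emap[OF bv v0(1)] by (rule densD)
  \<comment> \<open>Numerator and partition function each contribute one copy of the error in
    \<open>aa\<close>, and the partition functions stay above the mass of \<open>M\<close>; hence
    the factor \<open>2 / measure M UNIV\<close>.\<close>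
  have gv: "(\<lambda>j. \<integral>x. \<bar>g (r j) x - emap v x\<bar> \<partial>M) \<longlonglongrightarrow> 0"
  proof (rule null_sandwich)
    show "(\<lambda>j. 2 / measure M UNIV * (\<integral>x. \<bar>a j x - a' x\<bar> \<partial>M)) \<longlonglongrightarrow> 0"
      using tendsto_mult_left[OF aa, of "2 / measure M UNIV"] by simp
    show "\<forall>\<^sub>F j in sequentially. (\<integral>x. \<bar>g (r j) x - emap v x\<bar> \<partial>M) \<le> 2 / measure M UNIV * (\<integral>x. \<bar>a j x - a' x\<bar> \<partial>M)"
    proof (intro always_eventually allI)
      fix j
      let ?D = "\<integral>x. \<bar>a j x - a' x\<bar> \<partial>M"
      have D: "0 \<le> ?D" by simp
      have "(\<integral>x. \<bar>g (r j) x - emap v x\<bar> \<partial>M) \<le> (\<integral>x. \<bar>a j x - a' x\<bar> / Z j + \<bar>Z j - Z'\<bar> / (Z j * Z') * a' x \<partial>M)"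
      proof (intro integral_mono bdd_int bdd_abs bdd_diff bdd_add bdd_div bdd_cmult ba gg bev)
        fix x
        have "a j x / Z j - a' x / Z' = (a j x - a' x) / Z j + (Z' - Z j) / (Z j * Z') * a' x"
          using Zp(1)[of j] Zp(2) by (simp add: field_simps)
        also have "\<bar>\<dots>\<bar> \<le> \<bar>(a j x - a' x) / Z j\<bar> + \<bar>(Z' - Z j) / (Z j * Z') * a' x\<bar>"
          by (rule abs_triangle_ineq)
        also have "\<dots> = \<bar>a j x - a' x\<bar> / Z j + \<bar>Z j - Z'\<bar> / (Z j * Z') * a' x"
          using Zp(1)[of j] Zp(2) by (simp add: abs_mult a'_def abs_minus_commute)
        finally show "\<bar>g (r j) x - emap v x\<bar> \<le> \<bar>a j x - a' x\<bar> / Z j + \<bar>Z j - Z'\<bar> / (Z j * Z') * a' x"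
          unfolding g_eq v_eq .
      qed
      also have "\<dots> = (\<integral>x. \<bar>a j x - a' x\<bar> / Z j \<partial>M) + (\<integral>x. \<bar>Z j - Z'\<bar> / (Z j * Z') * a' x \<partial>M)"
        by (intro Bochner_Integration.integral_add bdd_int bdd_div bdd_abs bdd_diff bdd_cmult ba)
      also have "\<dots> = ?D / Z j + \<bar>Z j - Z'\<bar> / Z j"
        using Zp(1)[of j] Zp(2) by (simp add: Z'_def[symmetric])
      also have "\<dots> \<le> ?D / Z j + ?D / Z j"
        using ZZ[of j] Zp(1)[of j] Zp(2) by (intro add_left_mono divide_right_mono) auto
      also have "\<dots> \<le> ?D / measure M UNIV + ?D / measure M UNIV"
        using Zge(1)[of j] Zge(2) M_pos D by (intro add_mono frac_le) auto
      finally show "(\<integral>x. \<bar>g (r j) x - emap v x\<bar> \<partial>M) \<le> 2 / measure M UNIV * ?D" by simp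
    qed
  qed auto
  \<comment> \<open>Two L1 limits of the same sequence of potentials: \<open>v\<close> by
    compactness, \<open>pot (emap v)\<close> because \<open>g (r j)\<close> tends to
    \<open>emap v\<close>.\<close>
  have fix_AE: "AE x in M. v x = pot (emap v) x"
    using pgv pot_converge_L1[OF gg(1) bev gv]
    by (intro L1_triangle_zero[of "\<lambda>j. pot (g (r j))"] bdd_pot gg bv bev) auto
  \<comment> \<open>\<open>v\<close> solves the equation only almost everywhere. Its representative
    \<open>w\<close> solves it at every point, because changing \<open>v\<close> on a null set
    alters neither the partition function nor any potential.\<close>
  define w where "w = pot (emap v)"
  have wm: "w \<in> borel_measurable M" unfolding w_def using bdd_meas[OF bev] by measurable
  have Zeq: "(\<integral>y. exp (2 * s * w y) \<partial>M) = (\<integral>y. exp (2 * s * v y) \<partial>M)"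
  proof (rule integral_cong_AE)
    show "AE y in M. exp (2 * s * w y) = exp (2 * s * v y)"
      using fix_AE by eventually_elim (simp add: w_def)
  qed (use wm in measurable)
  have "pot (emap w) x = pot (emap v) x" for x
    unfolding pot_def
  proof (rule integral_cong_AE)
    have [measurable]: "emap w \<in> borel_measurable M" "emap v \<in> borel_measurable M"
      unfolding emap_def using wm by measurable
    show "(\<lambda>y. k x y * emap w y) \<in> borel_measurable M" "(\<lambda>y. k x y * emap v y) \<in> borel_measurable M"
      by measurable
    show "AE y in M. k x y * emap w y = k x y * emap v y"
      using fix_AE by eventually_elim (simp add: emap_def Zeq, simp add: w_def)
  qed
  then show ?thesis
    using dens_emap[OF bv v0(1)] by (intro that[of "emap v"]) (auto simp: w_def)
qed

end

text \<open>Continuity in the first argument is asked for almost every \<open>y\<close> only, since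
  a logarithmic kernel is discontinuous at \<open>y = x\<close>.\<close>

locale continuous_exp_kernel = exp_kernel M k s s' C
  for M :: "'a::{metric_space, second_countable_topology} measure" and k s s' C +
  assumes k_cont: "X \<longlonglongrightarrow> x \<Longrightarrow> AE y in M. (\<lambda>j. k (X j) y) \<longlonglongrightarrow> k x y"
begin

text \<open>Where \<open>k\<close> exceeds \<open>L\<close> the excess is at most
  \<open>k\<^sup>2 / L\<close>, and \<open>exp_bound\<close> controls \<open>k\<^sup>2\<close>. The
  estimate is uniform in \<open>x\<close>, so the functions \<open>k x\<close> are uniformly
  integrable.\<close>

lemma k_trunc_le:
  assumes "0 < L"
  shows "(\<integral>y. k x y - min (k x y) L \<partial>M) \<le> 2 * C / s'\<^sup>2 / L"
proof -
  have "(\<integral>y. k x y - min (k x y) L \<partial>M) \<le> (\<integral>y. 2 / s'\<^sup>2 / L * exp (s' * k x y) \<partial>M)"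
  proof (intro integral_mono Bochner_Integration.integrable_diff k_int integrable_mult_right exp_k_int)
    show "integrable M (\<lambda>y. min (k x y) L)"
      using k_int[of x] by (rule Bochner_Integration.integrable_bound) (use assms k_nonneg in auto)
    fix y
    have "k x y - min (k x y) L \<le> (k x y)\<^sup>2 / L"
    proof (cases "k x y \<le> L")
      case False
      then have "k x y * L \<le> k x y * k x y" using k_nonneg by (intro mult_left_mono) auto
      then have "k x y * L - L * L \<le> (k x y)\<^sup>2"
        using assms using mult_pos_pos[OF assms assms] unfolding power2_eq_square by linarith
      then have "(k x y - L) * L \<le> (k x y)\<^sup>2" by (simp only: left_diff_distrib)
      then show ?thesis using assms False by (simp add: pos_le_divide_eq)
    qed (use assms k_nonneg in simp)
    also have "(k x y)\<^sup>2 \<le> 2 / s'\<^sup>2 * exp (s' * k x y)"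
    proof -
      have "(s' * k x y)\<^sup>2 / 2 \<le> exp (s' * k x y)"
        using exp_lower_Taylor_quadratic[of "s' * k x y"] mult_nonneg_nonneg[OF less_imp_le[OF s'_pos] k_nonneg[of x y]] by linarith
      then show ?thesis using s'_pos by (simp add: field_simps power_mult_distrib)
    qed
    finally show "k x y - min (k x y) L \<le> 2 / s'\<^sup>2 / L * exp (s' * k x y)"
      using assms by (simp add: divide_right_mono)
  qed
  also have "\<dots> \<le> 2 / s'\<^sup>2 / L * C"
    using exp_k_le[of x] assms by (simp add: mult_left_mono divide_right_mono)
  finally show ?thesis by simp
qed

lemma k_min_int: "0 < L \<Longrightarrow> integrable M (\<lambda>y. min (k x y) L)"
  using k_int[of x] by (rule Bochner_Integration.integrable_bound) (use k_nonneg in auto)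

text \<open>No common integrable majorant of the \<open>k (X j)\<close> is at hand, so dominated
  convergence is applied to the truncations at level \<open>L\<close>. The two tails fall to
  \<open>k_trunc_le\<close>, with \<open>L\<close> chosen to make each at most
  \<open>e / 4\<close>.\<close>

lemma k_L1_continuous:
  assumes "X \<longlonglongrightarrow> x"
  shows "(\<lambda>j. \<integral>y. \<bar>k (X j) y - k x y\<bar> \<partial>M) \<longlonglongrightarrow> 0"
proof (rule LIMSEQ_I)
  fix e :: real assume e: "0 < e"
  define c where "c = 2 * C / s'\<^sup>2"
  define L where "L = 4 * c / e"
  have "0 < c" unfolding c_def using C_pos s'_pos by simp
  then have L: "0 < L" unfolding L_def using e by simp
  have cL: "c / L = e / 4" unfolding L_def using e \<open>0 < c\<close> by simp
  have "(\<lambda>j. \<integral>y. \<bar>min (k (X j) y) L - min (k x y) L\<bar> \<partial>M) \<longlonglongrightarrow> (\<integral>y. 0 \<partial>M)"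
  proof (rule integral_dominated_convergence[where w = "\<lambda>_. L"])
    show "AE y in M. (\<lambda>j. \<bar>min (k (X j) y) L - min (k x y) L\<bar>) \<longlonglongrightarrow> 0"
      using k_cont[OF assms]
    proof eventually_elim
      case (elim y)
      have "(\<lambda>j. min (k (X j) y) L - min (k x y) L) \<longlonglongrightarrow> min (k x y) L - min (k x y) L"
        by (intro tendsto_intros elim)
      then show ?case by (intro tendsto_rabs_zero) simp
    qed
    show "AE y in M. norm \<bar>min (k (X j) y) L - min (k x y) L\<bar> \<le> L" for j
    proof (rule AE_I2)
      fix y
      show "norm \<bar>min (k (X j) y) L - min (k x y) L\<bar> \<le> L"
        using L k_nonneg[of "X j" y] k_nonneg[of x y] by auto
    qed
  qed auto
  then have "\<forall>\<^sub>F j in sequentially. (\<integral>y. \<bar>min (k (X j) y) L - min (k x y) L\<bar> \<partial>M) < e / 2"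
    using e by (intro order_tendstoD(2)) auto
  then obtain N where N: "\<And>j. j \<ge> N \<Longrightarrow> (\<integral>y. \<bar>min (k (X j) y) L - min (k x y) L\<bar> \<partial>M) < e / 2"
    by (auto simp: eventually_sequentially)
  show "\<exists>N. \<forall>j\<ge>N. norm ((\<integral>y. \<bar>k (X j) y - k x y\<bar> \<partial>M) - 0) < e"
  proof (intro exI allI impI)
    fix j assume j: "j \<ge> N"
    note i = k_int k_min_int[OF L]
    have "(\<integral>y. \<bar>k (X j) y - k x y\<bar> \<partial>M) \<le>
        (\<integral>y. \<bar>min (k (X j) y) L - min (k x y) L\<bar> + ((k (X j) y - min (k (X j) y) L) + (k x y - min (k x y) L)) \<partial>M)"
      by (intro integral_mono integrable_abs Bochner_Integration.integrable_add Bochner_Integration.integrable_diff i) auto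
    also have "\<dots> = (\<integral>y. \<bar>min (k (X j) y) L - min (k x y) L\<bar> \<partial>M)
        + ((\<integral>y. k (X j) y - min (k (X j) y) L \<partial>M) + (\<integral>y. k x y - min (k x y) L \<partial>M))"
      using i by (simp add: Bochner_Integration.integral_add)
    also have "\<dots> < e / 2 + (e / 4 + e / 4)"
      using k_trunc_le[OF L, of "X j"] k_trunc_le[OF L, of x] N[OF j] cL unfolding c_def by linarith
    finally show "norm ((\<integral>y. \<bar>k (X j) y - k x y\<bar> \<partial>M) - 0) < e" by simp
  qed
qed

lemma pot_diff_le:
  assumes "f \<in> borel_measurable M" "\<And>x. \<bar>f x\<bar> \<le> B"
  shows "\<bar>pot f x - pot f x'\<bar> \<le> B * (\<integral>y. \<bar>k x y - k x' y\<bar> \<partial>M)"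
proof -
  have b: "bdd f" using assms by (rule bddI)
  have B: "0 \<le> B" using assms(2) by (meson abs_ge_zero order_trans)
  have "pot f x - pot f x' = (\<integral>y. (k x y - k x' y) * f y \<partial>M)"
    unfolding pot_def using b by (simp add: kf_int left_diff_distrib)
  also have "\<bar>\<dots>\<bar> \<le> (\<integral>y. \<bar>(k x y - k x' y) * f y\<bar> \<partial>M)" by (rule integral_abs_bound)
  also have "\<dots> \<le> (\<integral>y. B * \<bar>k x y - k x' y\<bar> \<partial>M)"
  proof (intro integral_mono)
    show "integrable M (\<lambda>y. \<bar>(k x y - k x' y) * f y\<bar>)" using b by (simp add: kf_int left_diff_distrib)
    show "\<bar>(k x y - k x' y) * f y\<bar> \<le> B * \<bar>k x y - k x' y\<bar>" for y
      using assms(2) B unfolding abs_mult by (subst mult.commute) (rule mult_right_mono, auto)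
  qed (simp add: k_int)
  finally show ?thesis by simp
qed

text \<open>With \<open>pot_diff_le\<close> this gives a modulus of continuity at \<open>x\<close>
  shared by all potentials of functions with a common bound.\<close>

lemma k_L1_equicontinuous:
  assumes "0 < e"
  obtains d where "0 < d" "\<And>x'. dist x' x < d \<Longrightarrow> (\<integral>y. \<bar>k x' y - k x y\<bar> \<partial>M) < e"
proof -
  have "isCont (\<lambda>x'. \<integral>y. \<bar>k x' y - k x y\<bar> \<partial>M) x"
    unfolding continuous_at_sequentially o_def using k_L1_continuous by simp
  then have "\<exists>d>0. \<forall>x'. dist x' x < d \<longrightarrow> dist (\<integral>y. \<bar>k x' y - k x y\<bar> \<partial>M) (\<integral>y. \<bar>k x y - k x y\<bar> \<partial>M) < e"
    using assms unfolding continuous_at_eps_delta by blast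
  then obtain d where "0 < d" "\<forall>x'. dist x' x < d \<longrightarrow> dist (\<integral>y. \<bar>k x' y - k x y\<bar> \<partial>M) (\<integral>y. \<bar>k x y - k x y\<bar> \<partial>M) < e"
    by blast
  then show ?thesis by (intro that[of d]) (auto simp: dist_real_def)
qed

lemma pot_continuous:
  assumes "bdd f"
  shows "continuous_on UNIV (pot f)"
proof -
  obtain B where B: "0 \<le> B" "\<And>x. \<bar>f x\<bar> \<le> B" using assms(1) by (elim bddE) blast
  have "isCont (pot f) x" for x
    unfolding continuous_at_sequentially o_def
  proof (intro allI impI)
    fix X assume "X \<longlonglongrightarrow> x"
    have "(\<lambda>j. \<bar>pot f (X j) - pot f x\<bar>) \<longlonglongrightarrow> 0"
    proof (rule null_sandwich)
      show "(\<lambda>j. B * (\<integral>y. \<bar>k (X j) y - k x y\<bar> \<partial>M)) \<longlonglongrightarrow> 0"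
        using tendsto_mult_left[OF k_L1_continuous[OF \<open>X \<longlonglongrightarrow> x\<close>], of B] by simp
      show "\<forall>\<^sub>F j in sequentially. \<bar>pot f (X j) - pot f x\<bar> \<le> B * (\<integral>y. \<bar>k (X j) y - k x y\<bar> \<partial>M)"
        by (intro always_eventually allI pot_diff_le bdd_meas assms B(2))
    qed simp
    then show "(\<lambda>j. pot f (X j)) \<longlonglongrightarrow> pot f x"
      by (simp add: tendsto_rabs_zero_iff LIM_zero_iff)
  qed
  then show ?thesis by (simp add: continuous_at_imp_continuous_on)
qed

text \<open>The Arzela-Ascoli argument with pointwise limits only: a diagonal subsequence converges
  on a countable dense set, and equicontinuity makes it Cauchy at every other point. The 1 in
  \<open>3 * (B + 1)\<close> covers \<open>B = 0\<close>.\<close>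

lemma pot_compact:
  assumes g: "\<And>j. g j \<in> borel_measurable M" "\<And>j x. 0 \<le> g j x" "\<And>j x. g j x \<le> B"
  shows "\<exists>r v. strict_mono (r :: nat \<Rightarrow> nat) \<and> (\<forall>x. (\<lambda>j. pot (g (r j)) x) \<longlonglongrightarrow> v x)"
proof -
  obtain T :: "'a set" where T: "countable T" "\<And>X. open X \<Longrightarrow> X \<noteq> {} \<Longrightarrow> \<exists>d\<in>T. d \<in> X"
    by (rule countable_dense_setE) (rule that)
  have gB: "\<bar>g j x\<bar> \<le> B" for j x using g(2,3)[of j x] by auto
  have B: "0 \<le> B" using gB by (meson abs_ge_zero order_trans)
  have "norm (pot (g j) x) \<le> B * K" for j x using pot_mono_bound[OF g(1) gB] by simp
  then obtain r where r: "strict_mono (r :: nat \<Rightarrow> nat)"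
    and conv: "\<And>x. x \<in> T \<Longrightarrow> \<exists>l. (\<lambda>j. pot (g (r j)) x) \<longlonglongrightarrow> l"
    by (rule function_convergent_subsequence[OF T(1), of "\<lambda>j. pot (g j)" "B * K"]) (rule that)
  have "\<exists>l. (\<lambda>j. pot (g (r j)) x) \<longlonglongrightarrow> l" for x
  proof -
    have "Cauchy (\<lambda>j. pot (g (r j)) x)"
    proof (rule metric_CauchyI)
      fix e :: real assume e: "0 < e"
      then have "0 < e / (3 * (B + 1))" using B by simp
      then obtain d where d: "0 < d" "\<And>x'. dist x' x < d \<Longrightarrow> (\<integral>y. \<bar>k x' y - k x y\<bar> \<partial>M) < e / (3 * (B + 1))"
        by (rule k_L1_equicontinuous) (rule that)
      obtain z where z: "z \<in> T" "z \<in> ball x d" using T(2)[of "ball x d"] d(1) by auto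
      have close: "\<bar>pot (g j) z - pot (g j) x\<bar> < e / 3" for j
      proof -
        have "\<bar>pot (g j) z - pot (g j) x\<bar> \<le> B * (\<integral>y. \<bar>k z y - k x y\<bar> \<partial>M)" by (rule pot_diff_le[OF g(1) gB])
        also have "\<dots> \<le> B * (e / (3 * (B + 1)))"
          using d(2)[of z] z B by (intro mult_left_mono) (auto simp: dist_commute)
        also have "\<dots> < e / 3" using B e by (simp add: field_simps)
        finally show ?thesis .
      qed
      have "Cauchy (\<lambda>j. pot (g (r j)) z)" using conv[OF z(1)] LIMSEQ_imp_Cauchy by blast
      from this[unfolded Cauchy_def, rule_format, of "e / 3"] e
      obtain N where N: "\<And>i j. i \<ge> N \<Longrightarrow> j \<ge> N \<Longrightarrow> dist (pot (g (r i)) z) (pot (g (r j)) z) < e / 3"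
        by auto
      show "\<exists>N. \<forall>i\<ge>N. \<forall>j\<ge>N. dist (pot (g (r i)) x) (pot (g (r j)) x) < e"
      proof (intro exI allI impI)
        fix i j assume "N \<le> i" "N \<le> j"
        then show "dist (pot (g (r i)) x) (pot (g (r j)) x) < e"
          using N[of i j] close[of "r i"] close[of "r j"] unfolding dist_real_def by linarith
      qed
    qed
    then show ?thesis by (simp add: Cauchy_convergent_iff convergent_def)
  qed
  then have "\<exists>v. \<forall>x. (\<lambda>j. pot (g (r j)) x) \<longlonglongrightarrow> v x" by (intro choice allI)
  with r show ?thesis by blast
qed

theorem mean_field_solution:
  obtains v where "continuous_on UNIV v" "\<And>x. 0 \<le> v x" "bdd v" "\<And>x. pot (emap v) x = v x"
proof -
  obtain g where g: "dens g" "\<And>x. pot (emap (pot g)) x = pot g x"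
  proof (rule fixed_point)
    fix B and g :: "nat \<Rightarrow> 'a \<Rightarrow> real"
    assume "\<And>j. g j \<in> borel_measurable M" "\<And>j x. 0 \<le> g j x" "\<And>j x. g j x \<le> B"
    then show "\<exists>r v. strict_mono (r :: nat \<Rightarrow> nat) \<and> (\<forall>x. (\<lambda>j. pot (g (r j)) x) \<longlonglongrightarrow> v x)"
      by (rule pot_compact)
  qed (rule that)
  show ?thesis
  proof (rule that[of "pot g"])
    show "continuous_on UNIV (pot g)" "bdd (pot g)" using densD(1)[OF g(1)] by (rule pot_continuous bdd_pot)+
    show "0 \<le> pot g x" for x using densD(2)[OF g(1)] by (rule pot_nonneg)
  qed (rule g(2))
qed

end

section \<open>The logarithmic kernel on the conformal sphere\<close>

text \<open>Each point is charged to one ball of the family, and a ball of radius \<open>r\<close>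
  has volume proportional to \<open>r ^ DIM('a)\<close>. With dyadic radii this reduces radial
  integrals to geometric series.\<close>

lemma nn_integral_dyadic_finite:
  fixes c r :: "nat \<Rightarrow> real"
  assumes c: "\<And>j. 0 \<le> c j" and r: "\<And>j. 0 \<le> r j"
    and sum: "summable (\<lambda>j. c j * r j ^ DIM('a))"
    and h: "\<And>z::'a::euclidean_space. h z = 0 \<or> (\<exists>j. h z \<le> ennreal (c j) \<and> norm z \<le> r j)"
  shows "(\<integral>\<^sup>+z. h z \<partial>(lborel :: 'a measure)) < \<infinity>"
proof -
  have "(\<integral>\<^sup>+z. h z \<partial>(lborel :: 'a measure)) \<le> (\<integral>\<^sup>+z. (\<Sum>j. ennreal (c j) * indicator (cball 0 (r j)) z) \<partial>(lborel :: 'a measure))"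
  proof (rule nn_integral_mono)
    fix z :: 'a
    show "h z \<le> (\<Sum>j. ennreal (c j) * indicator (cball 0 (r j)) z)"
    proof (cases "h z = 0")
      case False
      with h obtain j where j: "h z \<le> ennreal (c j)" "norm z \<le> r j" by blast
      have "h z \<le> sum (\<lambda>j. ennreal (c j) * indicator (cball 0 (r j)) z) {j}" using j by simp
      also have "\<dots> \<le> (\<Sum>j. ennreal (c j) * indicator (cball 0 (r j)) z)"
        by (rule sum_le_suminf) auto
      finally show ?thesis .
    qed simp
  qed
  also have "\<dots> = (\<Sum>j. ennreal (c j) * emeasure lborel (cball (0::'a) (r j)))"
  proof (subst nn_integral_suminf)
    show "(\<lambda>z. ennreal (c j) * indicator (cball (0::'a) (r j)) z) \<in> borel_measurable lborel" for j
    proof -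
      have [measurable]: "cball (0::'a) (r j) \<in> sets borel" by simp
      show ?thesis by measurable
    qed
    have "(\<integral>\<^sup>+z. ennreal (c j) * indicator (cball (0::'a) (r j)) z \<partial>lborel) = ennreal (c j) * emeasure lborel (cball (0::'a) (r j))" for j
      by (rule nn_integral_cmult_indicator) simp
    then show "(\<Sum>j. \<integral>\<^sup>+z. ennreal (c j) * indicator (cball (0::'a) (r j)) z \<partial>lborel) = (\<Sum>j. ennreal (c j) * emeasure lborel (cball (0::'a) (r j)))"
      by (simp only:)
  qed
  also have "\<dots> = (\<Sum>j. ennreal (unit_ball_vol (real DIM('a)) * (c j * r j ^ DIM('a))))"
    using c r by (simp add: emeasure_cball ennreal_mult'[symmetric] mult_ac)
  also have "\<dots> < \<infinity>"
    using sum c r by (subst suminf_ennreal2) (auto intro!: summable_mult)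
  finally show ?thesis .
qed

lemma nn_integral_singular_power_finite:
  assumes "0 \<le> a" "a < real DIM('a::euclidean_space)"
  shows "(\<integral>\<^sup>+z. ennreal (if norm z \<le> 1 then norm z powr (- a) else 0) \<partial>(lborel :: 'a measure)) < \<infinity>"
\<comment> \<open>In shell \<open>j\<close> the norm lies between \<open>2 powr (-(j+1))\<close> and
  \<open>2 powr (-j)\<close>: the function is bounded by its value at the inner radius, hence
  \<open>j + 1\<close>, and the volume by that of the outer ball.\<close>
proof (rule nn_integral_dyadic_finite[where c = "\<lambda>j. 2 powr (a * (real j + 1))" and r = "\<lambda>j. 2 powr (- real j)"])
  have "(\<lambda>j. 2 powr (a * (real j + 1)) * (2 powr (- real j)) ^ DIM('a))
      = (\<lambda>j. 2 powr a * (2 powr (a - real DIM('a))) ^ j)"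
    by (simp add: fun_eq_iff powr_realpow[symmetric] powr_powr powr_add[symmetric] algebra_simps)
  moreover have "2 powr (a - real DIM('a)) < (1::real)" using assms by (simp add: powr_less_one)
  ultimately show "summable (\<lambda>j. 2 powr (a * (real j + 1)) * (2 powr (- real j)) ^ DIM('a))"
    by (auto intro!: summable_mult summable_geometric)
next
  fix z :: 'a
  show "ennreal (if norm z \<le> 1 then norm z powr (- a) else 0) = 0 \<or>
    (\<exists>j. ennreal (if norm z \<le> 1 then norm z powr (- a) else 0) \<le> ennreal (2 powr (a * (real j + 1))) \<and> norm z \<le> 2 powr (- real j))"
  proof (cases "norm z \<le> 1 \<and> z \<noteq> 0")
    case True
    define t where "t = - log 2 (norm z)"
    have z: "norm z = 2 powr (- t)" using True by (simp add: t_def)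
    have "0 \<le> t" using True by (simp add: t_def)
    define j where "j = nat \<lfloor>t\<rfloor>"
    have j: "real j \<le> t" "t < real j + 1" using \<open>0 \<le> t\<close> unfolding j_def by linarith+
    have "norm z powr (- a) = 2 powr (a * t)" unfolding z by (simp add: powr_powr mult.commute)
    also have "\<dots> \<le> 2 powr (a * (real j + 1))" using j assms by (intro powr_mono mult_left_mono) auto
    finally have "norm z powr (- a) \<le> 2 powr (a * (real j + 1))" .
    moreover have "norm z \<le> 2 powr (- real j)" unfolding z using j by simp
    ultimately show ?thesis using True by (auto simp: ennreal_leI intro!: exI[of _ j])
  qed auto
qed auto

lemma nn_integral_tail_power_finite:
  assumes "real DIM('a::euclidean_space) < q"
  shows "(\<integral>\<^sup>+z. ennreal (if norm z \<le> 1 then 0 else norm z powr (- q)) \<partial>(lborel :: 'a measure)) < \<infinity>"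
\<comment> \<open>Now the norm lies between \<open>2 powr j\<close> and \<open>2 powr (j+1)\<close>,
  so the shift by one sits in the radius of the ball.\<close>
proof (rule nn_integral_dyadic_finite[where c = "\<lambda>j. 2 powr (- q * real j)" and r = "\<lambda>j. 2 powr (real j + 1)"])
  have "(\<lambda>j. 2 powr (- q * real j) * (2 powr (real j + 1)) ^ DIM('a))
      = (\<lambda>j. 2 powr real DIM('a) * (2 powr (real DIM('a) - q)) ^ j)"
    by (simp add: fun_eq_iff powr_realpow[symmetric] powr_powr powr_add[symmetric] algebra_simps)
  moreover have "2 powr (real DIM('a) - q) < (1::real)" using assms by (simp add: powr_less_one)
  ultimately show "summable (\<lambda>j. 2 powr (- q * real j) * (2 powr (real j + 1)) ^ DIM('a))"
    by (auto intro!: summable_mult summable_geometric)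
next
  fix z :: 'a
  show "ennreal (if norm z \<le> 1 then 0 else norm z powr (- q)) = 0 \<or>
    (\<exists>j. ennreal (if norm z \<le> 1 then 0 else norm z powr (- q)) \<le> ennreal (2 powr (- q * real j)) \<and> norm z \<le> 2 powr (real j + 1))"
  proof (cases "norm z \<le> 1")
    case False
    then have z1: "1 < norm z" "0 < norm z" by linarith+
    define t where "t = log 2 (norm z)"
    have z: "norm z = 2 powr t" using z1 by (simp add: t_def)
    have "0 \<le> t" using z1 by (simp add: t_def)
    define j where "j = nat \<lfloor>t\<rfloor>"
    have j: "real j \<le> t" "t < real j + 1" using \<open>0 \<le> t\<close> unfolding j_def by linarith+
    have "0 < q" using assms by (meson DIM_positive of_nat_0_less_iff order_less_trans)
    have "norm z powr (- q) = 2 powr (- q * t)" unfolding z by (simp add: powr_powr mult.commute)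
    also have "\<dots> \<le> 2 powr (- q * real j)" using j \<open>0 < q\<close> by (intro powr_mono) auto
    finally have "norm z powr (- q) \<le> 2 powr (- q * real j)" .
    moreover have "norm z \<le> 2 powr (real j + 1)" unfolding z using j by simp
    ultimately show ?thesis using False by (auto simp: ennreal_leI intro!: exI[of _ j])
  qed auto
qed auto

text \<open>Model majorant: singular of order \<open>a\<close> at the origin, decaying with order
  \<open>q\<close> at infinity. Its integral is finite when the dimension lies strictly between
  \<open>a\<close> and \<open>q\<close>.\<close>

definition hump :: "real \<Rightarrow> real \<Rightarrow> 'a::euclidean_space \<Rightarrow> real" where
  "hump a q z = (if norm z \<le> 1 then norm z powr (- a) else norm z powr (- q))"

lemma hump_meas [measurable]: "hump a q \<in> borel_measurable borel"
  unfolding hump_def by measurable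

lemma hump_nonneg: "0 \<le> hump a q z" by (simp add: hump_def)

lemma nn_integral_hump:
  assumes "0 \<le> a" "a < real DIM('a::euclidean_space)" "real DIM('a) < q"
  shows "(\<integral>\<^sup>+z. ennreal (hump a q z) \<partial>(lborel :: 'a measure)) < \<infinity>"
proof -
  have "(\<integral>\<^sup>+z. ennreal (hump a q z) \<partial>(lborel :: 'a measure)) =
     (\<integral>\<^sup>+z. ennreal (if norm z \<le> 1 then norm z powr (- a) else 0) + ennreal (if norm z \<le> 1 then 0 else norm z powr (- q)) \<partial>(lborel :: 'a measure))"
    by (intro nn_integral_cong) (simp add: hump_def)
  also have "\<dots> = (\<integral>\<^sup>+z. ennreal (if norm z \<le> 1 then norm z powr (- a) else 0) \<partial>(lborel :: 'a measure))
      + (\<integral>\<^sup>+z. ennreal (if norm z \<le> 1 then 0 else norm z powr (- q)) \<partial>(lborel :: 'a measure))"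
    by (intro nn_integral_add) measurable
  also have "\<dots> < \<infinity>"
    using nn_integral_singular_power_finite[OF assms(1,2)] nn_integral_tail_power_finite[OF assms(3)] by simp
  finally show ?thesis .
qed

lemma nn_integral_lborel_shift:
  fixes f :: "'a::euclidean_space \<Rightarrow> ennreal"
  assumes [measurable]: "f \<in> borel_measurable borel"
  shows "(\<integral>\<^sup>+x. f (x - c) \<partial>lborel) = (\<integral>\<^sup>+x. f x \<partial>lborel)"
proof -
  have "(\<integral>\<^sup>+x. f x \<partial>lborel) = (\<integral>\<^sup>+x. f x \<partial>distr lborel borel ((+) (- c)))"
    by (simp add: lborel_distr_plus)
  also have "\<dots> = (\<integral>\<^sup>+x. f (x - c) \<partial>lborel)" by (subst nn_integral_distr) auto
  finally show ?thesis by simp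
qed

text \<open>The norm of \<open>(1, x)\<close>, whence \<open>bracket_triangle\<close>;
  \<open>2 / (bracket x)\<^sup>2\<close> is the conformal factor of stereographic
  projection.\<close>

definition bracket :: "'a::real_normed_vector \<Rightarrow> real" where
  "bracket x = sqrt (1 + (norm x)\<^sup>2)"

text \<open>\<open>exp (- lker x y)\<close> is half the chordal distance between the stereographic projections of \<open>x\<close> and
  \<open>y\<close> to the unit sphere (except that \<open>ln 0 = 0\<close> makes the diagonal value finite). With this kernel
  the point at infinity plays no special role.\<close>

definition lker :: "'a::real_normed_vector \<Rightarrow> 'a \<Rightarrow> real" where
  "lker x y = ln (bracket x) + ln (bracket y) - ln (norm (x - y))"

lemma bracket_ge1: "1 \<le> bracket x" and bracket_ge_norm: "norm x \<le> bracket x"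
  and bracket_pos: "0 < bracket x"
proof -
  show "1 \<le> bracket x" by (simp add: bracket_def)
  then show "0 < bracket x" by linarith
  show "norm x \<le> bracket x" unfolding bracket_def by (rule real_le_rsqrt) simp
qed

lemma bracket_le: "bracket x \<le> 1 + norm x"
  unfolding bracket_def by (rule real_le_lsqrt) (auto simp: power2_sum)

lemma bracket_continuous [continuous_intros]: "continuous_on S bracket"
  unfolding bracket_def by (intro continuous_intros)

lemma bracket_meas [measurable]: "bracket \<in> borel_measurable borel"
  by (intro borel_measurable_continuous_onI bracket_continuous)

text \<open>A chord of the unit sphere is no longer than its diameter. In coordinates this comes
  down to \<open>(1 - norm x * norm y)\<^sup>2 >= 0\<close>; it makes \<open>lker\<close>
  nonnegative.\<close>

lemma norm_diff_le_bracket: "norm (x - y) \<le> bracket x * bracket y"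
proof -
  have "norm (x - y) \<le> norm x + norm y" by (rule norm_triangle_ineq4)
  also have "\<dots> \<le> sqrt ((1 + (norm x)\<^sup>2) * (1 + (norm y)\<^sup>2))"
  proof (rule real_le_rsqrt)
    have "0 \<le> (1 - norm x * norm y)\<^sup>2" by simp
    then show "(norm x + norm y)\<^sup>2 \<le> (1 + (norm x)\<^sup>2) * (1 + (norm y)\<^sup>2)"
      by (simp add: power2_eq_square algebra_simps)
  qed
  also have "\<dots> = bracket x * bracket y" by (simp add: bracket_def real_sqrt_mult)
  finally show ?thesis .
qed

lemma bracket_triangle: "bracket y \<le> bracket x + norm (x - y)"
proof -
  have e: "bracket z = norm (1::real, z)" for z :: 'a by (simp add: bracket_def norm_Pair)
  have "norm (1::real, y) \<le> norm (1::real, x) + norm (0::real, y - x)"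
    using norm_triangle_ineq[of "(1::real, x)" "(0, y - x)"] by simp
  then show ?thesis by (simp add: e norm_Pair norm_minus_commute)
qed

lemma lker_sym: "lker x y = lker y x" by (simp add: lker_def norm_minus_commute)

lemma lker_nonneg: "0 \<le> lker x y"
proof (cases "x = y")
  case True
  then show ?thesis using bracket_ge1[of x] by (simp add: lker_def)
next
  case False
  then have "ln (norm (x - y)) \<le> ln (bracket x * bracket y)"
    using norm_diff_le_bracket[of x y] by (simp add: bracket_pos)
  also have "\<dots> = ln (bracket x) + ln (bracket y)" by (intro ln_mult_pos bracket_pos)
  finally show ?thesis by (simp add: lker_def)
qed

lemma lker_meas [measurable]:
  fixes f g :: "'b \<Rightarrow> 'a::euclidean_space"
  assumes [measurable]: "f \<in> borel_measurable M" "g \<in> borel_measurable M"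
  shows "(\<lambda>x. lker (f x) (g x)) \<in> borel_measurable M"
  unfolding lker_def by measurable

lemma exp_lker:
  assumes "x \<noteq> y"
  shows "exp (a * lker x y) = (bracket x * bracket y / norm (x - y)) powr a"
proof -
  have "lker x y = ln (bracket x * bracket y / norm (x - y))"
    using assms bracket_pos[of x] bracket_pos[of y] by (simp add: lker_def ln_mult_pos ln_div)
  moreover have "0 < bracket x * bracket y / norm (x - y)"
    using assms bracket_pos[of x] bracket_pos[of y] by simp
  ultimately show ?thesis using assms bracket_pos[of x] bracket_pos[of y] by (simp add: powr_def less_imp_neq[symmetric])
qed

text \<open>If \<open>x\<close> is at distance at least \<open>bracket y / 2\<close> from
  \<open>y\<close>, the quotient in \<open>exp_lker\<close> is at most \<open>2 * bracket x\<close>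
  and \<open>y\<close> disappears. Otherwise \<open>bracket x\<close> is at least
  \<open>bracket y / 2\<close>, and powers of \<open>bracket y\<close> are traded for powers of
  \<open>norm (x - y)\<close>. Up to constants the majorant is a fixed function plus its translate,
  so its integral does not depend on \<open>y\<close>.\<close>

lemma hump_bounds:
  fixes x y :: "'a::euclidean_space"
  assumes "0 \<le> a" "a < p" "x \<noteq> 0" "x \<noteq> y"
  shows "exp (a * lker x y) * bracket x powr (- 2 * p)
     \<le> 2 powr a * hump a (2 * p - a) x + 2 powr (2 * p - a) * hump a (2 * p - a) (x - y)"
proof (cases "bracket y / 2 \<le> norm (x - y)")
  case True
  note b = bracket_pos[of x] bracket_pos[of y] bracket_ge1[of x] bracket_ge_norm[of x]
  have n: "0 < norm (x - y)" using assms by simp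
  have "bracket x * bracket y / norm (x - y) \<le> 2 * bracket x"
    using True n b by (simp add: field_simps)
  then have "exp (a * lker x y) \<le> (2 * bracket x) powr a"
    unfolding exp_lker[OF assms(4)] using assms b n by (intro powr_mono2) auto
  also have "\<dots> = 2 powr a * bracket x powr a" using b by (simp add: powr_mult)
  finally have "exp (a * lker x y) * bracket x powr (- 2 * p) \<le> 2 powr a * bracket x powr a * bracket x powr (- 2 * p)"
    by (rule mult_right_mono) simp
  also have "\<dots> = 2 powr a * bracket x powr (- (2 * p - a))"
    by (simp add: powr_add[symmetric] mult.assoc)
  also have "bracket x powr (- (2 * p - a)) \<le> hump a (2 * p - a) x"
  proof (cases "norm x \<le> 1")
    case True
    have "bracket x powr (- (2 * p - a)) \<le> 1 powr (- (2 * p - a))"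
      using b assms by (intro powr_mono2') auto
    also have "\<dots> = 1 powr (- a)" by simp
    also have "1 powr (- a) \<le> norm x powr (- a)" using True assms by (intro powr_mono2') auto
    finally show ?thesis using True by (simp add: hump_def)
  next
    case False
    then show ?thesis using b assms by (simp add: hump_def) (intro powr_mono2', auto)
  qed
  finally have "exp (a * lker x y) * bracket x powr (- 2 * p) \<le> 2 powr a * hump a (2 * p - a) x" by simp
  moreover have "0 \<le> 2 powr (2 * p - a) * hump a (2 * p - a) (x - y)" by (simp add: hump_nonneg)
  ultimately show ?thesis by linarith
next
  case False
  define z where "z = x - y"
  note b = bracket_pos[of x] bracket_pos[of y] bracket_ge1[of y]
  have n: "0 < norm z" using assms by (simp add: z_def)
  have half: "bracket y / 2 \<le> bracket x" and zy: "norm z < bracket y"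
    using False bracket_triangle[of y x] b by (auto simp: z_def)
  have "exp (a * lker x y) * bracket x powr (- 2 * p) =
      bracket y powr a * norm z powr (- a) * bracket x powr (- (2 * p - a))"
    unfolding exp_lker[OF assms(4)] z_def[symmetric] using b n
    by (simp add: powr_divide powr_mult powr_minus_divide powr_diff field_simps)
  also have "\<dots> \<le> bracket y powr a * norm z powr (- a) * (bracket y / 2) powr (- (2 * p - a))"
    using half b assms by (intro mult_left_mono powr_mono2') auto
  also have "\<dots> = 2 powr (2 * p - a) * (norm z powr (- a) * bracket y powr (- (2 * p - 2 * a)))"
    using b by (simp add: powr_divide powr_minus_divide powr_diff powr_add[symmetric] field_simps)
  also have "norm z powr (- a) * bracket y powr (- (2 * p - 2 * a)) \<le> hump a (2 * p - a) z"
  proof (cases "norm z \<le> 1")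
    case True
    have "bracket y powr (- (2 * p - 2 * a)) \<le> 1 powr (- (2 * p - 2 * a))"
      using b assms by (intro powr_mono2') auto
    then have "norm z powr (- a) * bracket y powr (- (2 * p - 2 * a)) \<le> norm z powr (- a) * 1"
      by (intro mult_left_mono) auto
    then show ?thesis using True by (simp add: hump_def)
  next
    case False
    have "bracket y powr (- (2 * p - 2 * a)) \<le> norm z powr (- (2 * p - 2 * a))"
      using b assms zy n by (intro powr_mono2') auto
    then have "norm z powr (- a) * bracket y powr (- (2 * p - 2 * a)) \<le> norm z powr (- a) * norm z powr (- (2 * p - 2 * a))"
      by (intro mult_left_mono) auto
    also have "\<dots> = norm z powr (- (2 * p - a))" by (simp add: powr_add[symmetric])
    finally show ?thesis using False by (simp add: hump_def)
  qed
  finally have "exp (a * lker x y) * bracket x powr (- 2 * p) \<le> 2 powr (2 * p - a) * hump a (2 * p - a) (x - y)"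
    by (simp add: z_def)
  moreover have "0 \<le> 2 powr a * hump a (2 * p - a) x" by (simp add: hump_nonneg)
  ultimately show ?thesis by linarith
qed

lemma AE_lborel_neq: "AE x in lborel. x \<noteq> (y::'a::euclidean_space)"
  by (rule AE_lborel_singleton)

text \<open>The conditions make both orders of the hump admissible: \<open>a\<close> lies below the
  dimension and \<open>2 * p - a\<close> above it. Translation invariance then gives the uniformity
  in \<open>y\<close>.\<close>

theorem exp_lker_integral_bound:
  assumes "0 \<le> a" "a < real DIM('a::euclidean_space)" "real DIM('a) + a < 2 * p"
  obtains C where "0 \<le> C"
    "\<And>y::'a. (\<integral>\<^sup>+x. ennreal (exp (a * lker x y) * bracket x powr (- 2 * p)) \<partial>lborel) \<le> ennreal C"
proof -
  let ?h = "hump a (2 * p - a) :: 'a \<Rightarrow> real"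
  define J where "J = (\<integral>\<^sup>+z. ennreal (?h z) \<partial>lborel)"
  define A where "A = ennreal (2 powr a) * J + ennreal (2 powr (2 * p - a)) * J"
  have "J < \<infinity>" unfolding J_def using assms by (intro nn_integral_hump) auto
  then have A: "A < \<infinity>" by (simp add: A_def ennreal_mult_less_top)
  have "(\<integral>\<^sup>+x. ennreal (exp (a * lker x y) * bracket x powr (- 2 * p)) \<partial>lborel) \<le> A" for y :: 'a
  proof -
    have "(\<integral>\<^sup>+x. ennreal (exp (a * lker x y) * bracket x powr (- 2 * p)) \<partial>lborel) \<le>
       (\<integral>\<^sup>+x. ennreal (2 powr a) * ennreal (?h x) + ennreal (2 powr (2 * p - a)) * ennreal (?h (x - y)) \<partial>lborel)"
    proof (rule nn_integral_mono_AE)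
      show "AE x in lborel. ennreal (exp (a * lker x y) * bracket x powr (- 2 * p)) \<le>
         ennreal (2 powr a) * ennreal (?h x) + ennreal (2 powr (2 * p - a)) * ennreal (?h (x - y))"
        using AE_lborel_neq[of 0] AE_lborel_neq[of y]
      proof eventually_elim
        case (elim x)
        then have "ennreal (exp (a * lker x y) * bracket x powr (- 2 * p)) \<le>
           ennreal (2 powr a * ?h x + 2 powr (2 * p - a) * ?h (x - y))"
          using assms by (intro ennreal_leI hump_bounds) auto
        then show ?case by (simp add: hump_nonneg ennreal_mult' ennreal_plus)
      qed
    qed
    also have "\<dots> = ennreal (2 powr a) * J + ennreal (2 powr (2 * p - a)) * (\<integral>\<^sup>+x. ennreal (?h (x - y)) \<partial>lborel)"
      by (simp add: nn_integral_add nn_integral_cmult J_def)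
    also have "(\<integral>\<^sup>+x. ennreal (?h (x - y)) \<partial>lborel) = J"
      unfolding J_def by (rule nn_integral_lborel_shift) measurable
    finally show ?thesis unfolding A_def .
  qed
  moreover obtain C where "0 \<le> C" "A = ennreal C" using A by (cases A) auto
  ultimately show ?thesis using that by auto
qed


lemma exp_lker_integrable:
  assumes "0 \<le> a" "a < real DIM('a::euclidean_space)" "real DIM('a) + a < q"
  obtains C where "0 \<le> C" "\<And>y::'a. integrable lborel (\<lambda>x. exp (a * lker x y) * bracket x powr (- q))"
    "\<And>y::'a. (LINT x|lborel. exp (a * lker x y) * bracket x powr (- q)) \<le> C"
proof -
  obtain C where C: "0 \<le> C"
    "\<And>y::'a. (\<integral>\<^sup>+x. ennreal (exp (a * lker x y) * bracket x powr (- 2 * (q / 2))) \<partial>lborel) \<le> ennreal C"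
  proof (rule exp_lker_integral_bound[where 'a = 'a, of a "q / 2"])
    show "real DIM('a) + a < 2 * (q / 2)" using assms(3) by simp
  qed (rule assms(1), rule assms(2), rule that)
  have i: "integrable lborel (\<lambda>x. exp (a * lker x y) * bracket x powr (- q))" for y :: 'a
    using C(2)[of y] by (intro integrableI_nonneg) (auto simp: less_top[symmetric] top_unique)
  have "(LINT x|lborel. exp (a * lker x y) * bracket x powr (- q)) \<le> C" for y :: 'a
  proof -
    have "ennreal (LINT x|lborel. exp (a * lker x y) * bracket x powr (- q)) \<le> ennreal C"
      using C(2)[of y] i[of y] by (subst nn_integral_eq_integral[symmetric]) auto
    then show ?thesis using C(1) by (simp add: ennreal_le_iff)
  qed
  with C(1) i show ?thesis by (rule that[of C])
qed

lemma bracket_power_integrable: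
  assumes "real DIM('a) < q"
  shows "integrable lborel (\<lambda>x::'a::euclidean_space. bracket x powr (- q))"
proof -
  obtain C where "0 \<le> C" and i: "\<And>y::'a. integrable lborel (\<lambda>x. exp (0 * lker x y) * bracket x powr (- q))"
    and "\<And>y::'a. (LINT x|lborel. exp (0 * lker x y) * bracket x powr (- q)) \<le> C"
  proof (rule exp_lker_integrable[where 'a = 'a, of 0 q])
    show "real DIM('a) + 0 < q" using assms by simp
  qed (simp, simp, rule that)
  from i[of 0] show ?thesis by simp
qed

section \<open>The weighted kernel with several singular points\<close>

text \<open>At most one of the singularities of \<open>weight\<close> below is felt at any given point.\<close>

lemma lker_separation:
  fixes P P' :: "'a::real_normed_vector"
  assumes "P \<noteq> P'"
  obtains L where "\<And>x. lker x P \<le> L \<or> lker x P' \<le> L"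
proof -
  define Q where "Q = bracket P + bracket P'"
  \<comment> \<open>The first entry lets \<open>bracket x\<close> be absorbed, giving
    \<open>bracket x <= 2 * Q\<close>. The triangle inequality through \<open>x\<close> then bounds
    \<open>norm (P - P')\<close> by \<open>2 * \<epsilon> * Q\<^sup>2\<close>, which the second
    entry contradicts.\<close>
  define \<epsilon> where "\<epsilon> = min (1 / (2 * Q)) (norm (P - P') / (4 * Q\<^sup>2))"
  note b = bracket_pos[of P] bracket_pos[of P']
  have Q: "0 < Q" using b by (simp add: Q_def)
  have d: "0 < norm (P - P')" using assms by simp
  have e: "0 < \<epsilon>" using Q d by (simp add: \<epsilon>_def)
  have e1: "\<epsilon> * Q \<le> 1 / 2" and e2: "4 * \<epsilon> * Q\<^sup>2 \<le> norm (P - P')"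
  proof -
    have "\<epsilon> \<le> 1 / (2 * Q)" "\<epsilon> \<le> norm (P - P') / (4 * Q\<^sup>2)" by (auto simp: \<epsilon>_def)
    then show "\<epsilon> * Q \<le> 1 / 2" "4 * \<epsilon> * Q\<^sup>2 \<le> norm (P - P')" using Q by (auto simp: field_simps)
  qed
  have close: "norm (x - R) \<le> \<epsilon> * (bracket x * bracket R)" if "\<not> lker x R \<le> - ln \<epsilon>" for x R :: 'a
  proof (cases "x = R")
    case False
    let ?r = "bracket x * bracket R / norm (x - R)"
    have r: "0 < ?r" using False bracket_pos[of x] bracket_pos[of R] by simp
    have "lker x R = ln ?r"
      using False bracket_pos[of x] bracket_pos[of R] by (simp add: lker_def ln_mult_pos ln_div)
    with that have "ln (1 / \<epsilon>) < ln ?r" using e by (simp add: ln_div)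
    then have "1 / \<epsilon> < ?r" using e r by simp
    then show ?thesis using e False by (simp add: field_simps)
  qed (use e bracket_pos[of x] in simp)
  have "lker x P \<le> - ln \<epsilon> \<or> lker x P' \<le> - ln \<epsilon>" for x
  proof (rule ccontr)
    assume "\<not> ?thesis"
    then have 1: "norm (x - P) \<le> \<epsilon> * (bracket x * bracket P)" and 2: "norm (x - P') \<le> \<epsilon> * (bracket x * bracket P')"
      using close by auto
    have q: "0 < bracket x" by (rule bracket_pos)
    have "bracket x \<le> bracket P + norm (x - P)" using bracket_triangle[of x P] by (simp add: norm_minus_commute)
    also have "\<dots> \<le> Q + bracket x * (\<epsilon> * Q)"
    proof (rule add_mono)
      show "bracket P \<le> Q" using b by (simp add: Q_def)
      have "\<epsilon> * (bracket x * bracket P) \<le> \<epsilon> * (bracket x * Q)"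
        using e q b by (intro mult_left_mono) (auto simp: Q_def)
      with 1 show "norm (x - P) \<le> bracket x * (\<epsilon> * Q)" by (simp add: mult_ac)
    qed
    also have "\<dots> \<le> Q + bracket x * (1 / 2)" using e1 q by (intro add_left_mono mult_left_mono) auto
    finally have qx: "bracket x \<le> 2 * Q" by simp
    have "norm (P - P') \<le> norm (x - P) + norm (x - P')"
      using norm_triangle_ineq4[of "x - P'" "x - P"] by simp
    also have "\<dots> \<le> \<epsilon> * (bracket x * bracket P) + \<epsilon> * (bracket x * bracket P')" using 1 2 by simp
    also have "\<dots> = \<epsilon> * Q * bracket x" by (simp add: Q_def algebra_simps)
    also have "\<dots> \<le> \<epsilon> * Q * (2 * Q)" using qx e Q by (intro mult_left_mono) auto
    also have "\<dots> < 4 * \<epsilon> * Q\<^sup>2" using e Q by (simp add: power2_eq_square)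
    finally show False using e2 by simp
  qed
  then show ?thesis by (rule that)
qed

lemma lker_separation_finite:
  fixes P :: "'i \<Rightarrow> 'a::real_normed_vector"
  assumes "finite I" "inj_on P I"
  obtains L where "0 \<le> L" "\<And>i j x. i \<in> I \<Longrightarrow> j \<in> I \<Longrightarrow> i \<noteq> j \<Longrightarrow> lker x (P i) \<le> L \<or> lker x (P j) \<le> L"
proof -
  have "\<exists>L. i \<in> I \<longrightarrow> j \<in> I \<longrightarrow> i \<noteq> j \<longrightarrow> (\<forall>x. lker x (P i) \<le> L \<or> lker x (P j) \<le> L)" for i j
    using lker_separation[of "P i" "P j"] assms(2) by (metis inj_onD)
  then obtain L where L: "\<And>i j x. i \<in> I \<Longrightarrow> j \<in> I \<Longrightarrow> i \<noteq> j \<Longrightarrow> lker x (P i) \<le> L i j \<or> lker x (P j) \<le> L i j"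
    by metis
  define L' where "L' = (\<Sum>i\<in>I. \<Sum>j\<in>I. \<bar>L i j\<bar>)"
  have "L i j \<le> L'" if "i \<in> I" "j \<in> I" for i j
  proof -
    have "L i j \<le> \<bar>L i j\<bar>" by simp
    also have "\<dots> \<le> (\<Sum>j\<in>I. \<bar>L i j\<bar>)" using that assms by (intro member_le_sum) auto
    also have "\<dots> \<le> L'" unfolding L'_def using that assms
      by (intro member_le_sum[of i I "\<lambda>i. \<Sum>j\<in>I. \<bar>L i j\<bar>"]) (auto intro: sum_nonneg)
    finally show ?thesis .
  qed
  with L have "lker x (P i) \<le> L' \<or> lker x (P j) \<le> L'" if "i \<in> I" "j \<in> I" "i \<noteq> j" for i j x
    using that by (meson order_trans)
  moreover have "0 \<le> L'" unfolding L'_def by (intro sum_nonneg) auto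
  ultimately show ?thesis using that by blast
qed

text \<open>For \<open>b l = n * \<beta> l\<close>, the part of \<open>exp (n * w)\<close> known in
  advance up to a constant factor; near \<open>P l\<close> it behaves like the distance to the power
  \<open>- b l\<close>. The last factor is, up to a constant, the density of the spherical measure
  under stereographic projection.\<close>

definition weight :: "nat \<Rightarrow> (nat \<Rightarrow> real) \<Rightarrow> (nat \<Rightarrow> 'a) \<Rightarrow> 'a::euclidean_space \<Rightarrow> real" where
  "weight m b P x = exp (\<Sum>l=1..m. b l * lker x (P l)) * bracket x powr (- 2 * real DIM('a))"

lemma weight_meas [measurable]: "weight m b P \<in> borel_measurable borel"
  unfolding weight_def by measurable

lemma weight_pos: "0 < weight m b P x" using bracket_pos[of x] by (simp add: weight_def)

text \<open>At each \<open>x\<close> only the \<open>P j\<close> with the largest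
  \<open>lker x (P j)\<close> counts; by separation the others contribute at most the constant
  factor \<open>E\<close>. For the two remaining logarithms
  \<open>a * u + b j * u' <= \<alpha> * max u u'\<close>, so the integrand is dominated by a sum of
  exponentials with the single exponent \<open>\<alpha>\<close>, which still lies below the
  dimension.\<close>

theorem exp_lker_weight_bound:
  fixes P :: "nat \<Rightarrow> 'a::euclidean_space"
  assumes inj: "inj_on P {1..m}" and m: "1 \<le> m" and a: "0 \<le> a" and b: "\<And>l. l \<in> {1..m} \<Longrightarrow> 0 \<le> b l"
    and ab: "\<And>l. l \<in> {1..m} \<Longrightarrow> a + b l \<le> \<alpha>" and \<alpha>: "\<alpha> < real DIM('a)"
  obtains C where "0 \<le> C" "\<And>y. (\<integral>\<^sup>+x. ennreal (exp (a * lker x y) * weight m b P x) \<partial>lborel) \<le> ennreal C"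
proof -
  let ?I = "{1..m}" and ?n = "real DIM('a)"
  have ne: "?I \<noteq> {}" using m by auto
  obtain l0 where "l0 \<in> ?I" using ne by blast
  then have \<alpha>0: "0 \<le> \<alpha>" using ab[of l0] a b[of l0] by linarith
  obtain C0 where C0: "0 \<le> C0"
    "\<And>y::'a. (\<integral>\<^sup>+x. ennreal (exp (\<alpha> * lker x y) * bracket x powr (- 2 * ?n)) \<partial>lborel) \<le> ennreal C0"
  proof (rule exp_lker_integral_bound[where 'a = 'a, of \<alpha> ?n])
    show "0 \<le> \<alpha>" "\<alpha> < ?n" "?n + \<alpha> < 2 * ?n" using \<alpha> \<alpha>0 by auto
  qed (rule that)
  obtain L where L: "0 \<le> L" "\<And>i j x. i \<in> ?I \<Longrightarrow> j \<in> ?I \<Longrightarrow> i \<noteq> j \<Longrightarrow> lker x (P i) \<le> L \<or> lker x (P j) \<le> L"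
    using lker_separation_finite[OF _ inj] by auto
  define E where "E = exp ((\<Sum>l\<in>?I. b l) * L)"
  have pw: "exp (a * lker x y) * exp (\<Sum>l\<in>?I. b l * lker x (P l)) \<le>
      E * (exp (\<alpha> * lker x y) + (\<Sum>l\<in>?I. exp (\<alpha> * lker x (P l))))" for x y
  proof -
    have "finite ((\<lambda>l. lker x (P l)) ` ?I)" "(\<lambda>l. lker x (P l)) ` ?I \<noteq> {}" using ne by auto
    from Max_in[OF this] obtain j where j: "j \<in> ?I" "lker x (P j) = Max ((\<lambda>l. lker x (P l)) ` ?I)" by auto
    then have jmax: "lker x (P l) \<le> lker x (P j)" if "l \<in> ?I" for l using that by simp
    have other: "lker x (P l) \<le> L" if "l \<in> ?I - {j}" for l
      using L(2)[of l j x] jmax[of l] j that by auto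
    have "(\<Sum>l\<in>?I. b l * lker x (P l)) = b j * lker x (P j) + (\<Sum>l\<in>?I - {j}. b l * lker x (P l))"
      using j by (intro sum.remove) auto
    also have "(\<Sum>l\<in>?I - {j}. b l * lker x (P l)) \<le> (\<Sum>l\<in>?I - {j}. b l * L)"
      using other b by (intro sum_mono mult_left_mono) auto
    also have "\<dots> \<le> (\<Sum>l\<in>?I. b l * L)" using b L(1) by (intro sum_mono2) auto
    also have "\<dots> = (\<Sum>l\<in>?I. b l) * L" by (rule sum_distrib_right[symmetric])
    finally have "a * lker x y + (\<Sum>l\<in>?I. b l * lker x (P l)) \<le> (\<Sum>l\<in>?I. b l) * L + (a * lker x y + b j * lker x (P j))"
      by simp
    also have "a * lker x y + b j * lker x (P j) \<le> \<alpha> * max (lker x y) (lker x (P j))"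
    proof -
      have "a * lker x y + b j * lker x (P j) \<le> a * max (lker x y) (lker x (P j)) + b j * max (lker x y) (lker x (P j))"
        using a b[OF j(1)] by (intro add_mono mult_left_mono) auto
      also have "\<dots> = (a + b j) * max (lker x y) (lker x (P j))" by (simp add: distrib_right)
      also have "\<dots> \<le> \<alpha> * max (lker x y) (lker x (P j))"
        using ab[OF j(1)] lker_nonneg[of x y] by (intro mult_right_mono) auto
      finally show ?thesis .
    qed
    finally have "exp (a * lker x y + (\<Sum>l\<in>?I. b l * lker x (P l))) \<le> E * exp (\<alpha> * max (lker x y) (lker x (P j)))"
      unfolding E_def exp_add[symmetric] by simp
    also have "exp (\<alpha> * max (lker x y) (lker x (P j))) \<le> exp (\<alpha> * lker x y) + exp (\<alpha> * lker x (P j))"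
      by (simp add: max_def)
    also have "exp (\<alpha> * lker x (P j)) \<le> (\<Sum>l\<in>?I. exp (\<alpha> * lker x (P l)))"
      using j by (intro member_le_sum) auto
    finally show ?thesis by (simp add: exp_add E_def mult_left_mono)
  qed
  define C where "C = E * (C0 + real m * C0)"
  have "(\<integral>\<^sup>+x. ennreal (exp (a * lker x y) * weight m b P x) \<partial>lborel) \<le> ennreal C" for y
  proof -
    let ?g = "\<lambda>y x. ennreal (exp (\<alpha> * lker x y) * bracket x powr (- 2 * ?n))"
    have "(\<integral>\<^sup>+x. ennreal (exp (a * lker x y) * weight m b P x) \<partial>lborel)
       \<le> (\<integral>\<^sup>+x. ennreal E * (?g y x + (\<Sum>l\<in>?I. ?g (P l) x)) \<partial>lborel)"
    proof (rule nn_integral_mono)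
      fix x :: 'a
      have "exp (a * lker x y) * weight m b P x \<le>
        E * (exp (\<alpha> * lker x y) + (\<Sum>l\<in>?I. exp (\<alpha> * lker x (P l)))) * bracket x powr (- 2 * ?n)"
        using mult_right_mono[OF pw[of x y], of "bracket x powr (- 2 * ?n)"] by (simp add: weight_def mult.assoc)
      also have "\<dots> = E * (exp (\<alpha> * lker x y) * bracket x powr (- 2 * ?n) + (\<Sum>l\<in>?I. exp (\<alpha> * lker x (P l)) * bracket x powr (- 2 * ?n)))"
        unfolding sum_distrib_right[symmetric] by (simp only: distrib_left distrib_right mult.assoc)
      finally have "ennreal (exp (a * lker x y) * weight m b P x) \<le>
          ennreal (E * (exp (\<alpha> * lker x y) * bracket x powr (- 2 * ?n) + (\<Sum>l\<in>?I. exp (\<alpha> * lker x (P l)) * bracket x powr (- 2 * ?n))))"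
        by (rule ennreal_leI)
      also have "\<dots> = ennreal E * (?g y x + (\<Sum>l\<in>?I. ?g (P l) x))"
        by (subst ennreal_mult', simp add: E_def, subst ennreal_plus, simp, simp add: sum_nonneg, subst sum_ennreal, simp, rule refl)
      finally show "ennreal (exp (a * lker x y) * weight m b P x) \<le> ennreal E * (?g y x + (\<Sum>l\<in>?I. ?g (P l) x))" .
    qed
    also have "\<dots> = ennreal E * ((\<integral>\<^sup>+x. ?g y x \<partial>lborel) + (\<Sum>l\<in>?I. \<integral>\<^sup>+x. ?g (P l) x \<partial>lborel))"
      by (simp add: nn_integral_cmult nn_integral_add nn_integral_sum del: sum_ennreal)
    also have "\<dots> \<le> ennreal E * (ennreal C0 + (\<Sum>l\<in>?I. ennreal C0))"
      by (intro mult_left_mono add_mono sum_mono C0) auto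
    also have "\<dots> = ennreal C"
      using C0(1) by (simp add: C_def E_def ennreal_mult' ennreal_plus ennreal_of_nat_eq_real_of_nat)
    finally show ?thesis .
  qed
  moreover have "0 \<le> C" using C0 by (simp add: C_def E_def)
  ultimately show ?thesis using that by blast
qed

section \<open>Fourier transforms of test functions\<close>

abbreviation frd :: "(real^'n \<Rightarrow> real) \<Rightarrow> real^'n \<Rightarrow> real^'n \<Rightarrow> real" where
  "frd f v x \<equiv> frechet_derivative f (at x) v"

lemma frd_eqI: "(f has_derivative f') (at x) \<Longrightarrow> frd f v x = f' v"
  by (metis frechet_derivative_at)

lemma frd_works: "f differentiable (at x) \<Longrightarrow> (f has_derivative (\<lambda>v. frd f v x)) (at x)"
  by (simp add: frechet_derivative_works[symmetric] eta_contract_eq)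

lemma frd_add:
  "f differentiable (at x) \<Longrightarrow> g differentiable (at x) \<Longrightarrow> frd (\<lambda>x. f x + g x) v x = frd f v x + frd g v x"
  by (rule frd_eqI) (auto intro!: derivative_eq_intros frd_works)

lemma frd_uminus: "f differentiable (at x) \<Longrightarrow> frd (\<lambda>x. - f x) v x = - frd f v x"
  by (rule frd_eqI) (auto intro!: derivative_eq_intros frd_works)

lemma times_cont_diff_add: "times_cont_diff k f \<Longrightarrow> times_cont_diff k g \<Longrightarrow> times_cont_diff k (\<lambda>x. f x + g x)"
  by (induction k arbitrary: f g) (auto intro!: continuous_intros differentiable_add simp: frd_add)

lemma times_cont_diff_uminus: "times_cont_diff k f \<Longrightarrow> times_cont_diff k (\<lambda>x. - f x)"
  by (induction k arbitrary: f) (auto intro!: continuous_intros differentiable_minus simp: frd_uminus)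

lemma times_cont_diff_0: "times_cont_diff k (\<lambda>x. 0)"
  by (induction k) (auto simp: frechet_derivative_const)

definition supp :: "(real^'n \<Rightarrow> real) \<Rightarrow> (real^'n) set" where
  "supp f = closure {x. f x \<noteq> 0}"

lemma test_function_subset:
  assumes "\<And>k. times_cont_diff k f" "{x. f x \<noteq> 0} \<subseteq> K" "compact K"
  shows "test_function f"
proof -
  have "closure {x. f x \<noteq> 0} \<subseteq> K" using assms by (intro closure_minimal compact_imp_closed)
  moreover have "closure {x. f x \<noteq> 0} = K \<inter> closure {x. f x \<noteq> 0}" using calculation by blast
  ultimately show ?thesis
    using assms unfolding test_function_def by (metis compact_Int_closed closed_closure)
qed

lemma test_function_tcd: "test_function f \<Longrightarrow> times_cont_diff k f"
  and test_function_supp: "test_function f \<Longrightarrow> compact (supp f)"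
  by (auto simp: test_function_def supp_def)

lemma supp_superset: "{x. f x \<noteq> 0} \<subseteq> supp f" by (simp add: supp_def closure_subset)

lemma test_function_differentiable: "test_function f \<Longrightarrow> f differentiable (at x)"
  using test_function_tcd[of f 1] by simp

lemma test_function_continuous: "test_function f \<Longrightarrow> continuous_on UNIV f"
  using test_function_tcd[of f 0] by simp

lemma test_function_meas: "test_function f \<Longrightarrow> f \<in> borel_measurable borel"
  by (intro borel_measurable_continuous_onI test_function_continuous)

lemma test_function_add:
  assumes "test_function f" "test_function g" shows "test_function (\<lambda>x. f x + g x)"
proof (rule test_function_subset)
  show "{x. f x + g x \<noteq> 0} \<subseteq> supp f \<union> supp g" using supp_superset[of f] supp_superset[of g] by fastforce
  show "times_cont_diff k (\<lambda>x. f x + g x)" for k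
    using assms by (intro times_cont_diff_add test_function_tcd)
  show "compact (supp f \<union> supp g)" using assms by (intro compact_Un test_function_supp)
qed

lemma test_function_uminus:
  assumes "test_function f" shows "test_function (\<lambda>x. - f x)"
proof (rule test_function_subset)
  show "{x. - f x \<noteq> 0} \<subseteq> supp f" using supp_superset[of f] by simp
  show "times_cont_diff k (\<lambda>x. - f x)" for k
    using assms by (intro times_cont_diff_uminus test_function_tcd)
  show "compact (supp f)" using assms by (rule test_function_supp)
qed

lemma test_function_0: "test_function (\<lambda>x. 0)"
  by (simp add: test_function_def times_cont_diff_0)

lemma test_function_sum:
  "finite I \<Longrightarrow> (\<And>i. i \<in> I \<Longrightarrow> test_function (f i)) \<Longrightarrow> test_function (\<lambda>x. \<Sum>i\<in>I. f i x)"
  by (induction I rule: finite_induct) (auto intro: test_function_0 test_function_add)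

lemma test_function_frd:
  assumes "test_function f" shows "test_function (frd f v)"
proof (rule test_function_subset)
  show "times_cont_diff k (frd f v)" for k
    using test_function_tcd[OF assms, of "Suc k"] by simp
  show "{x. frd f v x \<noteq> 0} \<subseteq> supp f"
  proof (rule ccontr)
    assume "\<not> ?thesis"
    then obtain x where x: "frd f v x \<noteq> 0" "x \<notin> supp f" by blast
    have "(f has_derivative (\<lambda>_. 0)) (at x)"
    proof (rule has_derivative_transform_within_open)
      show "((\<lambda>_. 0) has_derivative (\<lambda>_. 0)) (at x)" by simp
      show "open (- supp f)" unfolding supp_def by (rule open_Compl) simp
      show "x \<in> - supp f" using x by simp
      show "0 = f y" if "y \<in> - supp f" for y using that supp_superset[of f] by auto
    qed
    then show False using x(1) frd_eqI by blast
  qed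
  show "compact (supp f)" using assms by (rule test_function_supp)
qed

lemma test_function_laplacian: "test_function f \<Longrightarrow> test_function (laplacian f)"
  unfolding laplacian_def partial_deriv_def
  by (intro test_function_sum test_function_frd) auto

lemma test_function_bounded_support:
  assumes "test_function f"
  obtains R where "0 < R" "\<And>x. R < norm x \<Longrightarrow> f x = 0"
proof -
  obtain R where R: "0 < R" "\<And>x. x \<in> supp f \<Longrightarrow> norm x \<le> R"
    using compact_imp_bounded[OF test_function_supp[OF assms]] unfolding bounded_pos by blast
  have "f x = 0" if "R < norm x" for x
  proof (rule ccontr)
    assume "f x \<noteq> 0"
    then have "x \<in> supp f" using supp_superset[of f] by blast
    then show False using R(2)[of x] that by linarith
  qed
  with R(1) show ?thesis by (rule that[of R])
qed

lemma test_function_bounded: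
  assumes "test_function f"
  obtains B where "0 \<le> B" "\<And>x. \<bar>f x\<bar> \<le> B"
proof -
  have "compact (f ` supp f)"
    by (intro compact_continuous_image test_function_supp assms continuous_on_subset[OF test_function_continuous]) auto
  then have "bounded (f ` supp f)" by (rule compact_imp_bounded)
  then obtain B where B: "0 < B" "\<And>y. y \<in> f ` supp f \<Longrightarrow> norm y \<le> B"
    unfolding bounded_pos by blast
  have "\<bar>f x\<bar> \<le> B" for x
  proof (cases "f x = 0")
    case False
    then have "x \<in> supp f" using supp_superset[of f] by (intro subsetD[OF supp_superset]) simp
    then have "norm (f x) \<le> B" by (intro B(2) imageI)
    then show ?thesis by simp
  qed (use B in auto)
  then show ?thesis using B(1) that[of B] by simp
qed

lemma integrable_bounded_cball:
  fixes f :: "real^'n \<Rightarrow> 'b::{banach, second_countable_topology}"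
  assumes "f \<in> borel_measurable borel" "\<And>x. norm (f x) \<le> B" "\<And>x. R < norm x \<Longrightarrow> f x = 0"
  shows "integrable lborel f"
proof (rule Bochner_Integration.integrable_bound)
  show "integrable lborel (\<lambda>x. B * indicator (cball (0::real^'n) R) x :: real)"
    by (intro integrable_mult_right integrable_real_indicator) (auto simp: emeasure_bounded_finite[unfolded infinity_ennreal_def])
  show "AE x in lborel. norm (f x) \<le> norm (B * indicator (cball (0::real^'n) R) x :: real)"
    using assms(2,3) by (intro AE_I2) (auto simp: indicator_def not_le split: if_splits intro: order_trans[OF _ abs_ge_self])
qed (use assms in simp)

lemma test_function_integrable: assumes "test_function f" shows "integrable lborel f"
proof -
  obtain R where R: "0 < R" "\<And>x. R < norm x \<Longrightarrow> f x = 0" by (rule test_function_bounded_support[OF assms]) (rule that)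
  obtain B where B: "0 \<le> B" "\<And>x. \<bar>f x\<bar> \<le> B" by (rule test_function_bounded[OF assms]) (rule that)
  show ?thesis using test_function_meas[OF assms] R B by (intro integrable_bounded_cball[of f B R]) auto
qed

section \<open>The Fourier transform of a test function\<close>

lemma lborel_integral_shift:
  fixes f :: "'a::euclidean_space \<Rightarrow> 'b::{banach, second_countable_topology}"
  assumes [measurable]: "f \<in> borel_measurable borel"
  shows "(LINT x|lborel. f (x + c)) = (LINT x|lborel. f x)"
proof -
  have "(LINT x|lborel. f x) = (LINT x|distr lborel borel ((+) c). f x)"
    by (simp add: lborel_distr_plus)
  also have "\<dots> = (LINT x|lborel. f (c + x))" by (rule integral_distr) auto
  finally show ?thesis by (simp add: add.commute)
qed

abbreviation Fr :: "(real^'n \<Rightarrow> real) \<Rightarrow> real^'n \<Rightarrow> complex" where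
  "Fr \<phi> \<equiv> fourier (\<lambda>y. of_real (\<phi> y))"

lemma norm_of_real_mult_cis: "norm (of_real a * cis b) = \<bar>a\<bar>"
  by (simp add: norm_mult)

lemma cis_meas [measurable]: "cis \<in> borel_measurable borel"
  by (intro borel_measurable_continuous_onI continuous_intros)

lemma integrable_mult_cis:
  fixes f :: "'a \<Rightarrow> complex"
  assumes "integrable M f" "g \<in> borel_measurable M"
  shows "integrable M (\<lambda>x. f x * cis (g x))"
proof (rule Bochner_Integration.integrable_bound[OF assms(1)])
  have [measurable]: "f \<in> borel_measurable M" "g \<in> borel_measurable M" using assms by auto
  show "(\<lambda>x. f x * cis (g x)) \<in> borel_measurable M" by measurable
qed (simp add: norm_mult)


lemma Fr_integrable: assumes "integrable lborel \<phi>" shows "integrable lborel (\<lambda>x. of_real (\<phi> x) * cis (- (x \<bullet> \<xi>)))"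
  by (rule integrable_mult_cis) (use assms in auto)

lemma Fr_add: "integrable lborel f \<Longrightarrow> integrable lborel g \<Longrightarrow> Fr (\<lambda>x. f x + g x) \<xi> = Fr f \<xi> + Fr g \<xi>"
  unfolding fourier_def by (simp add: distrib_right Fr_integrable)

lemma Fr_uminus: "Fr (\<lambda>x. - f x) \<xi> = - Fr f \<xi>"
  unfolding fourier_def by simp

lemma Fr_sum: "finite I \<Longrightarrow> (\<And>i. i \<in> I \<Longrightarrow> integrable lborel (f i)) \<Longrightarrow> Fr (\<lambda>x. \<Sum>i\<in>I. f i x) \<xi> = (\<Sum>i\<in>I. Fr (f i) \<xi>)"
  unfolding fourier_def by (simp add: sum_distrib_right Fr_integrable)

lemma norm_Fr_le: "norm (Fr f \<xi>) \<le> (LINT x|lborel. \<bar>f x\<bar>)"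
  unfolding fourier_def by (rule order_trans[OF integral_norm_bound]) (simp add: norm_of_real_mult_cis)

lemma Fr_meas [measurable]:
  assumes [measurable]: "f \<in> borel_measurable borel" shows "Fr f \<in> borel_measurable borel"
  unfolding fourier_def by measurable

lemma Fr_shift:
  assumes [measurable]: "f \<in> borel_measurable borel"
  shows "Fr (\<lambda>x. f (x + v)) \<xi> = cis (v \<bullet> \<xi>) * Fr f \<xi>"
proof -
  have "Fr (\<lambda>x. f (x + v)) \<xi> = (LINT x|lborel. of_real (f (x + v)) * cis (- (((x + v) - v) \<bullet> \<xi>)))"
    unfolding fourier_def by simp
  also have "\<dots> = (LINT x|lborel. of_real (f x) * cis (- ((x - v) \<bullet> \<xi>)))"
    by (rule lborel_integral_shift[where f = "\<lambda>x. of_real (f x) * cis (- ((x - v) \<bullet> \<xi>))"]) measurable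
  also have "\<dots> = (LINT x|lborel. cis (v \<bullet> \<xi>) * (of_real (f x) * cis (- (x \<bullet> \<xi>))))"
    by (intro Bochner_Integration.integral_cong refl) (simp add: inner_diff_left cis_mult mult.left_commute)
  also have "\<dots> = cis (v \<bullet> \<xi>) * Fr f \<xi>" unfolding fourier_def by simp
  finally show ?thesis .
qed

lemma test_function_line_deriv:
  assumes "test_function f"
  shows "((\<lambda>s. f (x + s *\<^sub>R v)) has_real_derivative frd f v (x + s *\<^sub>R v)) (at s)"
proof -
  have d: "(f has_derivative (\<lambda>h. frd f h (x + s *\<^sub>R v))) (at (x + s *\<^sub>R v))"
    by (intro frd_works test_function_differentiable assms)
  have "((\<lambda>s. f (x + s *\<^sub>R v)) has_derivative (\<lambda>h. frd f (h *\<^sub>R v) (x + s *\<^sub>R v))) (at s)"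
    by (rule has_derivative_compose[of "\<lambda>s. x + s *\<^sub>R v" "\<lambda>h. h *\<^sub>R v", OF _ d]) (auto intro!: derivative_eq_intros)
  moreover have "(\<lambda>h. frd f (h *\<^sub>R v) (x + s *\<^sub>R v)) = (*) (frd f v (x + s *\<^sub>R v))"
    using linear_cmul[OF has_derivative_linear[OF d]] by (simp add: fun_eq_iff mult.commute)
  ultimately show ?thesis by (simp add: has_field_derivative_def)
qed

text \<open>Translation by a vector multiplies the transform by a character, so the transform of a
  difference quotient is explicit. The quotients are bounded by the mean value theorem and supported
  in a common ball because the steps are at most 1; dominated convergence gives the limit.\<close>

lemma Fr_frd:
  assumes "test_function f"
  shows "Fr (frd f v) \<xi> = \<i> * of_real (v \<bullet> \<xi>) * Fr f \<xi>"
proof -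
  define t where "t = (\<lambda>j. 1 / real (Suc j))"
  have t: "0 < t j" "t j \<le> 1" for j by (auto simp: t_def)
  have t0: "t \<longlonglongrightarrow> 0" unfolding t_def by (rule LIMSEQ_inverse_real_of_nat[unfolded inverse_eq_divide])
  define q where "q j x = (f (x + t j *\<^sub>R v) - f x) / t j" for j x
  obtain R where R: "0 < R" "\<And>x. R < norm x \<Longrightarrow> f x = 0" by (rule test_function_bounded_support[OF assms]) (rule that)
  obtain B where B: "0 \<le> B" "\<And>x. \<bar>frd f v x\<bar> \<le> B" by (rule test_function_bounded[OF test_function_frd[OF assms]]) (rule that)
  have [measurable]: "f \<in> borel_measurable borel" "frd f v \<in> borel_measurable borel"
    using assms by (auto intro: test_function_meas test_function_frd)
  have qB: "\<bar>q j x\<bar> \<le> B" for j x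
  proof -
    have "\<exists>z. 0 < z \<and> z < t j \<and> f (x + t j *\<^sub>R v) - f (x + 0 *\<^sub>R v) = (t j - 0) * frd f v (x + z *\<^sub>R v)"
      using t[of j] by (intro MVT2 test_function_line_deriv assms)
    then obtain z where "f (x + t j *\<^sub>R v) - f (x + 0 *\<^sub>R v) = (t j - 0) * frd f v (x + z *\<^sub>R v)"
      by (elim exE conjE) (rule that)
    then have "q j x = frd f v (x + z *\<^sub>R v)" using t[of j] by (simp add: q_def)
    then show ?thesis using B by simp
  qed
  have q0: "q j x = 0" if "R + norm v < norm x" for j x
  proof -
    have "norm (t j *\<^sub>R v) \<le> norm v" using t[of j] by (simp add: mult_left_le_one_le)
    then have "R < norm (x + t j *\<^sub>R v)" using that norm_triangle_ineq2[of x "- (t j *\<^sub>R v)"] by simp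
    moreover have "R < norm x" using that norm_ge_zero[of v] by linarith
    ultimately show ?thesis using R(2) by (simp add: q_def)
  qed
  have qm [measurable]: "q j \<in> borel_measurable borel" for j unfolding q_def by measurable
  have qlim: "(\<lambda>j. q j x) \<longlonglongrightarrow> frd f v x" for x
  proof -
    have "((\<lambda>h. (f (x + (0 + h) *\<^sub>R v) - f (x + 0 *\<^sub>R v)) / h) \<longlongrightarrow> frd f v (x + 0 *\<^sub>R v)) (at 0)"
      using test_function_line_deriv[OF assms, of x v 0] by (simp add: DERIV_def)
    moreover have "filterlim t (at 0) sequentially"
      using t0 t by (auto simp: filterlim_at less_imp_neq[symmetric])
    ultimately have "(\<lambda>j. (f (x + (0 + t j) *\<^sub>R v) - f (x + 0 *\<^sub>R v)) / t j) \<longlonglongrightarrow> frd f v (x + 0 *\<^sub>R v)"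
      by (rule filterlim_compose)
    then show ?thesis by (simp add: q_def)
  qed
  have "(\<lambda>j. Fr (q j) \<xi>) \<longlonglongrightarrow> Fr (frd f v) \<xi>"
    unfolding fourier_def
  proof (rule integral_dominated_convergence[where w = "\<lambda>x. B * indicator (cball 0 (R + norm v)) x"])
    show "AE x in lborel. (\<lambda>j. complex_of_real (q j x) * cis (- (x \<bullet> \<xi>))) \<longlonglongrightarrow> complex_of_real (frd f v x) * cis (- (x \<bullet> \<xi>))"
      by (intro AE_I2 tendsto_intros qlim)
    show "AE x in lborel. norm (complex_of_real (q j x) * cis (- (x \<bullet> \<xi>))) \<le> B * indicator (cball 0 (R + norm v)) x" for j
      using qB q0 by (intro AE_I2) (auto simp: norm_of_real_mult_cis indicator_def not_le)
    show "integrable lborel (\<lambda>x. B * indicator (cball (0::real^'n) (R + norm v)) x)"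
      by (intro integrable_mult_right integrable_real_indicator) (auto simp: emeasure_bounded_finite[unfolded infinity_ennreal_def])
  qed measurable
  moreover have "(\<lambda>j. Fr (q j) \<xi>) \<longlonglongrightarrow> \<i> * of_real (v \<bullet> \<xi>) * Fr f \<xi>"
  proof -
    have fi: "integrable lborel f" using assms by (rule test_function_integrable)
    have fsi: "integrable lborel (\<lambda>x. f (x + c))" for c
    proof -
      have "integrable (distr lborel borel ((+) c)) f" using fi by (simp add: lborel_distr_plus)
      then show ?thesis by (subst (asm) integrable_distr_eq) (auto simp: add.commute)
    qed
    have 1: "Fr (q j) \<xi> = (cis (t j * (v \<bullet> \<xi>)) - 1) / t j * Fr f \<xi>" for j
    proof -
      have "Fr (q j) \<xi> = (LINT x|lborel. (of_real (f (x + t j *\<^sub>R v)) * cis (- (x \<bullet> \<xi>)) - of_real (f x) * cis (- (x \<bullet> \<xi>))) / of_real (t j))"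
        unfolding fourier_def q_def by (intro Bochner_Integration.integral_cong refl) (simp add: field_simps)
      also have "\<dots> = (Fr (\<lambda>x. f (x + t j *\<^sub>R v)) \<xi> - Fr f \<xi>) / of_real (t j)"
        unfolding fourier_def using fi fsi by (simp add: Fr_integrable)
      finally show ?thesis by (simp add: Fr_shift) (simp add: algebra_simps)
    qed
    have 2: "(\<lambda>j. (cis (t j * (v \<bullet> \<xi>)) - 1) / t j) \<longlonglongrightarrow> \<i> * of_real (v \<bullet> \<xi>)"
    proof -
      have "((\<lambda>z. exp (\<i> * (z * of_real (v \<bullet> \<xi>)))) has_field_derivative \<i> * of_real (v \<bullet> \<xi>)) (at 0)"
        by (auto intro!: derivative_eq_intros)
      then have "((\<lambda>h. (exp (\<i> * ((0 + h) * of_real (v \<bullet> \<xi>))) - exp (\<i> * (0 * of_real (v \<bullet> \<xi>)))) / h) \<longlongrightarrow> \<i> * of_real (v \<bullet> \<xi>)) (at 0)"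
        unfolding DERIV_def .
      moreover have "filterlim (\<lambda>j. of_real (t j) :: complex) (at 0) sequentially"
        using tendsto_of_real[OF t0, where 'a = complex] t by (auto simp: filterlim_at less_imp_neq[symmetric])
      ultimately have "(\<lambda>j. (exp (\<i> * ((0 + of_real (t j)) * of_real (v \<bullet> \<xi>))) - exp (\<i> * (0 * of_real (v \<bullet> \<xi>)))) / of_real (t j)) \<longlonglongrightarrow> \<i> * of_real (v \<bullet> \<xi>)"
        by (rule filterlim_compose)
      then show ?thesis by (simp add: cis_conv_exp)
    qed
    show ?thesis unfolding 1 by (intro tendsto_mult tendsto_const 2)
  qed
  ultimately show ?thesis by (rule LIMSEQ_unique)
qed

lemma Fr_laplacian:
  assumes "test_function f"
  shows "Fr (laplacian f) \<xi> = - of_real ((norm \<xi>)\<^sup>2) * Fr f \<xi>"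
proof -
  have t: "test_function (frd f v)" "test_function (frd (frd f v) w)" for v w
    by (rule test_function_frd, fact assms) (rule test_function_frd, rule test_function_frd, fact assms)
  have "Fr (laplacian f) \<xi> = (\<Sum>i\<in>UNIV. Fr (frd (frd f (axis i 1)) (axis i 1)) \<xi>)"
    unfolding laplacian_def partial_deriv_def
    by (rule Fr_sum) (simp, rule test_function_integrable, rule t)
  also have "\<dots> = (\<Sum>i\<in>UNIV. - of_real ((\<xi> $ i)\<^sup>2) * Fr f \<xi>)"
    using assms t by (intro sum.cong refl) (simp add: Fr_frd inner_axis' power2_eq_square mult_ac)
  also have "\<dots> = - of_real ((norm \<xi>)\<^sup>2) * Fr f \<xi>"
    unfolding norm_vec_def L2_set_def by (simp add: sum_negf sum_distrib_right sum_nonneg)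
  finally show ?thesis .
qed

lemma Fr_iterate_laplacian:
  assumes "test_function f"
  shows "test_function (((\<lambda>f x. - laplacian f x) ^^ k) f) \<and>
    Fr (((\<lambda>f x. - laplacian f x) ^^ k) f) \<xi> = of_real (norm \<xi> ^ (2 * k)) * Fr f \<xi>"
proof (induction k)
  case (Suc k)
  let ?g = "((\<lambda>f x. - laplacian f x) ^^ k) f"
  have "test_function ?g" using Suc by simp
  moreover have "Fr (\<lambda>x. - laplacian ?g x) \<xi> = of_real ((norm \<xi>)\<^sup>2) * Fr ?g \<xi>"
    using Fr_laplacian[of ?g \<xi>] Fr_uminus[of "laplacian ?g" \<xi>] Suc by simp
  ultimately show ?case
    using Suc by (auto intro!: test_function_uminus test_function_laplacian simp: power_add power2_eq_square)
qed (use assms in simp)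

text \<open>\<open>f - laplacian f\<close> is again a test function and its transform is
  \<open>(bracket \<xi>)\<^sup>2 * Fr f \<xi>\<close>, so each induction step gains two powers of
  \<open>bracket\<close>, starting from the trivial L1 bound.\<close>

lemma Fr_decay:
  assumes "test_function f"
  shows "\<exists>C\<ge>0. \<forall>\<xi>. bracket \<xi> ^ (2 * N) * norm (Fr f \<xi>) \<le> C"
  using assms
proof (induction N arbitrary: f)
  case 0
  then show ?case using norm_Fr_le[of f] by (intro exI[of _ "LINT x|lborel. \<bar>f x\<bar>"]) auto
next
  case (Suc N)
  let ?g = "\<lambda>x. f x + - laplacian f x"
  have l: "test_function (laplacian f)" using Suc.prems by (rule test_function_laplacian)
  have "test_function ?g" by (intro test_function_add test_function_uminus l Suc.prems)
  then obtain C where C: "0 \<le> C" "\<And>\<xi>. bracket \<xi> ^ (2 * N) * norm (Fr ?g \<xi>) \<le> C"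
    using Suc.IH[of ?g] by blast
  have 1: "Fr ?g \<xi> = of_real ((bracket \<xi>)\<^sup>2) * Fr f \<xi>" for \<xi>
  proof -
    have "Fr ?g \<xi> = Fr f \<xi> + Fr (\<lambda>x. - laplacian f x) \<xi>"
      using Suc.prems l by (intro Fr_add test_function_integrable test_function_uminus)
    also have "Fr (\<lambda>x. - laplacian f x) \<xi> = of_real ((norm \<xi>)\<^sup>2) * Fr f \<xi>"
      using Fr_laplacian[OF Suc.prems] Fr_uminus[of "laplacian f"] by simp
    finally show ?thesis by (simp add: bracket_def algebra_simps)
  qed
  have "norm (Fr ?g \<xi>) = (bracket \<xi>)\<^sup>2 * norm (Fr f \<xi>)" for \<xi>
    unfolding 1 norm_mult norm_of_real by simp
  then have "bracket \<xi> ^ (2 * Suc N) * norm (Fr f \<xi>) \<le> C" for \<xi>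
    using C(2)[of \<xi>] by (simp add: power_add power2_eq_square mult_ac)
  with C(1) show ?case by blast
qed

section \<open>Gaussians and Fourier inversion\<close>

lemma integrable_gauss1:
  assumes "0 < t" shows "integrable lborel (\<lambda>x::real. exp (- t * x\<^sup>2))"
proof -
  have "integrable lborel (\<lambda>x. std_normal_density (0 + sqrt (2 * t) * x))"
    using assms by (intro lborel_integrable_real_affine integrable_normal_density) auto
  then have "integrable lborel (\<lambda>x. sqrt (2 * pi) * std_normal_density (0 + sqrt (2 * t) * x))"
    by (rule integrable_mult_right)
  then show ?thesis using assms by (simp add: std_normal_density_def power_mult_distrib)
qed

lemma gauss1_fourier:
  assumes "0 < t"
  shows "(LINT x|lborel. of_real (exp (- t * x\<^sup>2)) * cis (x * u)) = of_real (sqrt (pi / t) * exp (- u\<^sup>2 / (4 * t)))"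
proof -
  \<comment> \<open>At this scale the standard normal density becomes a multiple of
    \<open>exp (- t * x\<^sup>2)\<close>, so its characteristic function gives the
    transform.\<close>
  define c where "c = sqrt (2 * t)"
  have c: "0 < c" "c\<^sup>2 = 2 * t" using assms by (auto simp: c_def)
  have "of_real (exp (- (u / c)\<^sup>2 / 2)) = char std_normal_distribution (u / c)"
    by (simp add: char_std_normal_distribution)
  also have "\<dots> = (LINT x|lborel. std_normal_density x *\<^sub>R cis (u / c * x))"
    unfolding char_def by (subst integral_density) (auto simp: cis_conv_exp normal_density_nonneg)
  also have "\<dots> = \<bar>c\<bar> *\<^sub>R (LINT x|lborel. std_normal_density (0 + c * x) *\<^sub>R cis (u / c * (0 + c * x)))"
    using c by (intro lborel_integral_real_affine) auto
  also have "(\<lambda>x. std_normal_density (0 + c * x) *\<^sub>R cis (u / c * (0 + c * x)))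
      = (\<lambda>x. of_real (1 / sqrt (2 * pi)) * (of_real (exp (- t * x\<^sup>2)) * cis (x * u)))"
    using c by (simp add: fun_eq_iff std_normal_density_def power_mult_distrib scaleR_conv_of_real mult.commute)
  also have "\<bar>c\<bar> *\<^sub>R (LINT x|lborel. of_real (1 / sqrt (2 * pi)) * (of_real (exp (- t * x\<^sup>2)) * cis (x * u)))
     = of_real (c / sqrt (2 * pi)) * (LINT x|lborel. of_real (exp (- t * x\<^sup>2)) * cis (x * u))"
    using c by (subst integral_mult_right_zero) (simp add: scaleR_conv_of_real)
  finally have *: "of_real (c / sqrt (2 * pi)) * (LINT x|lborel. of_real (exp (- t * x\<^sup>2)) * cis (x * u))
    = (of_real (exp (- (u / c)\<^sup>2 / 2)) :: complex)" by simp
  have **: "sqrt (pi / t) * (c / sqrt (2 * pi)) = 1"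
    using assms by (simp add: c_def real_sqrt_mult real_sqrt_divide)
  have "(LINT x|lborel. of_real (exp (- t * x\<^sup>2)) * cis (x * u))
    = of_real (sqrt (pi / t) * (c / sqrt (2 * pi))) * (LINT x|lborel. of_real (exp (- t * x\<^sup>2)) * cis (x * u))"
    unfolding ** by simp
  also have "\<dots> = of_real (sqrt (pi / t)) * (of_real (exp (- (u / c)\<^sup>2 / 2)) :: complex)"
    unfolding of_real_mult mult.assoc * ..
  also have "- (u / c)\<^sup>2 / 2 = - u\<^sup>2 / (4 * t)" using c by (simp add: power_divide)
  finally show ?thesis by simp
qed

lemma integral_lborel_prod:
  fixes f :: "'a::euclidean_space \<Rightarrow> real \<Rightarrow> complex"
  assumes f: "\<And>b. b \<in> Basis \<Longrightarrow> integrable lborel (f b)"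
  shows "(LINT x|lborel. (\<Prod>b\<in>Basis. f b (x \<bullet> b))) = (\<Prod>b\<in>Basis. LINT x|lborel. f b x)"
proof -
  interpret product_sigma_finite "\<lambda>_::'a. lborel :: real measure" ..
  have [measurable]: "b \<in> Basis \<Longrightarrow> f b \<in> borel_measurable borel" for b
    using borel_measurable_integrable[OF f] by simp
  have "(LINT x|lborel. (\<Prod>b\<in>Basis. f b (x \<bullet> b)))
     = (LINT x|distr (\<Pi>\<^sub>M b\<in>Basis. lborel) borel (\<lambda>f. \<Sum>b\<in>Basis. f b *\<^sub>R b). (\<Prod>b\<in>Basis. f b (x \<bullet> b)))"
    by (subst lborel_eq) simp
  also have "\<dots> = (LINT g|(\<Pi>\<^sub>M b\<in>Basis. lborel). (\<Prod>b\<in>Basis. f b ((\<Sum>b\<in>Basis. g b *\<^sub>R b) \<bullet> b)))"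
    by (rule integral_distr) measurable
  also have "\<dots> = (LINT g|(\<Pi>\<^sub>M b\<in>Basis. lborel). (\<Prod>b\<in>Basis. f b (g b)))"
    by (intro Bochner_Integration.integral_cong refl prod.cong) (simp add: inner_sum_left inner_Basis if_distrib cong: if_cong)
  also have "\<dots> = (\<Prod>b\<in>Basis. LINT x|lborel. f b x)"
    using f by (intro product_integral_prod) auto
  finally show ?thesis .
qed

lemma norm_sq_Basis: "(norm x)\<^sup>2 = (\<Sum>b\<in>Basis. (x \<bullet> b)\<^sup>2)"
  by (subst power2_norm_eq_inner, subst euclidean_inner) (simp add: power2_eq_square)

lemma exp_norm_sq_prod: "exp (- t * (norm x)\<^sup>2) = (\<Prod>b\<in>Basis. exp (- t * (x \<bullet> b)\<^sup>2))"
  by (simp add: norm_sq_Basis exp_sum[symmetric] sum_distrib_left)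

lemma integrable_gauss:
  assumes "0 < t" shows "integrable lborel (\<lambda>x::'a::euclidean_space. exp (- t * (norm x)\<^sup>2))"
proof (rule integrableI_nonneg)
  have "(\<integral>\<^sup>+x. ennreal (exp (- t * (norm (x::'a))\<^sup>2)) \<partial>lborel) = (\<integral>\<^sup>+x. (\<Prod>b\<in>Basis. ennreal (exp (- t * (x \<bullet> b)\<^sup>2))) \<partial>(lborel :: 'a measure))"
    by (simp only: exp_norm_sq_prod prod_ennreal[OF exp_ge_zero])
  also have "\<dots> = (\<Prod>b\<in>(Basis::'a set). (\<integral>\<^sup>+x. ennreal (exp (- t * x\<^sup>2)) \<partial>lborel))"
    by (rule nn_integral_lborel_prod) auto
  also have "\<dots> < \<infinity>"
    using integrable_gauss1[OF assms] by (subst nn_integral_eq_integral) (auto simp: ennreal_power)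
  finally show "(\<integral>\<^sup>+x. ennreal (exp (- t * (norm (x::'a))\<^sup>2)) \<partial>lborel) < \<infinity>" .
qed auto

lemma gauss_fourier:
  fixes \<xi> :: "'a::euclidean_space"
  assumes "0 < t"
  shows "(LINT x|lborel. of_real (exp (- t * (norm x)\<^sup>2)) * cis (x \<bullet> \<xi>)) =
    of_real ((pi / t) powr (real DIM('a) / 2) * exp (- (norm \<xi>)\<^sup>2 / (4 * t)))"
proof -
  have cs: "cis (x \<bullet> \<xi>) = (\<Prod>b\<in>Basis. cis ((x \<bullet> b) * (\<xi> \<bullet> b)))" for x
    by (subst euclidean_inner) (simp add: cis_conv_exp exp_sum[symmetric] sum_distrib_left)
  have "(LINT x|lborel. of_real (exp (- t * (norm x)\<^sup>2)) * cis (x \<bullet> \<xi>))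
    = (LINT x|lborel. (\<Prod>b\<in>Basis. of_real (exp (- t * (x \<bullet> b)\<^sup>2)) * cis ((x \<bullet> b) * (\<xi> \<bullet> b))))"
    unfolding exp_norm_sq_prod cs by (simp add: prod.distrib)
  also have "\<dots> = (\<Prod>b\<in>Basis. LINT x|lborel. of_real (exp (- t * x\<^sup>2)) * cis (x * (\<xi> \<bullet> b)))"
    by (rule integral_lborel_prod) (intro integrable_mult_cis integrable_of_real integrable_gauss1 assms, measurable)
  also have "\<dots> = (\<Prod>b\<in>(Basis::'a set). of_real (sqrt (pi / t) * exp (- (\<xi> \<bullet> b)\<^sup>2 / (4 * t))))"
    using assms by (simp only: gauss1_fourier)
  also have "\<dots> = of_real (sqrt (pi / t) ^ DIM('a) * exp (\<Sum>b\<in>(Basis::'a set). - (\<xi> \<bullet> b)\<^sup>2 / (4 * t)))"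
    by (simp add: prod.distrib exp_sum)
  also have "sqrt (pi / t) ^ DIM('a) = (pi / t) powr (real DIM('a) / 2)"
    using assms by (simp add: powr_half_sqrt[symmetric] powr_realpow[symmetric] powr_powr)
  also have "(\<Sum>b\<in>(Basis::'a set). - (\<xi> \<bullet> b)\<^sup>2 / (4 * t)) = - (norm \<xi>)\<^sup>2 / (4 * t)"
    by (simp add: norm_sq_Basis sum_negf sum_divide_distrib)
  finally show ?thesis .
qed

section \<open>Gaussian means and Fourier inversion\<close>

lemma integrable_pair_mult:
  fixes f :: "'a::euclidean_space \<Rightarrow> complex" and g :: "'b::euclidean_space \<Rightarrow> complex"
  assumes f: "integrable lborel f" and g: "integrable lborel g"
  shows "integrable (lborel \<Otimes>\<^sub>M lborel) (\<lambda>p. f (fst p) * g (snd p))"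
proof (rule lborel_pair.Fubini_integrable)
  have [measurable]: "f \<in> borel_measurable borel" "g \<in> borel_measurable borel"
    using f g by auto
  show "(\<lambda>p. f (fst p) * g (snd p)) \<in> borel_measurable (lborel \<Otimes>\<^sub>M lborel)" by measurable
  show "integrable lborel (\<lambda>x. LINT y|lborel. norm (f (fst (x, y)) * g (snd (x, y))))"
    using f by (simp add: norm_mult)
  show "AE x in lborel. integrable lborel (\<lambda>y. f (fst (x, y)) * g (snd (x, y)))"
    using g by simp
qed

lemma Fubini_cis:
  fixes f :: "'a::euclidean_space \<Rightarrow> complex" and g :: "'b::euclidean_space \<Rightarrow> complex"
  assumes f: "integrable lborel f" and g: "integrable lborel g"
    and h: "(\<lambda>p. h (fst p) (snd p)) \<in> borel_measurable (borel \<Otimes>\<^sub>M borel)"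
  shows "(LINT x|lborel. f x * (LINT y|lborel. g y * cis (h x y))) = (LINT y|lborel. g y * (LINT x|lborel. f x * cis (h x y)))"
proof -
  have "integrable (lborel \<Otimes>\<^sub>M lborel) (\<lambda>p. (f (fst p) * g (snd p)) * cis (h (fst p) (snd p)))"
    using h by (intro integrable_mult_cis integrable_pair_mult f g) (simp cong: measurable_cong_sets)
  then have "(LINT y|lborel. LINT x|lborel. (f x * g y) * cis (h x y)) = (LINT x|lborel. LINT y|lborel. (f x * g y) * cis (h x y))"
    by (intro lborel_pair.Fubini_integral) (simp add: case_prod_beta')
  moreover have "(LINT y|lborel. LINT x|lborel. (f x * g y) * cis (h x y)) = (LINT y|lborel. g y * (LINT x|lborel. f x * cis (h x y)))"
    by (subst integral_mult_right_zero[symmetric]) (simp add: mult_ac)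
  moreover have "(LINT x|lborel. LINT y|lborel. (f x * g y) * cis (h x y)) = (LINT x|lborel. f x * (LINT y|lborel. g y * cis (h x y)))"
    by (subst integral_mult_right_zero[symmetric]) (simp add: mult_ac)
  ultimately show ?thesis by simp
qed

lemma inv_fourier_meas [measurable]:
  assumes [measurable]: "h \<in> borel_measurable borel" shows "inv_fourier h \<in> borel_measurable borel"
  unfolding inv_fourier_def by measurable

lemma inv_fourier_bounded: "norm (inv_fourier h x) \<le> (LINT \<xi>|lborel. norm (h \<xi>)) / (2 * pi) ^ CARD('n)"
  for h :: "real^'n \<Rightarrow> complex"
proof -
  have "norm (LINT \<xi>|lborel. h \<xi> * cis (x \<bullet> \<xi>)) \<le> (LINT \<xi>|lborel. norm (h \<xi>))"
    by (rule order_trans[OF integral_norm_bound]) (simp add: norm_mult)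
  then show ?thesis unfolding inv_fourier_def norm_divide norm_of_real by (simp add: divide_right_mono)
qed

lemma inv_fourier_continuous:
  assumes "integrable lborel h" shows "isCont (inv_fourier h) y"
  unfolding continuous_at_sequentially o_def
proof (intro allI impI)
  fix X :: "nat \<Rightarrow> real^'a" assume X: "X \<longlonglongrightarrow> y"
  have [measurable]: "h \<in> borel_measurable borel" using assms by auto
  have "(\<lambda>j. LINT \<xi>|lborel. h \<xi> * cis (X j \<bullet> \<xi>)) \<longlonglongrightarrow> (LINT \<xi>|lborel. h \<xi> * cis (y \<bullet> \<xi>))"
  proof (rule integral_dominated_convergence[where w = "\<lambda>\<xi>. norm (h \<xi>)"])
    show "AE \<xi> in lborel. (\<lambda>j. h \<xi> * cis (X j \<bullet> \<xi>)) \<longlonglongrightarrow> h \<xi> * cis (y \<bullet> \<xi>)"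
    proof (rule AE_I2)
      fix \<xi> :: "real^'a"
      show "(\<lambda>j. h \<xi> * cis (X j \<bullet> \<xi>)) \<longlonglongrightarrow> h \<xi> * cis (y \<bullet> \<xi>)"
        by (intro tendsto_intros X)
    qed
  qed (use assms in \<open>auto simp: norm_mult\<close>)
  then show "(\<lambda>j. inv_fourier h (X j)) \<longlonglongrightarrow> inv_fourier h y"
    unfolding inv_fourier_def by (intro tendsto_intros) auto
qed

lemma gauss_shift_fourier:
  fixes y \<xi> :: "'a::euclidean_space"
  assumes "0 < t"
  shows "(LINT x|lborel. of_real (exp (- t * (norm (x - y))\<^sup>2)) * cis (x \<bullet> \<xi>)) =
    cis (y \<bullet> \<xi>) * of_real ((pi / t) powr (real DIM('a) / 2) * exp (- (norm \<xi>)\<^sup>2 / (4 * t)))"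
proof -
  have "(LINT x|lborel. of_real (exp (- t * (norm (x - y))\<^sup>2)) * cis (x \<bullet> \<xi>))
    = (LINT x|lborel. of_real (exp (- t * (norm (x + y - y))\<^sup>2)) * cis ((x + y) \<bullet> \<xi>))"
    by (rule lborel_integral_shift[symmetric]) measurable
  also have "\<dots> = (LINT x|lborel. cis (y \<bullet> \<xi>) * (of_real (exp (- t * (norm x)\<^sup>2)) * cis (x \<bullet> \<xi>)))"
    by (intro Bochner_Integration.integral_cong refl) (simp add: inner_add_left cis_mult mult.left_commute add.commute)
  also have "\<dots> = cis (y \<bullet> \<xi>) * of_real ((pi / t) powr (real DIM('a) / 2) * exp (- (norm \<xi>)\<^sup>2 / (4 * t)))"
    by (subst integral_mult_right_zero, subst gauss_fourier[OF assms]) simp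
  finally show ?thesis .
qed

lemma integrable_gauss_shift:
  assumes "0 < t" shows "integrable lborel (\<lambda>x::'a::euclidean_space. exp (- t * (norm (x - y))\<^sup>2))"
proof -
  have "integrable (distr lborel borel ((+) (- y))) (\<lambda>x::'a. exp (- t * (norm x)\<^sup>2))"
    using integrable_gauss[OF assms] by (simp add: lborel_distr_plus)
  then show ?thesis by (subst (asm) integrable_distr_eq) auto
qed

text \<open>Fubini carries a Gaussian in \<open>x\<close> to a Gaussian in \<open>\<xi>\<close>.
  Inversion, the vanishing mean of \<open>hnl f\<close> and its logarithmic potential all rest on
  this identity.\<close>

lemma gauss_inv_fourier:
  fixes h :: "real^'n \<Rightarrow> complex"
  assumes t: "0 < t" and h: "integrable lborel h"
  shows "(LINT x|lborel. of_real (exp (- t * (norm (x - y))\<^sup>2)) * inv_fourier h x) =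
    of_real ((pi / t) powr (real CARD('n) / 2) / (2 * pi) ^ CARD('n)) *
    (LINT \<xi>|lborel. h \<xi> * cis (y \<bullet> \<xi>) * of_real (exp (- (norm \<xi>)\<^sup>2 / (4 * t))))"
proof -
  let ?g = "\<lambda>x. of_real (exp (- t * (norm (x - y))\<^sup>2)) :: complex"
  have "(LINT x|lborel. ?g x * inv_fourier h x) = (LINT x|lborel. ?g x * (LINT \<xi>|lborel. h \<xi> * cis (x \<bullet> \<xi>))) / of_real ((2 * pi) ^ CARD('n))"
    unfolding inv_fourier_def by simp
  also have "(LINT x|lborel. ?g x * (LINT \<xi>|lborel. h \<xi> * cis (x \<bullet> \<xi>))) = (LINT \<xi>|lborel. h \<xi> * (LINT x|lborel. ?g x * cis (x \<bullet> \<xi>)))"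
    using t h by (intro Fubini_cis integrable_of_real integrable_gauss_shift) auto
  also have "\<dots> = (LINT \<xi>|lborel. of_real ((pi / t) powr (real CARD('n) / 2)) * (h \<xi> * cis (y \<bullet> \<xi>) * of_real (exp (- (norm \<xi>)\<^sup>2 / (4 * t)))))"
    unfolding gauss_shift_fourier[OF t] by (intro Bochner_Integration.integral_cong refl) (simp add: mult_ac)
  finally show ?thesis by simp
qed

lemma lborel_integral_scale:
  fixes f :: "'a::euclidean_space \<Rightarrow> 'b::{banach, second_countable_topology}"
  assumes [measurable]: "f \<in> borel_measurable borel" and c: "0 < c"
  shows "(LINT x|lborel. f x) = c ^ DIM('a) *\<^sub>R (LINT x|lborel. f (y + c *\<^sub>R x))"
proof -
  have "(LINT x|lborel. f x) = (LINT x|density (distr lborel borel (\<lambda>x. y + c *\<^sub>R x)) (\<lambda>_. ennreal (\<bar>c\<bar> ^ DIM('a))). f x)"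
    using lborel_affine[of c y] c by simp
  also have "\<dots> = (LINT x|distr lborel borel (\<lambda>x. y + c *\<^sub>R x). (\<bar>c\<bar> ^ DIM('a)) *\<^sub>R f x)"
    by (subst integral_density) auto
  also have "\<dots> = c ^ DIM('a) *\<^sub>R (LINT x|lborel. f (y + c *\<^sub>R x))"
    using c by (subst integral_distr) auto
  finally show ?thesis .
qed

text \<open>Gaussians concentrating at \<open>y\<close> form an approximate identity: rescaling by
  \<open>s j\<close> turns the vanishing integrals into Gaussian means of
  \<open>d (y + s j *\<^sub>R x)\<close>, which tend to a positive multiple of
  \<open>d y\<close>.\<close>

lemma gauss_zero:
  fixes d :: "'a::euclidean_space \<Rightarrow> complex"
  assumes [measurable]: "d \<in> borel_measurable borel" and B: "\<And>x. norm (d x) \<le> B" and c: "isCont d y"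
    and z: "\<And>t. 0 < t \<Longrightarrow> (LINT x|lborel. of_real (exp (- t * (norm (x - y))\<^sup>2)) * d x) = 0"
  shows "d y = 0"
proof -
  define s where "s = (\<lambda>j. 1 / real (Suc j))"
  have s: "0 < s j" for j by (simp add: s_def)
  have s0: "s \<longlonglongrightarrow> 0" unfolding s_def by (rule LIMSEQ_inverse_real_of_nat[unfolded inverse_eq_divide])
  have 0: "(LINT x|lborel. of_real (exp (- 1 * (norm x)\<^sup>2)) * d (y + s j *\<^sub>R x)) = 0" for j
  proof -
    have "0 = (LINT x|lborel. of_real (exp (- (1 / (s j)\<^sup>2) * (norm (x - y))\<^sup>2)) * d x)"
      using z[of "1 / (s j)\<^sup>2"] s[of j] by simp
    also have "\<dots> = (s j) ^ DIM('a) *\<^sub>R (LINT x|lborel. of_real (exp (- (1 / (s j)\<^sup>2) * (norm (y + s j *\<^sub>R x - y))\<^sup>2)) * d (y + s j *\<^sub>R x))"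
      by (rule lborel_integral_scale) (measurable, rule s)
    also have "(LINT x|lborel. of_real (exp (- (1 / (s j)\<^sup>2) * (norm (y + s j *\<^sub>R x - y))\<^sup>2)) * d (y + s j *\<^sub>R x))
       = (LINT x|lborel. of_real (exp (- 1 * (norm x)\<^sup>2)) * d (y + s j *\<^sub>R x))"
      using s[of j] by (intro Bochner_Integration.integral_cong refl) (simp add: power_mult_distrib)
    finally show ?thesis using s[of j] by simp
  qed
  have g: "integrable lborel (\<lambda>x::'a. exp (- 1 * (norm x)\<^sup>2))" by (rule integrable_gauss) simp
  have "(\<lambda>j. LINT x|lborel. of_real (exp (- 1 * (norm x)\<^sup>2)) * d (y + s j *\<^sub>R x)) \<longlonglongrightarrow> (LINT x|lborel. of_real (exp (- 1 * (norm (x::'a))\<^sup>2)) * d y)"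
  proof (rule integral_dominated_convergence[where w = "\<lambda>x. exp (- 1 * (norm x)\<^sup>2) * B"])
    show "integrable lborel (\<lambda>x::'a. exp (- 1 * (norm x)\<^sup>2) * B)" using g by (rule integrable_mult_left)
    show "AE x in lborel. (\<lambda>j. of_real (exp (- 1 * (norm x)\<^sup>2)) * d (y + s j *\<^sub>R x)) \<longlonglongrightarrow> of_real (exp (- 1 * (norm x)\<^sup>2)) * d y"
    proof (rule AE_I2)
      fix x :: 'a
      have "(\<lambda>j. y + s j *\<^sub>R x) \<longlonglongrightarrow> y + 0 *\<^sub>R x" by (intro tendsto_intros s0)
      then have "(\<lambda>j. y + s j *\<^sub>R x) \<longlonglongrightarrow> y" by simp
      then have "(\<lambda>j. d (y + s j *\<^sub>R x)) \<longlonglongrightarrow> d y" by (rule isCont_tendsto_compose[OF c])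
      then show "(\<lambda>j. of_real (exp (- 1 * (norm x)\<^sup>2)) * d (y + s j *\<^sub>R x)) \<longlonglongrightarrow> of_real (exp (- 1 * (norm x)\<^sup>2)) * d y"
        by (intro tendsto_intros)
    qed
    show "AE x in lborel. norm (of_real (exp (- 1 * (norm x)\<^sup>2)) * d (y + s j *\<^sub>R x)) \<le> exp (- 1 * (norm x)\<^sup>2) * B" for j
      using B by (intro AE_I2) (simp add: norm_mult mult_left_mono)
  qed measurable
  then have "(LINT x|lborel. of_real (exp (- 1 * (norm (x::'a))\<^sup>2)) * d y) = 0"
    unfolding 0 by (simp add: LIMSEQ_const_iff)
  moreover have "(LINT x|lborel. of_real (exp (- 1 * (norm (x::'a))\<^sup>2)) :: complex) = of_real (pi powr (real DIM('a) / 2))"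
    using gauss_fourier[of 1 "0::'a"] by simp
  ultimately show ?thesis by simp
qed

text \<open>\<open>Fr_decay\<close> with \<open>N = p + n\<close>: the factor
  \<open>bracket \<xi> ^ (2 * p)\<close> absorbs the power of the norm, and
  \<open>bracket \<xi> ^ (2 * n)\<close> is left for integrability.\<close>

lemma Fr_power_integrable:
  fixes f :: "real^'n \<Rightarrow> real"
  assumes "test_function f"
  shows "integrable lborel (\<lambda>\<xi>. of_real (norm \<xi> ^ p) * Fr f \<xi>)"
proof -
  let ?n = "CARD('n)"
  obtain C where C: "0 \<le> C" "\<And>\<xi>. bracket \<xi> ^ (2 * (p + ?n)) * norm (Fr f \<xi>) \<le> C"
    using Fr_decay[OF assms] by blast
  have i: "integrable lborel (\<lambda>x::real^'n. bracket x powr (- (2 * real ?n)))"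
    by (rule bracket_power_integrable) simp
  have [measurable]: "f \<in> borel_measurable borel" using assms by (rule test_function_meas)
  show ?thesis
  proof (rule Bochner_Integration.integrable_bound[OF integrable_mult_right[OF i, of C]])
    show "AE x in lborel. norm (of_real (norm x ^ p) * Fr f x) \<le> norm (C * bracket x powr (- (2 * real ?n)))"
    proof (rule AE_I2)
      fix x :: "real^'n"
      note b = bracket_ge1[of x] bracket_ge_norm[of x]
      have "norm x ^ p \<le> bracket x ^ p" using b by (intro power_mono) auto
      also have "\<dots> \<le> bracket x ^ (2 * p)" using b by (intro power_increasing) auto
      finally have "norm x ^ p * norm (Fr f x) \<le> bracket x ^ (2 * p) * norm (Fr f x)" by (intro mult_right_mono) auto
      moreover have "bracket x ^ (2 * p) * norm (Fr f x) * bracket x ^ (2 * ?n) \<le> C"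
        using C(2)[of x] by (simp add: power_add distrib_left mult_ac)
      then have "bracket x ^ (2 * p) * norm (Fr f x) \<le> C / bracket x ^ (2 * ?n)"
        using b by (simp add: pos_le_divide_eq)
      moreover have "bracket x powr (- (2 * real ?n)) = 1 / bracket x ^ (2 * ?n)"
        using b by (simp add: powr_minus_divide powr_realpow[symmetric])
      ultimately have "norm x ^ p * norm (Fr f x) \<le> C * bracket x powr (- (2 * real ?n))" by simp
      also have "norm x ^ p * norm (Fr f x) = norm (of_real (norm x ^ p) * Fr f x)"
        unfolding norm_mult norm_of_real by simp
      finally show "norm (of_real (norm x ^ p) * Fr f x) \<le> norm (C * bracket x powr (- (2 * real ?n)))"
        using abs_ge_self order_trans unfolding real_norm_def by blast
    qed
  qed measurable
qed

lemma gauss_Fr: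
  fixes f :: "real^'n \<Rightarrow> real"
  assumes f: "integrable lborel f" and t: "0 < t"
  shows "(LINT \<xi>|lborel. Fr f \<xi> * cis (y \<bullet> \<xi>) * of_real (exp (- (norm \<xi>)\<^sup>2 / (4 * t)))) =
    of_real ((4 * pi * t) powr (real CARD('n) / 2)) * (LINT x|lborel. of_real (exp (- t * (norm (x - y))\<^sup>2)) * of_real (f x))"
proof -
  let ?g = "\<lambda>\<xi>::real^'n. of_real (exp (- (1 / (4 * t)) * (norm \<xi>)\<^sup>2)) :: complex"
  have "(LINT \<xi>|lborel. Fr f \<xi> * cis (y \<bullet> \<xi>) * of_real (exp (- (norm \<xi>)\<^sup>2 / (4 * t)))) =
     (LINT \<xi>|lborel. ?g \<xi> * (LINT x|lborel. of_real (f x) * cis ((y - x) \<bullet> \<xi>)))"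
  proof (intro Bochner_Integration.integral_cong refl)
    fix \<xi> :: "real^'n"
    have "(LINT x|lborel. of_real (f x) * cis ((y - x) \<bullet> \<xi>)) = (LINT x|lborel. (of_real (f x) * cis (- (x \<bullet> \<xi>))) * cis (y \<bullet> \<xi>))"
      by (intro Bochner_Integration.integral_cong refl) (simp add: inner_diff_left cis_mult mult.assoc)
    also have "\<dots> = Fr f \<xi> * cis (y \<bullet> \<xi>)" unfolding fourier_def by simp
    finally show "Fr f \<xi> * cis (y \<bullet> \<xi>) * of_real (exp (- (norm \<xi>)\<^sup>2 / (4 * t))) = ?g \<xi> * (LINT x|lborel. of_real (f x) * cis ((y - x) \<bullet> \<xi>))"
      by (simp add: mult_ac)
  qed
  also have "\<dots> = (LINT x|lborel. of_real (f x) * (LINT \<xi>|lborel. ?g \<xi> * cis ((y - x) \<bullet> \<xi>)))"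
    using f t by (intro Fubini_cis integrable_of_real integrable_gauss) auto
  also have "\<dots> = (LINT x|lborel. of_real ((4 * pi * t) powr (real CARD('n) / 2)) * (of_real (exp (- t * (norm (x - y))\<^sup>2)) * of_real (f x)))"
  proof (intro Bochner_Integration.integral_cong refl)
    fix x :: "real^'n"
    have "(LINT \<xi>|lborel. ?g \<xi> * cis ((y - x) \<bullet> \<xi>)) = (LINT \<xi>|lborel. ?g \<xi> * cis (\<xi> \<bullet> (y - x)))"
      by (simp add: inner_commute)
    also have "\<dots> = of_real ((pi / (1 / (4 * t))) powr (real DIM(real^'n) / 2) * exp (- (norm (y - x))\<^sup>2 / (4 * (1 / (4 * t)))))"
      by (rule gauss_fourier) (use t in simp)
    also have "\<dots> = of_real ((4 * pi * t) powr (real CARD('n) / 2) * exp (- t * (norm (x - y))\<^sup>2))"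
      using t by (simp add: norm_minus_commute mult_ac)
    finally show "of_real (f x) * (LINT \<xi>|lborel. ?g \<xi> * cis ((y - x) \<bullet> \<xi>)) =
      of_real ((4 * pi * t) powr (real CARD('n) / 2)) * (of_real (exp (- t * (norm (x - y))\<^sup>2)) * of_real (f x))"
      by (simp add: mult_ac)
  qed
  finally show ?thesis by simp
qed

text \<open>By \<open>gauss_inv_fourier\<close> and \<open>gauss_Fr\<close> the functions
  \<open>inv_fourier (Fr f)\<close> and \<open>f\<close> have equal Gaussian means around
  \<open>y\<close> at every scale, as the two constants multiply to 1; \<open>gauss_zero\<close>
  then identifies their values at \<open>y\<close>.\<close>

theorem fourier_inversion:
  fixes f :: "real^'n \<Rightarrow> real"
  assumes "test_function f"
  shows "inv_fourier (Fr f) y = of_real (f y)"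
proof -
  let ?n = "CARD('n)"
  have Fi: "integrable lborel (Fr f)" using Fr_power_integrable[OF assms, of 0] by simp
  have fi: "integrable lborel f" using assms by (rule test_function_integrable)
  have [measurable]: "f \<in> borel_measurable borel" using assms by (rule test_function_meas)
  obtain B where B: "0 \<le> B" "\<And>x. \<bar>f x\<bar> \<le> B" by (rule test_function_bounded[OF assms]) (rule that)
  define d where "d x = inv_fourier (Fr f) x - of_real (f x)" for x
  define B' where "B' = (LINT \<xi>|lborel. norm (Fr f \<xi>)) / (2 * pi) ^ ?n"
  have B': "norm (inv_fourier (Fr f) x) \<le> B'" for x unfolding B'_def by (rule inv_fourier_bounded)
  have "d y = 0"
  proof (rule gauss_zero[where d = d and y = y and B = "B' + B"])
    show "d \<in> borel_measurable borel" unfolding d_def by measurable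
    show "norm (d x) \<le> B' + B" for x
      unfolding d_def using B'[of x] B(2)[of x] norm_triangle_ineq4[of "inv_fourier (Fr f) x" "of_real (f x)"] by simp
    have "isCont f y" using test_function_continuous[OF assms] by (simp add: continuous_on_eq_continuous_at)
    then show "isCont d y" unfolding d_def by (intro continuous_intros inv_fourier_continuous Fi)
    fix t :: real assume t: "0 < t"
    let ?g = "\<lambda>x. of_real (exp (- t * (norm (x - y))\<^sup>2)) :: complex"
    have gi: "integrable lborel ?g" using t by (intro integrable_of_real integrable_gauss_shift)
    have i1: "integrable lborel (\<lambda>x. ?g x * inv_fourier (Fr f) x)"
    proof (rule Bochner_Integration.integrable_bound[OF integrable_mult_left[OF gi, of "of_real B'"]])
      show "AE x in lborel. norm (?g x * inv_fourier (Fr f) x) \<le> norm (?g x * of_real B')"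
        using B' by (intro AE_I2) (auto simp: norm_mult intro!: mult_left_mono order_trans[OF _ abs_ge_self])
    qed measurable
    have i2: "integrable lborel (\<lambda>x. ?g x * of_real (f x))"
    proof (rule Bochner_Integration.integrable_bound[OF integrable_mult_left[OF gi, of "of_real B"]])
      show "AE x in lborel. norm (?g x * of_real (f x)) \<le> norm (?g x * of_real B)"
        using B by (intro AE_I2) (auto simp: norm_mult intro!: mult_left_mono)
    qed measurable
    have "(pi / t) powr (real ?n / 2) / (2 * pi) ^ ?n * (4 * pi * t) powr (real ?n / 2) = 1"
    proof -
      have "(pi / t) powr (real ?n / 2) * (4 * pi * t) powr (real ?n / 2) = ((pi / t) * (4 * pi * t)) powr (real ?n / 2)"
        using t by (intro powr_mult[symmetric])
      also have "(pi / t) * (4 * pi * t) = (2 * pi) powr 2" using t by (simp add: power2_eq_square)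
      also have "((2 * pi) powr 2) powr (real ?n / 2) = (2 * pi) ^ ?n" unfolding powr_powr by (simp add: powr_realpow del: power_mult_distrib)
      finally show ?thesis by (simp add: mult.commute)
    qed
    then have "(LINT x|lborel. ?g x * inv_fourier (Fr f) x) = (LINT x|lborel. ?g x * of_real (f x))"
      unfolding gauss_inv_fourier[OF t Fi] gauss_Fr[OF fi t] mult.assoc[symmetric] of_real_mult[symmetric] by (simp only: of_real_1 mult_1)
    then show "(LINT x|lborel. ?g x * d x) = 0"
      unfolding d_def right_diff_distrib using i1 i2 by simp
  qed
  then show ?thesis by (simp add: d_def)
qed

definition hnl :: "(real^'n \<Rightarrow> real) \<Rightarrow> real^'n \<Rightarrow> complex" where
  "hnl f = inv_fourier (\<lambda>\<xi>. of_real (norm \<xi> ^ CARD('n)) * Fr f \<xi>)"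

text \<open>For even \<open>n\<close> the iterated Laplacian is a test function with transform
  \<open>norm \<xi> ^ n * Fr f \<xi>\<close>, so inversion recovers it; for odd \<open>n\<close> the
  definitions agree literally.\<close>

theorem half_n_laplacian_eq:
  fixes f :: "real^'n \<Rightarrow> real"
  assumes "test_function f"
  shows "half_n_laplacian f x = Re (hnl f x)"
proof (cases "even CARD('n)")
  case True
  define g where "g = ((\<lambda>f x. - laplacian f x) ^^ (CARD('n) div 2)) f"
  have e: "2 * (CARD('n) div 2) = CARD('n)" using True by (rule dvd_mult_div_cancel)
  note it = Fr_iterate_laplacian[OF assms, of "CARD('n) div 2", folded g_def, unfolded e]
  have "test_function g" by (rule conjunct1[OF it])
  have "Fr g = (\<lambda>\<xi>. of_real (norm \<xi> ^ CARD('n)) * Fr f \<xi>)" by (intro ext conjunct2[OF it])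
  then have "hnl f = inv_fourier (Fr g)" unfolding hnl_def by (simp only:)
  then have "hnl f x = of_real (g x)" using fourier_inversion[OF \<open>test_function g\<close>] by (simp only:)
  moreover have "half_n_laplacian f x = g x"
    unfolding half_n_laplacian_def g_def if_P[OF True] by (rule refl)
  ultimately show ?thesis by (simp only: Re_complex_of_real)
next
  case False
  show ?thesis unfolding half_n_laplacian_def hnl_def if_not_P[OF False] by (rule refl)
qed

section \<open>Superpositions of Gaussians\<close>

text \<open>With \<open>a\<close> a quarter of a squared norm, this produces negative powers of the
  norm from Gaussians: \<open>p = n / 2\<close> serves the logarithmic potential,
  \<open>p = (n + 1) / 2\<close> the decay of the half-Laplacian.\<close>

lemma gamma_integral_scaled:
  fixes p a :: real
  assumes p: "0 < p" and a: "0 < a"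
  shows "integrable lborel (\<lambda>t. indicator {0<..} t * (t powr (p - 1) * exp (- a * t)))"
    and "(LINT t|lborel. indicator {0<..} t * (t powr (p - 1) * exp (- a * t))) = Gamma p * a powr (- p)"
proof -
  let ?f = "\<lambda>t. indicator {0<..} t * (t powr (p - 1) * exp (- a * t)) :: real"
  have "ennreal (Gamma p) = (\<integral>\<^sup>+t. ennreal (indicator {0..} t * t powr (p - 1) / exp t) \<partial>lborel)"
    using Gamma_conv_nn_integral_real[OF p] by simp
  also have "\<dots> = \<bar>a\<bar> * (\<integral>\<^sup>+t. ennreal (indicator {0..} (0 + a * t) * (0 + a * t) powr (p - 1) / exp (0 + a * t)) \<partial>lborel)"
    using a by (intro nn_integral_real_affine) auto
  also have "(\<integral>\<^sup>+t. ennreal (indicator {0..} (0 + a * t) * (0 + a * t) powr (p - 1) / exp (0 + a * t)) \<partial>lborel)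
     = (\<integral>\<^sup>+t. ennreal (a powr (p - 1)) * ennreal (?f t) \<partial>lborel)"
  proof (intro nn_integral_cong)
    fix t :: real
    have "indicator {0..} (0 + a * t) * (0 + a * t) powr (p - 1) / exp (0 + a * t) = a powr (p - 1) * ?f t"
      using a by (cases "t > 0"; cases "t = 0") (auto simp: indicator_def powr_mult exp_minus zero_le_mult_iff field_simps)
    then show "ennreal (indicator {0..} (0 + a * t) * (0 + a * t) powr (p - 1) / exp (0 + a * t)) = ennreal (a powr (p - 1)) * ennreal (?f t)"
      by (simp add: ennreal_mult')
  qed
  also have "\<dots> = ennreal (a powr (p - 1)) * (\<integral>\<^sup>+t. ennreal (?f t) \<partial>lborel)"
    by (intro nn_integral_cmult) measurable
  also have "ennreal \<bar>a\<bar> * (ennreal (a powr (p - 1)) * (\<integral>\<^sup>+t. ennreal (?f t) \<partial>lborel)) = ennreal (a powr p) * (\<integral>\<^sup>+t. ennreal (?f t) \<partial>lborel)"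
    using a by (simp add: mult.assoc[symmetric] ennreal_mult'[symmetric] powr_mult_base)
  finally have "ennreal (a powr (- p)) * ennreal (Gamma p) = ennreal (a powr (- p)) * (ennreal (a powr p) * (\<integral>\<^sup>+t. ennreal (?f t) \<partial>lborel))"
    by simp
  also have "\<dots> = (\<integral>\<^sup>+t. ennreal (?f t) \<partial>lborel)"
    using a by (simp add: mult.assoc[symmetric] ennreal_mult'[symmetric] powr_add[symmetric])
  finally have *: "(\<integral>\<^sup>+t. ennreal (?f t) \<partial>lborel) = ennreal (Gamma p * a powr (- p))"
    using Gamma_real_pos[OF p] by (simp add: ennreal_mult'[symmetric] mult.commute)
  show i: "integrable lborel ?f"
    using * by (intro integrableI_nonneg) auto
  have "0 \<le> Gamma p * a powr (- p)" using Gamma_real_pos[OF p] by simp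
  moreover have "ennreal (LINT t|lborel. ?f t) = ennreal (Gamma p * a powr (- p))"
    using * i by (subst nn_integral_eq_integral[symmetric]) auto
  moreover have "0 \<le> (LINT t|lborel. ?f t)" by (intro Bochner_Integration.integral_nonneg) auto
  ultimately show "(LINT t|lborel. ?f t) = Gamma p * a powr (- p)" by simp
qed

lemma nn_integral_exp_inverse:
  fixes c :: real
  assumes c: "0 < c"
  shows "(\<integral>\<^sup>+s. ennreal (indicator {0<..} s * (exp (- c / s) / s\<^sup>2)) \<partial>lborel) = ennreal (1 / c)"
proof -
  let ?f = "\<lambda>s. exp (- c / s) / s\<^sup>2" and ?F = "\<lambda>s. exp (- c / s) / c"
  have D: "DERIV ?F x :> ?f x" if "0 < x" for x
    using that c by (auto intro!: derivative_eq_intros simp: power2_eq_square field_simps)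
  have f: "isCont ?f x" if "0 < x" for x using that by (intro continuous_intros) auto
  have A: "((?F \<circ> real_of_ereal) \<longlongrightarrow> 0) (at_right 0)"
  proof -
    have "(?F \<longlongrightarrow> 0) (at_right 0)" using c by real_asymp
    then show ?thesis unfolding zero_ereal_def ereal_tendsto_simps .
  qed
  have B: "((?F \<circ> real_of_ereal) \<longlongrightarrow> 1 / c) (at_left \<infinity>)"
  proof -
    have "(?F \<longlongrightarrow> inverse c) at_top" using c by real_asymp
    then show ?thesis unfolding ereal_tendsto_simps inverse_eq_divide .
  qed
  have I: "set_integrable lborel (einterval 0 \<infinity>) ?f" "(LBINT x=0..\<infinity>. ?f x) = 1 / c - 0"
    by (rule interval_integral_FTC_nonneg[where F = ?F]; (fact A B | use D f in simp))+
  have e: "einterval 0 \<infinity> = {0::real<..}" by (auto simp: einterval_def)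
  have i: "integrable lborel (\<lambda>s. indicator {0<..} s * ?f s)"
    using I(1) unfolding set_integrable_def e by simp
  have "(LINT s|lborel. indicator {0<..} s * ?f s) = 1 / c"
    using I(2) unfolding interval_lebesgue_integral_def set_lebesgue_integral_def e by simp
  then show ?thesis using i by (subst nn_integral_eq_integral) auto
qed

text \<open>The classical integrand \<open>(exp (- t) - exp (- r * t)) / t\<close> in the variable
  \<open>s = 1 / t\<close>. In this variable the frequency-side integral of
  \<open>log_potential_hnl\<close> has directly the form of
  \<open>gamma_integral_scaled\<close>.\<close>

definition frullani_integrand :: "real \<Rightarrow> real \<Rightarrow> real" where
  "frullani_integrand r s = indicator {0<..} s * ((exp (- 1 / s) - exp (- r / s)) / s)"

text \<open>The difference quotient is the integral of \<open>exp (- c / s) / s\<^sup>2\<close> over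
  \<open>c\<close> in \<open>{a..b}\<close>; after Tonelli the integral over \<open>s\<close> leaves
  \<open>1 / c\<close>.\<close>

lemma frullani_integrand_nn:
  assumes "0 < a" "a \<le> b"
  shows "(\<integral>\<^sup>+s. ennreal (indicator {0<..} s * ((exp (- a / s) - exp (- b / s)) / s)) \<partial>lborel) = ennreal (ln b - ln a)"
proof -
  have "(\<integral>\<^sup>+s. ennreal (indicator {0<..} s * ((exp (- a / s) - exp (- b / s)) / s)) \<partial>lborel)
     = (\<integral>\<^sup>+s. \<integral>\<^sup>+c. ennreal (indicator {0<..} s * (exp (- c / s) / s\<^sup>2)) * indicator {a..b} c \<partial>lborel \<partial>lborel)"
  proof (intro nn_integral_cong)
    fix s :: real
    show "ennreal (indicator {0<..} s * ((exp (- a / s) - exp (- b / s)) / s))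
       = (\<integral>\<^sup>+c. ennreal (indicator {0<..} s * (exp (- c / s) / s\<^sup>2)) * indicator {a..b} c \<partial>lborel)"
    proof (cases "0 < s")
      case True
      have "(\<integral>\<^sup>+c. ennreal (exp (- c / s) / s\<^sup>2) * indicator {a..b} c \<partial>lborel) = ennreal ((- exp (- b / s) / s) - (- exp (- a / s) / s))"
        using True assms by (intro nn_integral_FTC_Icc)
          (auto intro!: derivative_eq_intros simp: power2_eq_square field_simps)
      then show ?thesis using True by (simp add: diff_divide_distrib)
    qed simp
  qed
  also have "\<dots> = (\<integral>\<^sup>+c. \<integral>\<^sup>+s. ennreal (indicator {0<..} s * (exp (- c / s) / s\<^sup>2)) * indicator {a..b} c \<partial>lborel \<partial>lborel)"
    by (rule lborel_pair.Fubini') measurable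
  also have "\<dots> = (\<integral>\<^sup>+c. ennreal (1 / c) * indicator {a..b} c \<partial>lborel)"
  proof (intro nn_integral_cong)
    fix c :: real
    have "(\<integral>\<^sup>+s. ennreal (indicator {0<..} s * (exp (- c / s) / s\<^sup>2)) * indicator {a..b} c \<partial>lborel)
       = (\<integral>\<^sup>+s. ennreal (indicator {0<..} s * (exp (- c / s) / s\<^sup>2)) \<partial>lborel) * indicator {a..b} c"
      by (intro nn_integral_multc) measurable
    also have "\<dots> = ennreal (1 / c) * indicator {a..b} c"
    proof (cases "c \<in> {a..b}")
      case True
      then have "0 < c" using assms by simp
      from nn_integral_exp_inverse[OF this] show ?thesis by simp
    qed simp
    finally show "(\<integral>\<^sup>+s. ennreal (indicator {0<..} s * (exp (- c / s) / s\<^sup>2)) * indicator {a..b} c \<partial>lborel)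
       = ennreal (1 / c) * indicator {a..b} c" .
  qed
  also have "\<dots> = ennreal (ln b - ln a)"
    using assms by (intro nn_integral_FTC_Icc) (auto intro!: derivative_eq_intros)
  finally show ?thesis .
qed

lemma frullani_integrand_meas [measurable]:
  assumes [measurable]: "f \<in> borel_measurable M" "g \<in> borel_measurable M"
  shows "(\<lambda>x. frullani_integrand (f x) (g x)) \<in> borel_measurable M"
  unfolding frullani_integrand_def by measurable

text \<open>The integrand keeps one sign in \<open>s\<close>, nonnegative for \<open>r >= 1\<close>
  and nonpositive for \<open>r <= 1\<close>. Its absolute integral is therefore explicit too, and
  that is the majorant for Fubini in \<open>log_potential_hnl\<close>.\<close>

lemma frullani:
  assumes r: "0 < r"
  shows "integrable lborel (frullani_integrand r)" "(LINT s|lborel. frullani_integrand r s) = ln r" "(LINT s|lborel. \<bar>frullani_integrand r s\<bar>) = \<bar>ln r\<bar>"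
proof -
  have 1: "integrable lborel (\<lambda>s. indicator {0<..} s * ((exp (- a / s) - exp (- b / s)) / s))
      \<and> (LINT s|lborel. indicator {0<..} s * ((exp (- a / s) - exp (- b / s)) / s)) = ln b - ln a
      \<and> (\<forall>s. 0 \<le> indicator {0<..} s * ((exp (- a / s) - exp (- b / s)) / s))"
    if ab: "0 < a" "a \<le> b" for a b :: real
  proof -
    let ?f = "\<lambda>s. indicator {0<..} s * ((exp (- a / s) - exp (- b / s)) / s) :: real"
    have nn: "0 \<le> ?f s" for s using ab by (cases "0 < s") (auto simp: divide_right_mono)
    have i: "integrable lborel ?f"
      using frullani_integrand_nn[OF ab] nn by (intro integrableI_nonneg) auto
    have "ennreal (LINT s|lborel. ?f s) = ennreal (ln b - ln a)"
      using frullani_integrand_nn[OF ab] i nn by (subst nn_integral_eq_integral[symmetric]) auto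
    moreover have "0 \<le> (LINT s|lborel. ?f s)" using nn by (intro Bochner_Integration.integral_nonneg)
    moreover have "0 \<le> ln b - ln a" using ab by simp
    ultimately show ?thesis using i nn by simp
  qed
  have "integrable lborel (frullani_integrand r) \<and> (LINT s|lborel. frullani_integrand r s) = ln r \<and> (LINT s|lborel. \<bar>frullani_integrand r s\<bar>) = \<bar>ln r\<bar>"
  proof (cases "1 \<le> r")
    case True
    note f = 1[of 1 r, OF _ True]
    have e: "frullani_integrand r = (\<lambda>s. indicator {0<..} s * ((exp (- 1 / s) - exp (- r / s)) / s))" by (simp add: frullani_integrand_def fun_eq_iff)
    have "integrable lborel (frullani_integrand r) \<and> (LINT s|lborel. frullani_integrand r s) = ln r - ln 1 \<and> (\<forall>s. 0 \<le> frullani_integrand r s)"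
      unfolding e using f by simp
    then show ?thesis using True by (simp add: abs_of_nonneg)
  next
    case False
    then have r1: "r \<le> 1" by simp
    let ?f = "\<lambda>s. indicator {0<..} s * ((exp (- r / s) - exp (- 1 / s)) / s) :: real"
    have e: "frullani_integrand r = (\<lambda>s. - ?f s)" by (simp add: frullani_integrand_def fun_eq_iff diff_divide_distrib algebra_simps)
    have "integrable lborel (frullani_integrand r)" unfolding e using 1[OF r r1] by simp
    moreover have "(LINT s|lborel. frullani_integrand r s) = ln r" unfolding e using 1[OF r r1] by simp
    moreover have "\<bar>frullani_integrand r s\<bar> = ?f s" for s unfolding e using 1[OF r r1] by (simp only: abs_minus_cancel abs_of_nonneg)
    moreover have "\<bar>ln r\<bar> = - ln r" using r r1 by simp
    ultimately show ?thesis using 1[OF r r1] by simp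
  qed
  then show "integrable lborel (frullani_integrand r)" "(LINT s|lborel. frullani_integrand r s) = ln r" "(LINT s|lborel. \<bar>frullani_integrand r s\<bar>) = \<bar>ln r\<bar>"
    by blast+
qed

definition sqrt_integrand :: "real \<Rightarrow> real \<Rightarrow> real" where
  "sqrt_integrand r \<tau> = indicator {0<..} \<tau> * ((1 - exp (- r\<^sup>2 / (4 * \<tau>))) * \<tau> powr (- 1 / 2))"

lemma sqrt_integrand_meas [measurable]:
  assumes [measurable]: "f \<in> borel_measurable M" "g \<in> borel_measurable M"
  shows "(\<lambda>x. sqrt_integrand (f x) (g x)) \<in> borel_measurable M"
  unfolding sqrt_integrand_def by measurable

lemma sqrt_integrand_nonneg: "0 \<le> sqrt_integrand r \<tau>"
  by (cases "0 < \<tau>") (auto simp: sqrt_integrand_def divide_nonpos_pos)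

text \<open>The substitution \<open>\<tau> = r\<^sup>2 * \<sigma>\<close> shows homogeneity of
  degree 1 in \<open>r\<close>, so \<open>c\<close> is the integral at \<open>r = 1\<close>. There
  the integrand is dominated by order \<open>-1/2\<close> at the origin and order
  \<open>-3/2\<close> at infinity.\<close>

lemma sqrt_integrand_integral:
  obtains c where "0 < c" "\<And>r. 0 \<le> r \<Longrightarrow> integrable lborel (sqrt_integrand r)" "\<And>r. 0 \<le> r \<Longrightarrow> (LINT \<tau>|lborel. sqrt_integrand r \<tau>) = c * r"
proof -
  have i1: "integrable lborel (sqrt_integrand 1)"
  proof (rule integrableI_nonneg)
    have "(\<integral>\<^sup>+\<tau>. ennreal (sqrt_integrand 1 \<tau>) \<partial>lborel) \<le> (\<integral>\<^sup>+\<tau>. ennreal (hump (1/2) (3/2) (\<tau>::real)) \<partial>lborel)"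
    proof (intro nn_integral_mono ennreal_leI)
      fix \<tau> :: real
      show "sqrt_integrand 1 \<tau> \<le> hump (1/2) (3/2) \<tau>"
      proof (cases "0 < \<tau>")
        case True
        have "1 + - 1 / (4 * \<tau>) \<le> exp (- 1 / (4 * \<tau>))" by (rule exp_ge_add_one_self)
        then have b: "1 - exp (- 1 / (4 * \<tau>)) \<le> 1 / (4 * \<tau>)" by simp
        show ?thesis
        proof (cases "\<tau> \<le> 1")
          case t1: True
          have "(1 - exp (- 1 / (4 * \<tau>))) * \<tau> powr (- 1 / 2) \<le> 1 * \<tau> powr (- 1 / 2)"
            by (intro mult_right_mono) auto
          then show ?thesis using True t1 by (simp add: sqrt_integrand_def hump_def)
        next
          case False
          have "(1 - exp (- 1 / (4 * \<tau>))) * \<tau> powr (- 1 / 2) \<le> \<tau> powr (- 1) * \<tau> powr (- 1 / 2)"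
          proof (intro mult_right_mono)
            have "1 / (4 * \<tau>) \<le> 1 / \<tau>" using True by (simp add: field_simps)
            then show "1 - exp (- 1 / (4 * \<tau>)) \<le> \<tau> powr (- 1)" using b True by (simp add: powr_minus_divide)
          qed auto
          also have "\<dots> = \<tau> powr (- (3 / 2))" by (subst powr_add[symmetric]) simp
          finally show ?thesis using True False by (simp add: sqrt_integrand_def hump_def)
        qed
      qed (simp add: sqrt_integrand_def hump_nonneg)
    qed
    also have "\<dots> < \<infinity>" by (rule nn_integral_hump) auto
    finally show "(\<integral>\<^sup>+\<tau>. ennreal (sqrt_integrand 1 \<tau>) \<partial>lborel) < \<infinity>" .
  qed (auto simp: sqrt_integrand_nonneg)
  define c where "c = (LINT \<tau>|lborel. sqrt_integrand 1 \<tau>)"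
  have "(LINT \<tau>|lborel. (1 - exp (- 1 / 4)) * indicator {0<..<1::real} \<tau>) \<le> c"
    unfolding c_def
  proof (intro integral_mono i1)
    fix \<tau> :: real
    show "(1 - exp (- 1 / 4)) * indicator {0<..<1} \<tau> \<le> sqrt_integrand 1 \<tau>"
    proof (cases "0 < \<tau> \<and> \<tau> < 1")
      case True
      have "(1 - exp (- 1 / 4)) * 1 \<le> (1 - exp (- 1 / (4 * \<tau>))) * \<tau> powr (- 1 / 2)"
      proof (intro mult_mono)
        show "1 - exp (- 1 / 4) \<le> 1 - exp (- 1 / (4 * \<tau>))" using True by (simp add: field_simps)
        have "1 powr (- 1 / 2) \<le> \<tau> powr (- 1 / 2)" using True by (intro powr_mono2') auto
        then show "1 \<le> \<tau> powr (- 1 / 2)" by simp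
      qed (use True in \<open>auto simp: divide_nonpos_pos\<close>)
      then show ?thesis using True by (simp add: sqrt_integrand_def)
    qed (use sqrt_integrand_nonneg in \<open>auto simp: indicator_def\<close>)
  qed (auto simp: integrable_mult_right)
  moreover have "(LINT \<tau>|lborel. (1 - exp (- 1 / 4 :: real)) * indicator {0<..<1::real} \<tau>) = 1 - exp (- 1 / 4)" by simp
  moreover have "0 < 1 - exp (- 1 / 4 :: real)" by simp
  ultimately have c: "0 < c" by linarith
  have scale: "sqrt_integrand r (0 + r\<^sup>2 * \<tau>) = sqrt_integrand 1 \<tau> / r" if "0 < r" for r \<tau>
  proof (cases "0 < \<tau>")
    case True
    have "(r\<^sup>2 * \<tau>) powr (- 1 / 2) = (r\<^sup>2) powr (- 1 / 2) * \<tau> powr (- 1 / 2)" by (rule powr_mult)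
    also have "(r\<^sup>2) powr (- 1 / 2) = r powr (2 * (- 1 / 2))"
      using that by (subst powr_powr[symmetric]) simp
    also have "\<dots> = 1 / r" using that by (simp add: powr_minus_divide)
    finally show ?thesis using True that by (simp add: sqrt_integrand_def zero_less_mult_iff)
  qed (use that in \<open>auto simp: sqrt_integrand_def zero_less_mult_iff\<close>)
  have "integrable lborel (sqrt_integrand r) \<and> (LINT \<tau>|lborel. sqrt_integrand r \<tau>) = c * r" if "0 \<le> r" for r
  proof (cases "r = 0")
    case True
    then have "sqrt_integrand r = (\<lambda>_. 0)" by (simp add: sqrt_integrand_def fun_eq_iff)
    then show ?thesis using True by simp
  next
    case False
    then have r: "0 < r" using that by simp
    have "integrable lborel (\<lambda>\<tau>. sqrt_integrand r (0 + r\<^sup>2 * \<tau>))" using i1 scale[OF r] by simp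
    then have "integrable lborel (sqrt_integrand r)" using r by (subst (asm) lborel_integrable_real_affine_iff) auto
    moreover have "(LINT \<tau>|lborel. sqrt_integrand r \<tau>) = \<bar>r\<^sup>2\<bar> *\<^sub>R (LINT \<tau>|lborel. sqrt_integrand r (0 + r\<^sup>2 * \<tau>))"
      using r by (intro lborel_integral_real_affine) auto
    then have "(LINT \<tau>|lborel. sqrt_integrand r \<tau>) = c * r" using r scale[OF r] by (simp add: c_def power2_eq_square)
    ultimately show ?thesis by simp
  qed
  with c show ?thesis by (intro that[of c]) simp_all
qed

text \<open>Absolute convergence is checked by integrating over the parameter \<open>s\<close>
  first: in every application the integral of the absolute value of \<open>K s x\<close> over
  \<open>s\<close> is known in closed form.\<close>

lemma kernel_Fubini:
  fixes K :: "real \<Rightarrow> 'a::euclidean_space \<Rightarrow> real" and g :: "'a \<Rightarrow> complex"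
  assumes K: "(\<lambda>p. K (snd p) (fst p)) \<in> borel_measurable (borel \<Otimes>\<^sub>M borel)" and g: "g \<in> borel_measurable borel"
    and i: "AE x in lborel. integrable lborel (\<lambda>s. K s x)"
    and J: "integrable lborel (\<lambda>x. (LINT s|lborel. \<bar>K s x\<bar>) * norm (g x))"
  shows "(LINT x|lborel. of_real (LINT s|lborel. K s x) * g x) = (LINT s|lborel. LINT x|lborel. of_real (K s x) * g x)"
proof -
  have [measurable]: "(\<lambda>p. K (snd p) (fst p)) \<in> borel_measurable (lborel \<Otimes>\<^sub>M lborel)"
    using K by (simp cong: measurable_cong_sets)
  have [measurable]: "g \<in> borel_measurable borel" by (rule g)
  have "integrable (lborel \<Otimes>\<^sub>M lborel) (\<lambda>p. of_real (K (snd p) (fst p)) * g (fst p))"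
  proof (rule lborel_pair.Fubini_integrable)
    show "integrable lborel (\<lambda>x. LINT s|lborel. norm (of_real (K (snd (x, s)) (fst (x, s))) * g (fst (x, s))))"
      using J by (simp add: norm_mult)
    show "AE x in lborel. integrable lborel (\<lambda>s. of_real (K (snd (x, s)) (fst (x, s))) * g (fst (x, s)))"
      using i by eventually_elim simp
  qed measurable
  then have "(LINT s|lborel. LINT x|lborel. of_real (K s x) * g x) = (LINT x|lborel. LINT s|lborel. of_real (K s x) * g x)"
    by (intro lborel_pair.Fubini_integral) (simp add: case_prod_beta')
  also have "\<dots> = (LINT x|lborel. of_real (LINT s|lborel. K s x) * g x)" by simp
  finally show ?thesis by simp
qed

section \<open>The fundamental solution\<close>

lemma hnl_integrand_integrable:
  fixes f :: "real^'n \<Rightarrow> real"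
  assumes "test_function f"
  shows "integrable lborel (\<lambda>\<xi>. of_real (norm \<xi> ^ CARD('n)) * Fr f \<xi>)"
  using assms by (rule Fr_power_integrable)

lemma hnl_meas: assumes "test_function f" shows "hnl f \<in> borel_measurable borel"
proof -
  have [measurable]: "f \<in> borel_measurable borel" using assms by (rule test_function_meas)
  show ?thesis unfolding hnl_def by measurable
qed

lemma hnl_bounded:
  fixes f :: "real^'n \<Rightarrow> real"
  obtains B where "0 \<le> B" "\<And>x. norm (hnl f x) \<le> B"
proof (rule that)
  show "norm (hnl f x) \<le> (LINT \<xi>|lborel. norm (of_real (norm \<xi> ^ CARD('n)) * Fr f \<xi>)) / (2 * pi) ^ CARD('n)" for x
    unfolding hnl_def by (rule inv_fourier_bounded)
qed simp

text \<open>A non-integrable function has Bochner integral 0 and the majorant is nonnegative, so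
  that case is trivial. The integral over \<open>\<tau>\<close> in
  \<open>half_laplacian_decay\<close> can thus be bounded from its pointwise majorant alone.\<close>

lemma norm_integral_le:
  fixes f :: "'a \<Rightarrow> 'b::{banach, second_countable_topology}"
  assumes g: "integrable M g" and le: "\<And>x. norm (f x) \<le> g x"
  shows "norm (LINT x|M. f x) \<le> (LINT x|M. g x)"
proof (cases "integrable M f")
  case True
  have "norm (LINT x|M. f x) \<le> (LINT x|M. norm (f x))" by (rule integral_norm_bound)
  also have "\<dots> \<le> (LINT x|M. g x)" using True g le by (intro integral_mono) auto
  finally show ?thesis .
next
  case False
  have "0 \<le> g x" for x using le[of x] norm_ge_zero order_trans by blast
  then have "0 \<le> (LINT x|M. g x)" by (intro Bochner_Integration.integral_nonneg)
  then show ?thesis using False by (simp add: not_integrable_integral_eq)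
qed

lemma bounded_tail_decay:
  fixes h :: "'a::real_normed_vector \<Rightarrow> 'b::real_normed_vector"
  assumes B: "0 \<le> B" "\<And>x. norm (h x) \<le> B" and p: "0 \<le> p"
    and R: "1 \<le> R" "0 \<le> A" "\<And>x. R < norm x \<Longrightarrow> norm (h x) \<le> A * norm x powr (- p)"
  shows "\<exists>C\<ge>0. \<forall>x. norm (h x) \<le> C * bracket x powr (- p)"
proof (intro exI[of _ "B * (1 + R) powr p + A * 2 powr p"] conjI allI)
  show "0 \<le> B * (1 + R) powr p + A * 2 powr p" using B R by simp
  fix x :: 'a
  note b = bracket_pos[of x] bracket_le[of x]
  show "norm (h x) \<le> (B * (1 + R) powr p + A * 2 powr p) * bracket x powr (- p)"
  proof (cases "norm x \<le> R")
    case True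
    have "1 = bracket x powr p * bracket x powr (- p)" using b by (simp add: powr_add[symmetric])
    also have "\<dots> \<le> (1 + R) powr p * bracket x powr (- p)"
      using b True p by (intro mult_right_mono powr_mono2) auto
    finally have "B * 1 \<le> B * ((1 + R) powr p * bracket x powr (- p))" using B(1) by (rule mult_left_mono)
    moreover have "0 \<le> A * 2 powr p * bracket x powr (- p)" using R by simp
    ultimately show ?thesis using B(2)[of x] by (simp add: algebra_simps)
  next
    case False
    have "norm x powr (- p) \<le> (bracket x / 2) powr (- p)"
      using b False R p by (intro powr_mono2') auto
    also have "\<dots> = 2 powr p * bracket x powr (- p)"
      using b by (simp add: powr_divide powr_minus_divide)
    finally have "A * norm x powr (- p) \<le> A * (2 powr p * bracket x powr (- p))" using R by (intro mult_left_mono) auto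
    moreover have "0 \<le> B * (1 + R) powr p * bracket x powr (- p)" using B by simp
    ultimately show ?thesis using R(3)[of x] False by (simp add: algebra_simps)
  qed
qed

text \<open>The kernel of \<open>(-\<Delta>)\<^bsup>1/2\<^esup>\<close> decays like \<open>\<bar>x\<bar>\<^bsup>-n-1\<^esup>\<close>; away from the support of \<open>g\<close> this follows by
  writing \<open>\<bar>\<xi>\<bar>\<close> as a superposition of \<open>1 - exp (-\<bar>\<xi>\<bar>\<^sup>2/4\<tau>)\<close>.\<close>

lemma half_laplacian_decay:
  fixes g :: "real^'n \<Rightarrow> real"
  assumes g: "test_function g"
  obtains R A where "1 \<le> R" "0 \<le> A"
    "\<And>x. R < norm x \<Longrightarrow> norm (inv_fourier (\<lambda>\<xi>. of_real (norm \<xi>) * Fr g \<xi>) x) \<le> A * norm x powr (- (real CARD('n) + 1))"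
proof -
  let ?n = "real CARD('n)"
  let ?h = "\<lambda>\<xi>. of_real (norm \<xi>) * Fr g \<xi>"
  obtain R0 where R0: "0 < R0" "\<And>x. R0 < norm x \<Longrightarrow> g x = 0"
    by (rule test_function_bounded_support[OF g]) (rule that)
  obtain c where c: "0 < c" "\<And>r. 0 \<le> r \<Longrightarrow> integrable lborel (sqrt_integrand r)" "\<And>r. 0 \<le> r \<Longrightarrow> (LINT \<tau>|lborel. sqrt_integrand r \<tau>) = c * r"
    by (rule sqrt_integrand_integral) (rule that)
  have [measurable]: "g \<in> borel_measurable borel" using g by (rule test_function_meas)
  have gi: "integrable lborel g" using g by (rule test_function_integrable)
  have Fi: "integrable lborel (Fr g)" using Fr_power_integrable[OF g, of 0] by simp
  have hi: "integrable lborel ?h" using Fr_power_integrable[OF g, of 1] by simp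
  define N where "N = (LINT z|lborel. \<bar>g z\<bar>)"
  have N0: "0 \<le> N" by (simp add: N_def)
  define A0 where "A0 = (4 * pi) powr (?n / 2) * N * Gamma ((?n + 1) / 2) * 4 powr ((?n + 1) / 2)"
  have Gp: "0 < Gamma ((?n + 1) / 2)" by (rule Gamma_real_pos) (simp add: add_nonneg_pos)
  then have A0: "0 \<le> A0" unfolding A0_def using N0 by simp
  \<comment> \<open>Beyond \<open>2 * R0\<close> the value \<open>g x\<close> is 0 and every
    \<open>z\<close> with \<open>g z \<noteq> 0\<close> satisfies
    \<open>norm (z - x) >= norm x / 2\<close>.\<close>
  define R where "R = max 1 (2 * R0)"
  have main: "norm (LINT \<xi>|lborel. ?h \<xi> * cis (x \<bullet> \<xi>)) * c \<le> A0 * norm x powr (- (?n + 1))" if x: "R < norm x" for x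
  proof -
    have xp: "0 < norm x" "1 < norm x" "2 * R0 < norm x" using x by (auto simp: R_def)
    have gx: "g x = 0" using R0 xp by simp
    let ?K = "\<lambda>\<tau> \<xi>. sqrt_integrand (norm \<xi>) \<tau>"
    let ?G = "\<lambda>\<xi>. Fr g \<xi> * cis (x \<bullet> \<xi>)"
    have Gi: "integrable lborel ?G" by (intro integrable_mult_cis Fi) simp
    have absK: "(LINT \<tau>|lborel. \<bar>?K \<tau> \<xi>\<bar>) = c * norm \<xi>" for \<xi> :: "real^'n"
      using c(3)[of "norm \<xi>"] by (simp add: sqrt_integrand_nonneg)
    have "of_real c * (LINT \<xi>|lborel. ?h \<xi> * cis (x \<bullet> \<xi>)) = (LINT \<xi>|lborel. of_real (LINT \<tau>|lborel. ?K \<tau> \<xi>) * ?G \<xi>)"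
      using c(3) by (subst integral_mult_right_zero[symmetric]) (simp add: mult_ac)
    also have "\<dots> = (LINT \<tau>|lborel. LINT \<xi>|lborel. of_real (?K \<tau> \<xi>) * ?G \<xi>)"
    proof (rule kernel_Fubini)
      show "(\<lambda>p. ?K (snd p) (fst p)) \<in> borel_measurable (borel \<Otimes>\<^sub>M borel)" by measurable
      show "?G \<in> borel_measurable borel" using borel_measurable_integrable[OF Gi] by simp
      show "AE \<xi> in lborel. integrable lborel (\<lambda>\<tau>. ?K \<tau> \<xi>)" using c(2) by (intro AE_I2) simp
      have "integrable lborel (\<lambda>\<xi>. c * norm (?h \<xi>))" using hi by (intro integrable_mult_right integrable_norm)
      then show "integrable lborel (\<lambda>\<xi>. (LINT \<tau>|lborel. \<bar>?K \<tau> \<xi>\<bar>) * norm (?G \<xi>))"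
        unfolding absK by (simp add: norm_mult mult.assoc)
    qed
    finally have eq: "of_real c * (LINT \<xi>|lborel. ?h \<xi> * cis (x \<bullet> \<xi>)) = (LINT \<tau>|lborel. LINT \<xi>|lborel. of_real (?K \<tau> \<xi>) * ?G \<xi>)" .
    \<comment> \<open>The power of \<open>\<tau>\<close> is \<open>-1/2\<close> from the kernel plus
      \<open>n/2\<close> from \<open>gauss_Fr\<close>, that is \<open>(n + 1) / 2 - 1\<close>; the
      quarter in the exponent comes from \<open>norm (z - x) >= norm x / 2\<close>.\<close>
    let ?b = "\<lambda>\<tau>. (4 * pi) powr (?n / 2) * N * (indicator {0<..} \<tau> * (\<tau> powr ((?n + 1) / 2 - 1) * exp (- ((norm x)\<^sup>2 / 4) * \<tau>)))"
    have inner: "norm (LINT \<xi>|lborel. of_real (?K \<tau> \<xi>) * ?G \<xi>) \<le> ?b \<tau>" for \<tau>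
    proof (cases "0 < \<tau>")
      case True
      let ?E = "\<lambda>\<xi>::real^'n. of_real (exp (- (norm \<xi>)\<^sup>2 / (4 * \<tau>))) :: complex"
      have GEi: "integrable lborel (\<lambda>\<xi>. ?G \<xi> * ?E \<xi>)"
      proof (rule Bochner_Integration.integrable_bound[OF Gi])
        have [measurable]: "?G \<in> borel_measurable borel" using borel_measurable_integrable[OF Gi] by simp
        show "(\<lambda>\<xi>. ?G \<xi> * ?E \<xi>) \<in> borel_measurable lborel" by measurable
        show "AE \<xi> in lborel. norm (?G \<xi> * ?E \<xi>) \<le> norm (?G \<xi>)"
          using True by (intro AE_I2) (simp add: norm_mult mult_left_le divide_nonpos_pos)
      qed
      \<comment> \<open>Off the support of \<open>g\<close> the constant 1 in
        \<open>sqrt_integrand\<close> drops out by inversion; only the Gaussian term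
        remains.\<close>
      have G0: "(LINT \<xi>|lborel. ?G \<xi>) = 0"
      proof -
        have "(LINT \<xi>|lborel. ?G \<xi>) / of_real ((2 * pi) ^ CARD('n)) = 0"
          using fourier_inversion[OF g, of x] gx by (simp add: inv_fourier_def)
        then show ?thesis by simp
      qed
      have "(LINT \<xi>|lborel. of_real (?K \<tau> \<xi>) * ?G \<xi>) = (LINT \<xi>|lborel. of_real (\<tau> powr (- 1 / 2)) * (?G \<xi> - ?G \<xi> * ?E \<xi>))"
        using True by (intro Bochner_Integration.integral_cong refl) (simp add: sqrt_integrand_def algebra_simps)
      also have "\<dots> = of_real (\<tau> powr (- 1 / 2)) * ((LINT \<xi>|lborel. ?G \<xi>) - (LINT \<xi>|lborel. ?G \<xi> * ?E \<xi>))"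
        using Gi GEi by simp
      also have "\<dots> = - of_real (\<tau> powr (- 1 / 2)) * (of_real ((4 * pi * \<tau>) powr (?n / 2)) *
          (LINT z|lborel. of_real (exp (- \<tau> * (norm (z - x))\<^sup>2)) * of_real (g z)))"
        unfolding G0 gauss_Fr[OF gi True] by simp
      finally have e1: "(LINT \<xi>|lborel. of_real (?K \<tau> \<xi>) * ?G \<xi>) = - of_real (\<tau> powr (- 1 / 2)) * (of_real ((4 * pi * \<tau>) powr (?n / 2)) *
          (LINT z|lborel. of_real (exp (- \<tau> * (norm (z - x))\<^sup>2)) * of_real (g z)))" .
      let ?e = "exp (- ((norm x)\<^sup>2 / 4) * \<tau>)"
      have "norm (LINT z|lborel. of_real (exp (- \<tau> * (norm (z - x))\<^sup>2)) * of_real (g z) :: complex)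
        \<le> (LINT z|lborel. norm (of_real (exp (- \<tau> * (norm (z - x))\<^sup>2)) * of_real (g z) :: complex))"
        by (rule integral_norm_bound)
      also have "\<dots> \<le> (LINT z|lborel. ?e * \<bar>g z\<bar>)"
      proof (rule integral_mono)
        have le: "norm (of_real (exp (- \<tau> * (norm (z - x))\<^sup>2)) * of_real (g z) :: complex) \<le> ?e * \<bar>g z\<bar>" for z
        proof (cases "g z = 0")
          case False
          then have "norm z \<le> R0" using R0(2)[of z] by linarith
          then have "norm x / 2 \<le> norm (z - x)"
            using xp norm_triangle_ineq2[of x z] by (simp add: norm_minus_commute)
          then have "(norm x / 2)\<^sup>2 \<le> (norm (z - x))\<^sup>2" by (intro power_mono) auto
          then have "exp (- \<tau> * (norm (z - x))\<^sup>2) \<le> ?e" using True by (simp add: power_divide field_simps)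
          then show ?thesis by (simp add: norm_mult mult_right_mono)
        qed simp
        show i: "integrable lborel (\<lambda>z. ?e * \<bar>g z\<bar>)" using gi by simp
        show "integrable lborel (\<lambda>z. norm (of_real (exp (- \<tau> * (norm (z - x))\<^sup>2)) * of_real (g z) :: complex))"
          by (rule Bochner_Integration.integrable_bound[OF i]) (use le in auto)
        show "norm (of_real (exp (- \<tau> * (norm (z - x))\<^sup>2)) * of_real (g z) :: complex) \<le> ?e * \<bar>g z\<bar>" for z by (rule le)
      qed
      also have "\<dots> = ?e * N" by (simp add: N_def)
      finally have "norm (LINT \<xi>|lborel. of_real (?K \<tau> \<xi>) * ?G \<xi>) \<le> \<tau> powr (- 1 / 2) * ((4 * pi * \<tau>) powr (?n / 2) * (?e * N))"
        unfolding e1 norm_mult norm_minus_cancel norm_of_real by (simp add: mult_left_mono)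
      also have "\<tau> powr (- 1 / 2) * ((4 * pi * \<tau>) powr (?n / 2) * (?e * N)) = (4 * pi) powr (?n / 2) * N * ((\<tau> powr (- 1 / 2) * \<tau> powr (?n / 2)) * ?e)"
        by (subst powr_mult) (simp add: mult_ac)
      also have "\<tau> powr (- 1 / 2) * \<tau> powr (?n / 2) = \<tau> powr ((?n + 1) / 2 - 1)"
        by (subst powr_add[symmetric]) (simp add: field_simps)
      finally show ?thesis using True by simp
    qed (simp add: sqrt_integrand_def)
    have gs: "integrable lborel (\<lambda>t. indicator {0<..} t * (t powr ((?n + 1) / 2 - 1) * exp (- ((norm x)\<^sup>2 / 4) * t)))"
      "(LINT t|lborel. indicator {0<..} t * (t powr ((?n + 1) / 2 - 1) * exp (- ((norm x)\<^sup>2 / 4) * t))) = Gamma ((?n + 1) / 2) * ((norm x)\<^sup>2 / 4) powr (- ((?n + 1) / 2))"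
      using xp by (intro gamma_integral_scaled; simp add: add_nonneg_pos)+
    have bi: "integrable lborel ?b" using gs(1) by (rule integrable_mult_right)
    have "norm (LINT \<tau>|lborel. LINT \<xi>|lborel. of_real (?K \<tau> \<xi>) * ?G \<xi>) \<le> (LINT \<tau>|lborel. ?b \<tau>)"
      using bi inner by (rule norm_integral_le)
    also have "\<dots> = (4 * pi) powr (?n / 2) * N * (Gamma ((?n + 1) / 2) * ((norm x)\<^sup>2 / 4) powr (- ((?n + 1) / 2)))"
      using gs(2) by simp
    also have "((norm x)\<^sup>2 / 4) powr (- ((?n + 1) / 2)) = 4 powr ((?n + 1) / 2) * norm x powr (- (?n + 1))"
    proof -
      have "((norm x)\<^sup>2 / 4) powr (- ((?n + 1) / 2)) = ((norm x)\<^sup>2) powr (- ((?n + 1) / 2)) * 4 powr ((?n + 1) / 2)"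
        by (simp add: powr_divide powr_minus_divide)
      also have "((norm x)\<^sup>2) powr (- ((?n + 1) / 2)) = norm x powr (2 * (- ((?n + 1) / 2)))"
        using xp by (subst powr_powr[symmetric]) simp
      also have "2 * (- ((?n + 1) / 2)) = - (?n + 1)" by (simp add: field_simps)
      finally show ?thesis by (simp only: mult.commute)
    qed
    finally have "norm (LINT \<tau>|lborel. LINT \<xi>|lborel. of_real (?K \<tau> \<xi>) * ?G \<xi>) \<le> A0 * norm x powr (- (?n + 1))"
      by (simp add: A0_def mult_ac)
    then show ?thesis unfolding eq[symmetric] norm_mult norm_of_real using c(1) by (simp add: mult.commute)
  qed
  show ?thesis
  proof (rule that)
    show "1 \<le> R" by (simp add: R_def)
    show "0 \<le> A0 / c / (2 * pi) ^ CARD('n)" using A0 c by simp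
    show "norm (inv_fourier ?h x) \<le> A0 / c / (2 * pi) ^ CARD('n) * norm x powr (- (?n + 1))" if "R < norm x" for x
    proof -
      have "norm (LINT \<xi>|lborel. ?h \<xi> * cis (x \<bullet> \<xi>)) \<le> A0 * norm x powr (- (?n + 1)) / c"
        using main[OF that] c by (simp add: pos_le_divide_eq)
      then have "norm (LINT \<xi>|lborel. ?h \<xi> * cis (x \<bullet> \<xi>)) / \<bar>(2 * pi) ^ CARD('n)\<bar> \<le> A0 * norm x powr (- (?n + 1)) / c / \<bar>(2 * pi) ^ CARD('n)\<bar>"
        by (rule divide_right_mono) simp
      also have "\<dots> = A0 / c / (2 * pi) ^ CARD('n) * norm x powr (- (?n + 1))" by simp
      finally show ?thesis unfolding inv_fourier_def norm_divide norm_of_real .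
    qed
  qed
qed

text \<open>For even \<open>n\<close> the function has bounded support. For odd \<open>n\<close>
  write \<open>norm \<xi> ^ n = norm \<xi> * norm \<xi> ^ (n - 1)\<close>: the even power is an
  iterated Laplacian, so \<open>half_laplacian_decay\<close> is applied to a test function. On
  bounded sets the global bound suffices.\<close>

theorem hnl_decay:
  fixes f :: "real^'n \<Rightarrow> real"
  assumes f: "test_function f"
  shows "\<exists>C\<ge>0. \<forall>x. norm (hnl f x) \<le> C * bracket x powr (- (real CARD('n) + 1))"
proof -
  obtain B where B: "0 \<le> B" "\<And>x. norm (hnl f x) \<le> B" by (rule hnl_bounded) (rule that)
  obtain R A where RA: "1 \<le> R" "0 \<le> A" "\<And>x. R < norm x \<Longrightarrow> norm (hnl f x) \<le> A * norm x powr (- (real CARD('n) + 1))"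
  proof (cases "even CARD('n)")
    case True
    define g where "g = ((\<lambda>f x. - laplacian f x) ^^ (CARD('n) div 2)) f"
    have e: "2 * (CARD('n) div 2) = CARD('n)" using True by (rule dvd_mult_div_cancel)
    note it = Fr_iterate_laplacian[OF f, of "CARD('n) div 2", folded g_def, unfolded e]
    have g: "test_function g" by (rule conjunct1[OF it])
    have "Fr g = (\<lambda>\<xi>. of_real (norm \<xi> ^ CARD('n)) * Fr f \<xi>)" by (intro ext conjunct2[OF it])
    then have "hnl f = inv_fourier (Fr g)" unfolding hnl_def by (simp only:)
    then have hg: "hnl f x = of_real (g x)" for x using fourier_inversion[OF g] by (simp only:)
    obtain R where R: "0 < R" "\<And>x. R < norm x \<Longrightarrow> g x = 0"
      by (rule test_function_bounded_support[OF g]) (rule that)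
    show ?thesis
    proof (rule that)
      show "1 \<le> max 1 R" "0 \<le> (0::real)" by simp_all
      show "norm (hnl f x) \<le> 0 * norm x powr (- (real CARD('n) + 1))" if "max 1 R < norm x" for x
        using R(2)[of x] that hg[of x] by simp
    qed
  next
    case False
    define g where "g = ((\<lambda>f x. - laplacian f x) ^^ ((CARD('n) - 1) div 2)) f"
    have e: "2 * ((CARD('n) - 1) div 2) = CARD('n) - 1" using False by (intro dvd_mult_div_cancel) simp
    note it = Fr_iterate_laplacian[OF f, of "(CARD('n) - 1) div 2", folded g_def, unfolded e]
    have g: "test_function g" by (rule conjunct1[OF it])
    have Fg: "Fr g = (\<lambda>\<xi>. of_real (norm \<xi> ^ (CARD('n) - 1)) * Fr f \<xi>)" by (intro ext conjunct2[OF it])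
    have "norm \<xi> * norm \<xi> ^ (CARD('n) - 1) = norm \<xi> ^ CARD('n)" for \<xi> :: "real^'n"
      by (simp add: power_eq_if[of _ "CARD('n)"])
    then have h: "hnl f = inv_fourier (\<lambda>\<xi>. of_real (norm \<xi>) * Fr g \<xi>)"
      unfolding hnl_def Fg mult.assoc[symmetric] of_real_mult[symmetric] by (simp only:)
    obtain R A where RA: "1 \<le> R" "0 \<le> A" "\<And>x. R < norm x \<Longrightarrow>
        norm (inv_fourier (\<lambda>\<xi>. of_real (norm \<xi>) * Fr g \<xi>) x) \<le> A * norm x powr (- (real CARD('n) + 1))"
      by (rule half_laplacian_decay[OF g]) (rule that)
    show ?thesis by (rule that[OF RA(1,2)]) (unfold h, rule RA(3))
  qed
  show ?thesis by (rule bounded_tail_decay[OF B _ RA]) simp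
qed


lemma hnl_integrable:
  fixes f :: "real^'n \<Rightarrow> real"
  assumes f: "test_function f"
  shows "integrable lborel (hnl f)"
proof -
  obtain C where C: "0 \<le> C" "\<And>x. norm (hnl f x) \<le> C * bracket x powr (- (real CARD('n) + 1))"
    using hnl_decay[OF f] by blast
  have i: "integrable lborel (\<lambda>x::real^'n. C * bracket x powr (- (real CARD('n) + 1)))"
    by (intro integrable_mult_right bracket_power_integrable) simp
  show ?thesis
    by (rule Bochner_Integration.integrable_bound[OF i])
       (use C hnl_meas[OF f] in \<open>auto intro: order_trans[OF _ abs_ge_self]\<close>)
qed

text \<open>\<open>(1 + x / n) ^ n <= exp x\<close> at \<open>x = v\<^sup>2 / 4\<close>, combined
  with \<open>(1 - v / (2 * sqrt n))\<^sup>2 >= 0\<close>.\<close>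

lemma power_exp_bounded:
  fixes v :: real
  assumes "0 \<le> v" "0 < n"
  shows "v ^ n * exp (- v\<^sup>2 / 4) \<le> sqrt (real n) ^ n"
proof -
  have n: "0 < sqrt (real n)" using assms by simp
  have "(1 - v / (2 * sqrt (real n)))\<^sup>2 = 1 - v / sqrt (real n) + v\<^sup>2 / 4 / real n"
    by (simp add: power2_diff power_divide power_mult_distrib)
  then have "v / sqrt (real n) \<le> 1 + v\<^sup>2 / 4 / real n"
    using zero_le_power2[of "1 - v / (2 * sqrt (real n))"] by linarith
  then have "(v / sqrt (real n)) ^ n \<le> (1 + v\<^sup>2 / 4 / real n) ^ n"
    using assms by (intro power_mono) auto
  also have "\<dots> \<le> exp (v\<^sup>2 / 4)"
    using assms by (intro exp_ge_one_plus_x_over_n_power_n) (auto intro: order_trans[of _ 0])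
  finally show ?thesis using n by (simp add: power_divide exp_minus field_simps)
qed

text \<open>The symbol \<open>norm \<xi> ^ n\<close> vanishes at the origin. As \<open>hnl f\<close>
  is given as an inverse transform, its integral is reached through Gaussian cut-offs of width
  \<open>m j\<close>; on the frequency side they become bounded factors
  \<open>q (m j * norm \<xi>)\<close> that tend to 0 for \<open>\<xi> \<noteq> 0\<close>.\<close>

theorem hnl_integral_zero:
  fixes f :: "real^'n \<Rightarrow> real"
  assumes f: "test_function f"
  shows "(LINT x|lborel. hnl f x) = 0"
proof -
  let ?n = "CARD('n)"
  let ?F = "\<lambda>\<xi>. of_real (norm \<xi> ^ CARD('n)) * Fr f \<xi>"
  have n: "0 < ?n" by simp
  define m where "m j = real (Suc j)" for j
  have m: "0 < m j" for j by (simp add: m_def)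
  have im0: "(\<lambda>j. 1 / m j) \<longlonglongrightarrow> 0" unfolding m_def by (rule LIMSEQ_inverse_real_of_nat[unfolded inverse_eq_divide])
  have Fi: "integrable lborel ?F" by (rule hnl_integrand_integrable[OF f])
  have Fri: "integrable lborel (Fr f)" using Fr_power_integrable[OF f, of 0] by simp
  have [measurable]: "Fr f \<in> borel_measurable borel" using borel_measurable_integrable[OF Fri] by simp
  have [measurable]: "hnl f \<in> borel_measurable borel" by (rule hnl_meas[OF f])
  let ?L = "\<lambda>j. LINT x|lborel. of_real (exp (- (1 / m j)\<^sup>2 * (norm (x - 0))\<^sup>2)) * hnl f x"
  have "?L \<longlonglongrightarrow> (LINT x|lborel. of_real (exp (- 0\<^sup>2 * (norm (x - 0))\<^sup>2)) * hnl f x)"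
  proof (rule integral_dominated_convergence[where w = "\<lambda>x. norm (hnl f x)"])
    show "AE x in lborel. (\<lambda>j. of_real (exp (- (1 / m j)\<^sup>2 * (norm (x - 0))\<^sup>2)) * hnl f x) \<longlonglongrightarrow> of_real (exp (- 0\<^sup>2 * (norm (x - 0))\<^sup>2)) * hnl f x"
      by (intro AE_I2 tendsto_intros im0)
    show "AE x in lborel. norm (of_real (exp (- (1 / m j)\<^sup>2 * (norm (x - 0))\<^sup>2)) * hnl f x) \<le> norm (hnl f x)" for j
      by (intro AE_I2) (simp add: norm_mult mult_left_le_one_le)
    show "integrable lborel (\<lambda>x. norm (hnl f x))" using hnl_integrable[OF f] by (rule integrable_norm)
  qed measurable
  then have 1: "?L \<longlonglongrightarrow> (LINT x|lborel. hnl f x)" by simp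
  define c where "c = pi powr (real ?n / 2) / (2 * pi) ^ ?n"
  \<comment> \<open>The power joins the symbol with the factor \<open>m j ^ n\<close> from the
    normalisation of the Gaussian.\<close>
  define q where "q v = v ^ ?n * exp (- v\<^sup>2 / 4)" for v :: real
  have q_le: "\<bar>q v\<bar> \<le> sqrt (real ?n) ^ ?n" if "0 \<le> v" for v
    using power_exp_bounded[OF that n] that by (simp add: q_def)
  \<comment> \<open>Bounding one power more than in \<open>q_le\<close> leaves the factor
    \<open>1 / m j\<close>.\<close>
  have q_lim: "(\<lambda>j. q (m j * r)) \<longlonglongrightarrow> 0" if r: "0 < r" for r
  proof (rule null_sandwich)
    let ?K = "sqrt (real (Suc ?n)) ^ Suc ?n"
    show "(\<lambda>j. 1 / m j * (?K / r)) \<longlonglongrightarrow> 0" using tendsto_mult_right[OF im0, of "?K / r"] by simp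
    show "\<forall>\<^sub>F j in sequentially. q (m j * r) \<le> 1 / m j * (?K / r)"
    proof (intro always_eventually allI)
      fix j
      have v: "0 < m j * r" using m r by simp
      have "(m j * r) * q (m j * r) \<le> ?K"
        using power_exp_bounded[of "m j * r" "Suc ?n"] v by (simp add: q_def mult.assoc)
      then have "q (m j * r) \<le> ?K / (m j * r)" using v by (subst pos_le_divide_eq) (simp_all add: mult.commute)
      then show "q (m j * r) \<le> 1 / m j * (?K / r)" by simp
    qed
    show "0 \<le> q (m j * r)" for j using m[of j] r by (simp add: q_def)
  qed
  have eq: "?L j = of_real c * (LINT \<xi>|lborel. of_real (q (m j * norm \<xi>)) * Fr f \<xi>)" for j
  proof -
    have t: "0 < (1 / m j)\<^sup>2" using m[of j] by simp
    have pw: "(pi / (1 / m j)\<^sup>2) powr (real ?n / 2) = pi powr (real ?n / 2) * m j ^ ?n"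
    proof -
      have "(pi / (1 / m j)\<^sup>2) powr (real ?n / 2) = (pi * (m j)\<^sup>2) powr (real ?n / 2)" by (simp add: power_divide)
      also have "\<dots> = pi powr (real ?n / 2) * ((m j)\<^sup>2) powr (real ?n / 2)" by (rule powr_mult)
      also have "((m j)\<^sup>2) powr (real ?n / 2) = (m j powr 2) powr (real ?n / 2)" using m[of j] by simp
      also have "\<dots> = m j ^ ?n" unfolding powr_powr using m[of j] by (simp add: powr_realpow)
      finally show ?thesis .
    qed
    have "?L j = of_real ((pi / (1 / m j)\<^sup>2) powr (real ?n / 2) / (2 * pi) ^ ?n) *
       (LINT \<xi>|lborel. ?F \<xi> * cis (0 \<bullet> \<xi>) * of_real (exp (- (norm \<xi>)\<^sup>2 / (4 * (1 / m j)\<^sup>2))))"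
      unfolding hnl_def by (rule gauss_inv_fourier[OF t Fi])
    also have "\<dots> = of_real c * (of_real (m j ^ ?n) * (LINT \<xi>|lborel. ?F \<xi> * cis (0 \<bullet> \<xi>) * of_real (exp (- (norm \<xi>)\<^sup>2 / (4 * (1 / m j)\<^sup>2)))))"
      unfolding pw c_def by simp
    also have "of_real (m j ^ ?n) * (LINT \<xi>|lborel. ?F \<xi> * cis (0 \<bullet> \<xi>) * of_real (exp (- (norm \<xi>)\<^sup>2 / (4 * (1 / m j)\<^sup>2))))
      = (LINT \<xi>|lborel. of_real (m j ^ ?n) * (?F \<xi> * cis (0 \<bullet> \<xi>) * of_real (exp (- (norm \<xi>)\<^sup>2 / (4 * (1 / m j)\<^sup>2)))))"
      by (rule integral_mult_right_zero[symmetric])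
    also have "\<dots> = (LINT \<xi>|lborel. of_real (q (m j * norm \<xi>)) * Fr f \<xi>)"
    proof (intro Bochner_Integration.integral_cong refl)
      fix \<xi> :: "real^'n"
      have "- (norm \<xi>)\<^sup>2 / (4 * (1 / m j)\<^sup>2) = - (m j * norm \<xi>)\<^sup>2 / 4"
        using m[of j] by (simp add: power_divide power_mult_distrib)
      then show "of_real (m j ^ ?n) * (?F \<xi> * cis (0 \<bullet> \<xi>) * of_real (exp (- (norm \<xi>)\<^sup>2 / (4 * (1 / m j)\<^sup>2))))
        = of_real (q (m j * norm \<xi>)) * Fr f \<xi>"
        unfolding q_def by (simp only: inner_zero_left cis_zero) (simp add: power_mult_distrib)
    qed
    finally show ?thesis .
  qed
  have "(\<lambda>j. LINT \<xi>|lborel. of_real (q (m j * norm \<xi>)) * Fr f \<xi>) \<longlonglongrightarrow> (LINT \<xi>|(lborel :: (real^'n) measure). (0 :: complex))"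
  proof (rule integral_dominated_convergence[where w = "\<lambda>\<xi>. sqrt (real ?n) ^ ?n * norm (Fr f \<xi>)"])
    show "AE \<xi> in lborel. (\<lambda>j. of_real (q (m j * norm \<xi>)) * Fr f \<xi>) \<longlonglongrightarrow> 0"
      using AE_lborel_neq[of 0]
    proof eventually_elim
      case (elim \<xi>)
      then have "(\<lambda>j. of_real (q (m j * norm \<xi>)) * Fr f \<xi>) \<longlonglongrightarrow> of_real 0 * Fr f \<xi>"
        by (intro tendsto_intros q_lim) simp
      then show ?case by simp
    qed
    show "AE \<xi> in lborel. norm (of_real (q (m j * norm \<xi>)) * Fr f \<xi>) \<le> sqrt (real ?n) ^ ?n * norm (Fr f \<xi>)" for j
      using q_le m[of j] by (intro AE_I2) (simp add: norm_mult mult_right_mono)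
    show "integrable lborel (\<lambda>\<xi>. sqrt (real ?n) ^ ?n * norm (Fr f \<xi>))" using Fri by simp
    show "(\<lambda>\<xi>. of_real (q (m j * norm \<xi>)) * Fr f \<xi>) \<in> borel_measurable lborel" for j
      unfolding q_def by measurable
  qed simp
  then have "(\<lambda>j. of_real c * (LINT \<xi>|lborel. of_real (q (m j * norm \<xi>)) * Fr f \<xi>)) \<longlonglongrightarrow> of_real c * 0"
    by (intro tendsto_mult_left) simp
  then have "?L \<longlonglongrightarrow> 0" unfolding eq by simp
  with 1 show ?thesis by (rule LIMSEQ_unique)
qed

section \<open>Logarithmic potentials of \<open>hnl f\<close>\<close>

lemma ln_bracket_le: "0 \<le> ln (bracket x)" "ln (bracket x) \<le> 2 * bracket x powr (1 / 2)"
proof -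
  show "0 \<le> ln (bracket x)" using bracket_ge1[of x] by simp
  have "ln (bracket x powr (1 / 2)) \<le> bracket x powr (1 / 2)"
    using ln_le_minus_one[of "bracket x powr (1 / 2)"] bracket_pos[of x] by simp
  then show "ln (bracket x) \<le> 2 * bracket x powr (1 / 2)" using bracket_pos[of x] by simp
qed

lemma ln_bracket_hnl_integrable:
  fixes f :: "real^'n \<Rightarrow> real"
  assumes f: "test_function f"
  shows "integrable lborel (\<lambda>x. of_real (ln (bracket x)) * hnl f x)"
proof -
  obtain C where C: "0 \<le> C" "\<And>x. norm (hnl f x) \<le> C * bracket x powr (- (real CARD('n) + 1))"
    using hnl_decay[OF f] by blast
  have i: "integrable lborel (\<lambda>x::real^'n. 2 * C * bracket x powr (- (real CARD('n) + 1 / 2)))"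
    by (intro integrable_mult_right bracket_power_integrable) simp
  have [measurable]: "hnl f \<in> borel_measurable borel" by (rule hnl_meas[OF f])
  show ?thesis
  proof (rule Bochner_Integration.integrable_bound[OF i])
    show "AE x in lborel. norm (of_real (ln (bracket x)) * hnl f x) \<le> norm (2 * C * bracket x powr (- (real CARD('n) + 1 / 2)))"
    proof (rule AE_I2)
      fix x :: "real^'n"
      have "norm (of_real (ln (bracket x)) * hnl f x) = ln (bracket x) * norm (hnl f x)"
        using ln_bracket_le(1)[of x] by (simp add: norm_mult)
      also have "\<dots> \<le> (2 * bracket x powr (1 / 2)) * (C * bracket x powr (- (real CARD('n) + 1)))"
        using C ln_bracket_le[of x] by (intro mult_mono) auto
      also have "\<dots> = 2 * C * (bracket x powr (1 / 2) * bracket x powr (- (real CARD('n) + 1)))" by simp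
      also have "bracket x powr (1 / 2) * bracket x powr (- (real CARD('n) + 1)) = bracket x powr (- (real CARD('n) + 1 / 2))"
      proof -
        have "1 / 2 + (- (real CARD('n) + 1)) = - (real CARD('n) + 1 / 2)" by simp
        then show ?thesis by (simp only: powr_add[symmetric])
      qed
      finally show "norm (of_real (ln (bracket x)) * hnl f x) \<le> norm (2 * C * bracket x powr (- (real CARD('n) + 1 / 2)))"
        using abs_ge_self order_trans unfolding real_norm_def by blast
    qed
  qed measurable
qed

text \<open>\<open>lker <= 2 * exp (lker / 2)\<close>, and the decay of order \<open>n + 1\<close>
  makes the exponent \<open>1/2\<close> admissible in \<open>exp_lker_integrable\<close>:
  \<open>1/2 < n\<close> and \<open>n + 1/2 < n + 1\<close>. Uniformity in \<open>y\<close> is for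
  Fubini against a density in \<open>potential_hnl\<close>.\<close>

lemma lker_hnl_bound:
  fixes f :: "real^'n \<Rightarrow> real"
  assumes f: "test_function f"
  obtains C where "0 \<le> C" "\<And>y. integrable lborel (\<lambda>x. lker x y * norm (hnl f x))"
    "\<And>y. (LINT x|lborel. lker x y * norm (hnl f x)) \<le> C"
proof -
  let ?n = "real CARD('n)"
  obtain C where C: "0 \<le> C" "\<And>x. norm (hnl f x) \<le> C * bracket x powr (- (?n + 1))"
    using hnl_decay[OF f] by blast
  let ?e = "\<lambda>y x::real^'n. exp (1 / 2 * lker x y) * bracket x powr (- (?n + 1))"
  obtain C0 where C0: "0 \<le> C0" and ei: "\<And>y. integrable lborel (?e y)" and el: "\<And>y. (LINT x|lborel. ?e y x) \<le> C0"
  proof (rule exp_lker_integrable[where 'a = "real^'n", of "1 / 2" "?n + 1"])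
    have "0 < CARD('n)" by simp
    then have n: "1 \<le> ?n" by linarith
    have d: "real DIM(real^'n) = ?n" by simp
    show "1 / 2 < real DIM(real^'n)" unfolding d using n by linarith
    show "real DIM(real^'n) + 1 / 2 < ?n + 1" by simp
  qed (simp, rule that)
  have le: "lker x y * norm (hnl f x) \<le> 2 * C * ?e y x" for x y
  proof -
    have "lker x y \<le> 2 * exp (1 / 2 * lker x y)" using exp_ge_add_one_self[of "1 / 2 * lker x y"] by linarith
    then have "lker x y * norm (hnl f x) \<le> (2 * exp (1 / 2 * lker x y)) * (C * bracket x powr (- (?n + 1)))"
      using C lker_nonneg[of x y] by (intro mult_mono) auto
    then show ?thesis by (simp add: mult_ac)
  qed
  have [measurable]: "hnl f \<in> borel_measurable borel" by (rule hnl_meas[OF f])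
  have i: "integrable lborel (\<lambda>x. lker x y * norm (hnl f x))" for y
  proof (rule Bochner_Integration.integrable_bound[OF integrable_mult_right[OF ei[of y], of "2 * C"]])
    show "AE x in lborel. norm (lker x y * norm (hnl f x)) \<le> norm (2 * C * ?e y x)"
    proof (rule AE_I2)
      fix x
      have "norm (lker x y * norm (hnl f x)) = lker x y * norm (hnl f x)" using lker_nonneg[of x y] by simp
      also have "\<dots> \<le> 2 * C * ?e y x" by (rule le)
      finally show "norm (lker x y * norm (hnl f x)) \<le> norm (2 * C * ?e y x)"
        using abs_ge_self order_trans unfolding real_norm_def by blast
    qed
  qed measurable
  have "(LINT x|lborel. lker x y * norm (hnl f x)) \<le> 2 * C * C0" for y
  proof -
    have "(LINT x|lborel. lker x y * norm (hnl f x)) \<le> (LINT x|lborel. 2 * C * ?e y x)"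
      using ei[of y] by (intro integral_mono i le) simp
    also have "\<dots> = 2 * C * (LINT x|lborel. ?e y x)" by simp
    also have "\<dots> \<le> 2 * C * C0" using el[of y] C(1) by (intro mult_left_mono) auto
    finally show ?thesis .
  qed
  then show ?thesis using i C C0 by (intro that[of "2 * C * C0"]) auto
qed

lemma lker_hnl_integrable:
  assumes "test_function f"
  shows "integrable lborel (\<lambda>x. of_real (lker x y) * hnl f x)"
proof -
  obtain C where C: "0 \<le> C" "\<And>y. integrable lborel (\<lambda>x. lker x y * norm (hnl f x))"
    "\<And>y. (LINT x|lborel. lker x y * norm (hnl f x)) \<le> C"
    by (rule lker_hnl_bound[OF assms]) (rule that)
  have [measurable]: "hnl f \<in> borel_measurable borel" by (rule hnl_meas[OF assms])
  show ?thesis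
    by (rule Bochner_Integration.integrable_bound[OF C(2)[of y]]) (auto simp: norm_mult lker_nonneg)
qed


text \<open>Legendre's duplication formula at \<open>z = n / 2\<close>. The left side comes from the
  area of the sphere, the right side is the constant that the superposition of Gaussians produces in
  \<open>log_potential_hnl\<close>.\<close>

lemma gamma_const_duplication:
  "2 * gamma_const TYPE('n::finite) = pi powr (real CARD('n) / 2) * Gamma (real CARD('n) / 2) * 2 ^ CARD('n)"
proof -
  define n where "n = CARD('n)"
  have n: "0 < n" by (simp add: n_def)
  define z where "z = real n / 2"
  have z: "0 < z" using n by (simp add: z_def)
  have np: "complex_of_real r \<notin> \<int>\<^sub>\<le>\<^sub>0" if "0 < r" for r :: real
    using that by (auto elim!: nonpos_Ints_cases simp: complex_eq_iff)
  have "complex_of_real (Gamma z * Gamma (z + 1 / 2)) = complex_of_real (exp ((1 - 2 * z) * ln 2) * sqrt pi * Gamma (2 * z))"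
    using Gamma_legendre_duplication[of "complex_of_real z"] np[of z] np[of "z + 1 / 2"] z
    by (simp add: Gamma_complex_of_real[symmetric] exp_of_real[symmetric])
  then have "Gamma z * Gamma (z + 1 / 2) = exp ((1 - 2 * z) * ln 2) * sqrt pi * Gamma (2 * z)"
    by (simp only: of_real_eq_iff)
  also have "Gamma (2 * z) = fact (n - 1)"
    using Gamma_fact[of "n - 1", where 'a = real] n by (simp add: z_def)
  also have "exp ((1 - 2 * z) * ln 2) = 2 / 2 ^ n"
  proof -
    have "exp ((1 - 2 * z) * ln 2) = 2 powr (1 - real n)" by (simp add: powr_def z_def)
    then show ?thesis by (simp add: powr_diff powr_realpow)
  qed
  finally have L: "Gamma z * Gamma (z + 1 / 2) * 2 ^ n = 2 * sqrt pi * fact (n - 1)" by simp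
  have Gp: "0 < Gamma (z + 1 / 2)" using z by (intro Gamma_real_pos) simp
  have "gamma_const TYPE('n) = fact (n - 1) * pi powr (z + 1 / 2) / Gamma (z + 1 / 2)"
    unfolding gamma_const_eq n_def[symmetric] z_def by (simp add: add_divide_distrib)
  also have "pi powr (z + 1 / 2) = pi powr z * sqrt pi" by (simp add: powr_add powr_half_sqrt)
  finally have "2 * gamma_const TYPE('n) = pi powr z * (2 * sqrt pi * fact (n - 1)) / Gamma (z + 1 / 2)" by simp
  also have "\<dots> = pi powr z * Gamma z * 2 ^ n" unfolding L[symmetric] using Gp by simp
  finally show ?thesis by (simp add: z_def n_def)
qed

lemma ln_norm_hnl_integrable:
  fixes f :: "real^'n \<Rightarrow> real"
  assumes f: "test_function f"
  shows "integrable lborel (\<lambda>x. of_real (ln (norm (x - y))) * hnl f x)"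
proof -
  have "integrable lborel (\<lambda>x. of_real (ln (bracket x)) * hnl f x + of_real (ln (bracket y)) * hnl f x - of_real (lker x y) * hnl f x)"
    by (intro Bochner_Integration.integrable_add Bochner_Integration.integrable_diff integrable_mult_right
        ln_bracket_hnl_integrable lker_hnl_integrable hnl_integrable f)
  then show ?thesis by (simp add: lker_def algebra_simps)
qed

text \<open>Frullani's formula for \<open>ln ((norm (x - y))\<^sup>2)\<close> gives an integral over
  Gaussians, each of which passes to the frequency side. Integrating there over \<open>s\<close>
  first produces \<open>Gamma (n / 2) * 2 ^ n / norm \<xi> ^ n\<close>, which cancels the symbol,
  and inversion returns \<open>f y\<close>. The square accounts for the 2 in
  \<open>gamma_const_duplication\<close>.\<close>

theorem log_potential_hnl:
  fixes f :: "real^'n \<Rightarrow> real"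
  assumes f: "test_function f"
  shows "(LINT x|lborel. of_real (ln (norm (x - y))) * hnl f x) = - of_real (gamma_const TYPE('n) * f y)"
proof -
  let ?n = "CARD('n)" let ?p = "real CARD('n) / 2"
  let ?F = "\<lambda>\<xi>. of_real (norm \<xi> ^ CARD('n)) * Fr f \<xi>"
  let ?G = "\<lambda>\<xi>. ?F \<xi> * cis (y \<bullet> \<xi>)"
  have Fi: "integrable lborel ?F" by (rule hnl_integrand_integrable[OF f])
  have Fri: "integrable lborel (Fr f)" using Fr_power_integrable[OF f, of 0] by simp
  have [measurable]: "Fr f \<in> borel_measurable borel" using borel_measurable_integrable[OF Fri] by simp
  have [measurable]: "hnl f \<in> borel_measurable borel" by (rule hnl_meas[OF f])
  define cc where "cc = pi powr ?p / (2 * pi) ^ ?n"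
  let ?K = "\<lambda>s x. frullani_integrand ((norm (x - y))\<^sup>2) s"
  let ?K2 = "\<lambda>s \<xi>::real^'n. indicator {0<..} s * (s powr (?p - 1) * exp (- ((norm \<xi>)\<^sup>2 / 4) * s)) :: real"
  have p: "0 < ?p" by simp
  have ne: "0 < (norm (x - y))\<^sup>2" if "x \<noteq> y" for x :: "real^'n" using that by simp
  have inner: "(LINT x|lborel. of_real (?K s x) * hnl f x) = - of_real cc * (LINT \<xi>|lborel. of_real (?K2 s \<xi>) * ?G \<xi>)" for s
  proof (cases "0 < s")
    case True
    have t: "0 < 1 / s" using True by simp
    let ?g = "\<lambda>x. of_real (exp (- (1 / s) * (norm (x - y))\<^sup>2)) * hnl f x"
    have gi: "integrable lborel ?g"
    proof (rule Bochner_Integration.integrable_bound[OF hnl_integrable[OF f]])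
      show "AE x in lborel. norm (?g x) \<le> norm (hnl f x)"
        using True by (intro AE_I2) (simp add: norm_mult mult_left_le_one_le)
    qed measurable
    have "(LINT x|lborel. of_real (?K s x) * hnl f x) = (LINT x|lborel. of_real (exp (- 1 / s) / s) * hnl f x - of_real (1 / s) * ?g x)"
      using True by (intro Bochner_Integration.integral_cong refl) (simp add: frullani_integrand_def diff_divide_distrib algebra_simps)
    also have "\<dots> = of_real (exp (- 1 / s) / s) * (LINT x|lborel. hnl f x) - of_real (1 / s) * (LINT x|lborel. ?g x)"
      using gi hnl_integrable[OF f] by simp
    \<comment> \<open>The term \<open>exp (- 1 / s)\<close>, which makes the integral over
      \<open>s\<close> converge, is constant in \<open>x\<close> and is removed by the zero
      mean.\<close>
    also have "\<dots> = - of_real (1 / s) * (LINT x|lborel. ?g x)" by (simp add: hnl_integral_zero[OF f])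
    also have "(LINT x|lborel. ?g x) = of_real ((pi / (1 / s)) powr ?p / (2 * pi) ^ ?n) *
        (LINT \<xi>|lborel. ?F \<xi> * cis (y \<bullet> \<xi>) * of_real (exp (- (norm \<xi>)\<^sup>2 / (4 * (1 / s)))))"
      unfolding hnl_def by (rule gauss_inv_fourier[OF t Fi])
    also have "(pi / (1 / s)) powr ?p / (2 * pi) ^ ?n = cc * s powr ?p"
      using True by (simp add: cc_def powr_mult)
    also have "- of_real (1 / s) * (of_real (cc * s powr ?p) * (LINT \<xi>|lborel. ?F \<xi> * cis (y \<bullet> \<xi>) * of_real (exp (- (norm \<xi>)\<^sup>2 / (4 * (1 / s))))))
      = - of_real cc * (of_real (s powr ?p / s) * (LINT \<xi>|lborel. ?F \<xi> * cis (y \<bullet> \<xi>) * of_real (exp (- (norm \<xi>)\<^sup>2 / (4 * (1 / s))))))"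
      by simp
    also have "of_real (s powr ?p / s) * (LINT \<xi>|lborel. ?F \<xi> * cis (y \<bullet> \<xi>) * of_real (exp (- (norm \<xi>)\<^sup>2 / (4 * (1 / s)))))
      = (LINT \<xi>|lborel. of_real (s powr ?p / s) * (?F \<xi> * cis (y \<bullet> \<xi>) * of_real (exp (- (norm \<xi>)\<^sup>2 / (4 * (1 / s))))))"
      by (rule integral_mult_right_zero[symmetric])
    also have "\<dots> = (LINT \<xi>|lborel. of_real (?K2 s \<xi>) * ?G \<xi>)"
      using True by (intro Bochner_Integration.integral_cong refl) (simp add: powr_diff mult_ac)
    finally show ?thesis .
  qed (simp add: frullani_integrand_def)
  have K2i: "integrable lborel (\<lambda>s. ?K2 s \<xi>)" "(LINT s|lborel. ?K2 s \<xi>) = Gamma ?p * 2 ^ ?n / norm \<xi> ^ ?n" if "\<xi> \<noteq> 0" for \<xi>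
  proof -
    have a: "0 < (norm \<xi>)\<^sup>2 / 4" using that by simp
    show "integrable lborel (\<lambda>s. ?K2 s \<xi>)" by (rule gamma_integral_scaled(1)[OF p a])
    have "((norm \<xi>)\<^sup>2 / 4) powr (- ?p) = ((norm \<xi> / 2) powr 2) powr (- ?p)" using that by (simp add: power_divide)
    also have "\<dots> = (norm \<xi> / 2) powr (- real ?n)" unfolding powr_powr by simp
    also have "\<dots> = 1 / (norm \<xi> / 2) ^ ?n" using that by (simp add: powr_minus_divide powr_realpow)
    also have "\<dots> = 2 ^ ?n / norm \<xi> ^ ?n" by (simp add: power_divide)
    finally show "(LINT s|lborel. ?K2 s \<xi>) = Gamma ?p * 2 ^ ?n / norm \<xi> ^ ?n"
      using gamma_integral_scaled(2)[OF p a] by simp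
  qed
  have Gp: "0 < Gamma ?p" using p by (rule Gamma_real_pos)
  have Gm [measurable]: "?G \<in> borel_measurable borel" by measurable
  have "(LINT x|lborel. of_real (LINT s|lborel. ?K s x) * hnl f x) = (LINT s|lborel. LINT x|lborel. of_real (?K s x) * hnl f x)"
  proof (rule kernel_Fubini)
    show "(\<lambda>p. ?K (snd p) (fst p)) \<in> borel_measurable (borel \<Otimes>\<^sub>M borel)" by measurable
    show "AE x in lborel. integrable lborel (\<lambda>s. ?K s x)"
      using AE_lborel_neq[of y] by eventually_elim (rule frullani(1)[OF ne])
    show "integrable lborel (\<lambda>x. (LINT s|lborel. \<bar>?K s x\<bar>) * norm (hnl f x))"
    proof (rule Bochner_Integration.integrable_bound[OF integrable_mult_right[OF integrable_norm[OF ln_norm_hnl_integrable[OF f, of y]], of 2]])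
      show "AE x in lborel. norm ((LINT s|lborel. \<bar>?K s x\<bar>) * norm (hnl f x)) \<le> norm (2 * norm (of_real (ln (norm (x - y))) * hnl f x))"
        using AE_lborel_neq[of y]
      proof eventually_elim
        case (elim x)
        have "(LINT s|lborel. \<bar>?K s x\<bar>) = 2 * \<bar>ln (norm (x - y))\<bar>"
          unfolding frullani(3)[OF ne[OF elim]] using elim by (simp add: ln_realpow abs_mult)
        then show ?case by (simp add: norm_mult abs_mult)
      qed
    qed measurable
  qed measurable
  also have "\<dots> = - of_real cc * (LINT s|lborel. LINT \<xi>|lborel. of_real (?K2 s \<xi>) * ?G \<xi>)"
    unfolding inner by (rule integral_mult_right_zero)
  also have "(LINT s|lborel. LINT \<xi>|lborel. of_real (?K2 s \<xi>) * ?G \<xi>) = (LINT \<xi>|lborel. of_real (LINT s|lborel. ?K2 s \<xi>) * ?G \<xi>)"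
  proof (rule kernel_Fubini[symmetric])
    show "(\<lambda>p. ?K2 (snd p) (fst p)) \<in> borel_measurable (borel \<Otimes>\<^sub>M borel)" by measurable
    show "AE \<xi> in lborel. integrable lborel (\<lambda>s. ?K2 s \<xi>)"
      using AE_lborel_neq[of 0] by eventually_elim (rule K2i(1))
    show "integrable lborel (\<lambda>\<xi>. (LINT s|lborel. \<bar>?K2 s \<xi>\<bar>) * norm (?G \<xi>))"
    proof (rule Bochner_Integration.integrable_bound[OF integrable_mult_right[OF integrable_norm[OF Fri], of "Gamma ?p * 2 ^ ?n"]])
      show "AE \<xi> in lborel. norm ((LINT s|lborel. \<bar>?K2 s \<xi>\<bar>) * norm (?G \<xi>)) \<le> norm (Gamma ?p * 2 ^ ?n * norm (Fr f \<xi>))"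
        using AE_lborel_neq[of 0]
      proof eventually_elim
        case (elim \<xi>)
        have "(LINT s|lborel. \<bar>?K2 s \<xi>\<bar>) = (LINT s|lborel. ?K2 s \<xi>)"
          by (intro Bochner_Integration.integral_cong refl) simp
        then have "(LINT s|lborel. \<bar>?K2 s \<xi>\<bar>) = Gamma ?p * 2 ^ ?n / norm \<xi> ^ ?n" unfolding K2i(2)[OF elim] .
        then show ?case using elim Gp by (simp add: norm_mult norm_power abs_mult)
      qed
    qed measurable
  qed measurable
  also have "\<dots> = (LINT \<xi>|lborel. of_real (Gamma ?p * 2 ^ ?n) * (Fr f \<xi> * cis (y \<bullet> \<xi>)))"
  proof (rule integral_cong_AE)
    show "AE \<xi> in lborel. of_real (LINT s|lborel. ?K2 s \<xi>) * ?G \<xi> = of_real (Gamma ?p * 2 ^ ?n) * (Fr f \<xi> * cis (y \<bullet> \<xi>))"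
      using AE_lborel_neq[of 0]
    proof eventually_elim
      case (elim \<xi>)
      show ?case unfolding K2i(2)[OF elim] using elim by simp
    qed
  qed measurable
  also have "\<dots> = of_real (Gamma ?p * 2 ^ ?n) * (LINT \<xi>|lborel. Fr f \<xi> * cis (y \<bullet> \<xi>))"
    by (rule integral_mult_right_zero)
  also have "(LINT \<xi>|lborel. Fr f \<xi> * cis (y \<bullet> \<xi>)) = of_real ((2 * pi) ^ ?n) * of_real (f y)"
    unfolding fourier_inversion[OF f, of y, symmetric] inv_fourier_def by simp
  also have "- of_real cc * (of_real (Gamma ?p * 2 ^ ?n) * (of_real ((2 * pi) ^ ?n) * of_real (f y)))
      = (- of_real (cc * (2 * pi) ^ ?n * Gamma ?p * 2 ^ ?n * f y) :: complex)" by (simp add: mult_ac)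
  also have "cc * (2 * pi) ^ ?n * Gamma ?p * 2 ^ ?n * f y = 2 * gamma_const TYPE('n) * f y"
    unfolding gamma_const_duplication cc_def by simp
  also have "(LINT x|lborel. of_real (LINT s|lborel. ?K s x) * hnl f x) = (LINT x|lborel. 2 * (of_real (ln (norm (x - y))) * hnl f x))"
  proof (rule integral_cong_AE)
    show "AE x in lborel. of_real (LINT s|lborel. ?K s x) * hnl f x = 2 * (of_real (ln (norm (x - y))) * hnl f x)"
      using AE_lborel_neq[of y]
    proof eventually_elim
      case (elim x)
      then show ?case unfolding frullani(2)[OF ne[OF elim]] by (simp add: ln_realpow)
    qed
  qed measurable
  finally show ?thesis by simp
qed

text \<open>\<open>ln (bracket y)\<close> is constant in \<open>x\<close>, so the zero mean removes
  it. The remainder besides \<open>f y\<close> is the same for all \<open>y\<close>, hence also for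
  averages over \<open>y\<close>.\<close>

theorem lker_potential_hnl:
  fixes f :: "real^'n \<Rightarrow> real"
  assumes f: "test_function f"
  shows "(LINT x|lborel. of_real (lker x y) * hnl f x) =
    of_real (gamma_const TYPE('n) * f y) + (LINT x|lborel. of_real (ln (bracket x)) * hnl f x)"
proof -
  have "(LINT x|lborel. of_real (lker x y) * hnl f x) =
      (LINT x|lborel. of_real (ln (bracket x)) * hnl f x + of_real (ln (bracket y)) * hnl f x - of_real (ln (norm (x - y))) * hnl f x)"
    by (intro Bochner_Integration.integral_cong refl) (simp add: lker_def algebra_simps)
  also have "\<dots> = (LINT x|lborel. of_real (ln (bracket x)) * hnl f x) + of_real (ln (bracket y)) * (LINT x|lborel. hnl f x)
      - (LINT x|lborel. of_real (ln (norm (x - y))) * hnl f x)"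
    using ln_bracket_hnl_integrable[OF f] hnl_integrable[OF f] ln_norm_hnl_integrable[OF f, of y] by simp
  finally show ?thesis by (simp add: hnl_integral_zero[OF f] log_potential_hnl[OF f])
qed

section \<open>The solution\<close>

lemma gamma_const_pos: "0 < gamma_const TYPE('n::finite)"
proof -
  have "0 < Gamma (real CARD('n) / 2)" by (rule Gamma_real_pos) simp
  then have "0 < 2 * gamma_const TYPE('n)" unfolding gamma_const_duplication by simp
  then show ?thesis by simp
qed

lemma lker_continuous:
  assumes "x \<noteq> y" "X \<longlonglongrightarrow> x"
  shows "(\<lambda>j. lker (X j) y) \<longlonglongrightarrow> lker x y"
proof -
  have b: "1 + (norm x)\<^sup>2 \<noteq> 0" for x :: 'a using zero_le_power2[of "norm x"] by linarith
  show ?thesis unfolding lker_def bracket_def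
    using assms(1) b by (intro tendsto_intros assms(2)) auto
qed

lemma lker_continuous_on: "continuous_on (- {y}) (\<lambda>x. lker x y)"
proof -
  have "bracket x \<noteq> 0" for x :: 'a using bracket_pos[of x] by simp
  then show ?thesis unfolding lker_def by (intro continuous_intros) auto
qed

text \<open>Again \<open>lker <= 2 * exp (lker / 2)\<close>; on a compact set the power of
  \<open>bracket\<close> that makes the exponential integrable is bounded below.\<close>

lemma lker_locally_integrable: "locally_integrable (\<lambda>x. lker x (y :: real^'n))"
  unfolding locally_integrable_def set_integrable_def
proof (intro allI impI)
  fix K :: "(real^'n) set" assume K: "compact K"
  let ?n = "real CARD('n)"
  obtain R where R: "0 < R" "\<And>x. x \<in> K \<Longrightarrow> norm x \<le> R"
    using compact_imp_bounded[OF K] unfolding bounded_pos by blast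
  let ?e = "\<lambda>x::real^'n. exp (1 / 2 * lker x y) * bracket x powr (- (2 * ?n))"
  obtain C0 where "0 \<le> C0" and "\<And>y::real^'n. integrable lborel (\<lambda>x. exp (1 / 2 * lker x y) * bracket x powr (- (2 * ?n)))"
    and "\<And>y::real^'n. (LINT x|lborel. exp (1 / 2 * lker x y) * bracket x powr (- (2 * ?n))) \<le> C0"
  proof (rule exp_lker_integrable[where 'a = "real^'n", of "1 / 2" "2 * ?n"])
    have "0 < CARD('n)" by simp
    then have n: "1 \<le> ?n" by linarith
    have d: "real DIM(real^'n) = ?n" by simp
    show "1 / 2 < real DIM(real^'n)" "real DIM(real^'n) + 1 / 2 < 2 * ?n"
      unfolding d using n by linarith+
  qed (simp, rule that)
  then have ei: "integrable lborel ?e" by blast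
  have [measurable]: "K \<in> sets borel" using K by (simp add: compact_imp_closed borel_closed)
  show "integrable lborel (\<lambda>x. indicator K x *\<^sub>R lker x y)"
  proof (rule Bochner_Integration.integrable_bound[OF integrable_mult_right[OF ei, of "2 * (1 + R) powr (2 * ?n)"]])
    show "AE x in lborel. norm (indicator K x *\<^sub>R lker x y) \<le> norm (2 * (1 + R) powr (2 * ?n) * ?e x)"
    proof (rule AE_I2)
      fix x :: "real^'n"
      show "norm (indicator K x *\<^sub>R lker x y) \<le> norm (2 * (1 + R) powr (2 * ?n) * ?e x)"
      proof (cases "x \<in> K")
        case True
        note b = bracket_pos[of x] bracket_le[of x] R(2)[OF True]
        have "1 = bracket x powr (2 * ?n) * bracket x powr (- (2 * ?n))" using b by (simp add: powr_add[symmetric])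
        also have "\<dots> \<le> (1 + R) powr (2 * ?n) * bracket x powr (- (2 * ?n))"
          using b by (intro mult_right_mono powr_mono2) auto
        finally have 1: "1 \<le> (1 + R) powr (2 * ?n) * bracket x powr (- (2 * ?n))" .
        have "lker x y \<le> 2 * exp (1 / 2 * lker x y)" using exp_ge_add_one_self[of "1 / 2 * lker x y"] by linarith
        also have "\<dots> \<le> 2 * exp (1 / 2 * lker x y) * ((1 + R) powr (2 * ?n) * bracket x powr (- (2 * ?n)))"
          using mult_left_mono[OF 1, of "2 * exp (1 / 2 * lker x y)"] by simp
        also have "\<dots> = 2 * (1 + R) powr (2 * ?n) * ?e x" by simp
        finally have "norm (indicator K x *\<^sub>R lker x y) \<le> 2 * (1 + R) powr (2 * ?n) * ?e x"
          using True lker_nonneg[of x y] by simp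
        then show ?thesis using abs_ge_self order_trans unfolding real_norm_def by blast
      qed simp
    qed
  qed measurable
qed

lemma continuous_locally_integrable:
  assumes "continuous_on UNIV f" shows "locally_integrable f"
  unfolding locally_integrable_def set_integrable_def
  by (intro allI impI borel_integrable_compact continuous_on_subset[OF assms]) auto

lemma integrable_locally_integrable:
  assumes "integrable lborel f" shows "locally_integrable f"
  unfolding locally_integrable_def set_integrable_def
  by (intro allI impI integrable_mult_indicator assms) (simp add: compact_imp_closed borel_closed)

lemma locally_integrable_add:
  "locally_integrable f \<Longrightarrow> locally_integrable g \<Longrightarrow> locally_integrable (\<lambda>x. f x + g x)"
  unfolding locally_integrable_def by (auto intro: set_integral_add)

lemma locally_integrable_cmult:
  "locally_integrable f \<Longrightarrow> locally_integrable (\<lambda>x. c * f x)"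
  unfolding locally_integrable_def by (auto intro: set_integrable_mult_right)

lemma locally_integrable_sum:
  "finite I \<Longrightarrow> (\<And>i. i \<in> I \<Longrightarrow> locally_integrable (f i)) \<Longrightarrow> locally_integrable (\<lambda>x. \<Sum>i\<in>I. f i x)"
proof (induction I rule: finite_induct)
  case empty
  then show ?case by (simp add: continuous_locally_integrable)
qed (auto intro: locally_integrable_add)

text \<open>The abstract minimisation on the measure with density \<open>weight\<close>. Its
  fixed-point density refers to that measure, so \<open>p\<close> is the product with the
  weight.\<close>

theorem mean_field_existence:
  fixes P :: "nat \<Rightarrow> real^'n" and \<beta> :: "nat \<Rightarrow> real"
  assumes m: "1 \<le> m" and \<beta>: "\<And>l. l \<in> {1..m} \<Longrightarrow> 0 < \<beta> l" and S: "(\<Sum>l=1..m. \<beta> l) < 2"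
    and tri: "\<And>j. j \<in> {1..m} \<Longrightarrow> 2 * \<beta> j < (\<Sum>l=1..m. \<beta> l)" and inj: "inj_on P {1..m}"
  obtains v p :: "real^'n \<Rightarrow> real" and B Z where "continuous_on UNIV v" "\<And>x. \<bar>v x\<bar> \<le> B" "0 < Z"
    "\<And>x. p x = exp (real CARD('n) * (2 - (\<Sum>l=1..m. \<beta> l)) * v x) / Z * weight m (\<lambda>l. real CARD('n) * \<beta> l) P x"
    "integrable lborel p" "(LINT x|lborel. p x) = 1"
    "\<And>x. v x = (LINT y|lborel. lker x y * p y)"
proof -
  let ?n = "real CARD('n)" let ?S = "\<Sum>l=1..m. \<beta> l" let ?b = "\<lambda>l. ?n * \<beta> l"
  let ?W = "weight m ?b P"
  have n: "0 < ?n" by simp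
  have I: "finite {1..m}" "{1..m} \<noteq> {}" using m by auto
  define bm where "bm = Max (\<beta> ` {1..m})"
  have bm: "\<beta> l \<le> bm" if "l \<in> {1..m}" for l unfolding bm_def using that by simp
  have "bm \<in> \<beta> ` {1..m}" unfolding bm_def using I by (intro Max_in) auto
  then have bmS: "2 * bm < ?S" using tri by auto
  define s where "s = ?n * (1 - ?S / 2)"
  \<comment> \<open>The room left in \<open>s + n * bm < n\<close>, positive by \<open>tri\<close>.
    One half raises \<open>s\<close> to \<open>s'\<close>, the other half keeps
    \<open>s' + n * \<beta> l\<close> below \<open>n\<close>.\<close>
  define \<eta> where "\<eta> = ?n - s - ?n * bm"
  define s' where "s' = s + \<eta> / 2"
  have s: "0 < s" using S n by (simp add: s_def)
  have "\<eta> = ?n * ((?S - 2 * bm) / 2)" unfolding \<eta>_def s_def by (simp add: field_simps)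
  moreover have "0 < (?S - 2 * bm) / 2" using bmS by simp
  ultimately have eta: "0 < \<eta>" using mult_pos_pos[OF n] by metis
  have s'0: "0 \<le> s'" using s eta by (simp add: s'_def)
  obtain C where C: "0 \<le> C" "\<And>y. (\<integral>\<^sup>+x. ennreal (exp (s' * lker x y) * ?W x) \<partial>lborel) \<le> ennreal C"
  proof (rule exp_lker_weight_bound[OF inj m, of s' ?b "?n - \<eta> / 2"])
    show "0 \<le> s'" using s eta by (simp add: s'_def)
    show "0 \<le> ?b l" if "l \<in> {1..m}" for l using \<beta>[OF that] by simp
    show "s' + ?b l \<le> ?n - \<eta> / 2" if "l \<in> {1..m}" for l
    proof -
      have "?n * \<beta> l \<le> ?n * bm" using bm[OF that] n by (intro mult_left_mono) auto
      moreover have "s' + ?n * bm = ?n - \<eta> / 2" unfolding s'_def \<eta>_def by (simp add: field_simps)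
      ultimately show ?thesis by linarith
    qed
    show "?n - \<eta> / 2 < real DIM(real^'n)" using eta by simp
  qed (rule that)
  define M where "M = density lborel (\<lambda>x. ennreal (?W x))"
  have sM [measurable_cong]: "sets M = sets borel" by (simp add: M_def)
  have spM: "space M = UNIV" by (simp add: M_def)
  have eb: "(\<integral>\<^sup>+y. ennreal (exp (s' * lker x y)) \<partial>M) \<le> ennreal C" for x
  proof -
    have "(\<integral>\<^sup>+y. ennreal (exp (s' * lker x y)) \<partial>M) = (\<integral>\<^sup>+y. ennreal (?W y) * ennreal (exp (s' * lker x y)) \<partial>lborel)"
      unfolding M_def by (rule nn_integral_density) measurable
    also have "\<dots> = (\<integral>\<^sup>+y. ennreal (exp (s' * lker y x) * ?W y) \<partial>lborel)"
      by (intro nn_integral_cong) (simp add: ennreal_mult'[symmetric] lker_sym[of x] mult.commute less_imp_le[OF weight_pos])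
    finally show ?thesis using C(2)[of x] by simp
  qed
  \<comment> \<open>Since \<open>lker\<close> is nonnegative the exponential is at least 1, so
    \<open>eb\<close> also bounds the total mass.\<close>
  have fin: "emeasure M UNIV < \<infinity>"
  proof -
    have "emeasure M UNIV = (\<integral>\<^sup>+y. 1 \<partial>M)" using spM by simp
    also have "\<dots> \<le> (\<integral>\<^sup>+y. ennreal (exp (s' * lker 0 y)) \<partial>M)"
      using s'0 by (intro nn_integral_mono) (simp add: lker_nonneg)
    also have "\<dots> \<le> ennreal C" by (rule eb)
    finally show ?thesis by (simp add: le_less_trans)
  qed
  have pos: "0 < measure M UNIV"
  proof -
    have "emeasure M UNIV \<noteq> 0"
    proof
      assume "emeasure M UNIV = 0"
      then have "(\<integral>\<^sup>+x. ennreal (?W x) \<partial>lborel) = 0"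
        by (simp add: M_def emeasure_density)
      then have "AE x in lborel. ennreal (?W x) = 0" by (subst (asm) nn_integral_0_iff_AE) auto
      moreover have "ennreal (?W x) \<noteq> 0" for x using weight_pos[of m ?b P x] by (simp add: ennreal_eq_0_iff not_le)
      ultimately have "AE x in (lborel :: (real^'n) measure). (1::ennreal) = 0" by simp
      then have "(\<integral>\<^sup>+x. 1 \<partial>(lborel :: (real^'n) measure)) = (\<integral>\<^sup>+x. 0 \<partial>(lborel :: (real^'n) measure))"
        by (rule nn_integral_cong_AE)
      then show False by (simp add: emeasure_lborel_UNIV)
    qed
    then show ?thesis using fin by (simp add: measure_def enn2real_positive_iff zero_less_iff_neq_zero)
  qed
  interpret finite_measure M
    by (rule finite_measureI) (use fin spM in simp)
  interpret continuous_exp_kernel M lker s s' C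
  proof
    show "space M = UNIV" by (rule spM)
    show "(\<lambda>p. lker (fst p) (snd p)) \<in> borel_measurable (M \<Otimes>\<^sub>M M)" by measurable
    show "0 \<le> lker x y" "lker x y = lker y x" for x y :: "real^'n" by (rule lker_nonneg lker_sym)+
    show "0 < s" "s < s'" "0 < measure M UNIV" using s eta pos by (auto simp: s'_def)
    show "(\<integral>\<^sup>+y. ennreal (exp (s' * lker x y)) \<partial>M) \<le> ennreal C" for x by (rule eb)
    show "AE y in M. (\<lambda>j. lker (X j) y) \<longlonglongrightarrow> lker x y" if "X \<longlonglongrightarrow> x" for X and x :: "real^'n"
    proof -
      have "AE y in lborel. (\<lambda>j. lker (X j) y) \<longlonglongrightarrow> lker x y"
        using AE_lborel_neq[of x] by eventually_elim (rule lker_continuous[OF _ that], simp)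
      then show ?thesis unfolding M_def by (subst AE_density) auto
    qed
  qed
  obtain v where v: "continuous_on UNIV v" "\<And>x. 0 \<le> v x" "bdd v" "\<And>x. pot (emap v) x = v x"
    by (rule mean_field_solution) (rule that)
  obtain B where B: "0 \<le> B" "\<And>x. \<bar>v x\<bar> \<le> B" using v(3) by (elim bddE) blast
  define Z where "Z = (\<integral>y. exp (2 * s * v y) \<partial>M)"
  have Z: "0 < Z" using exp_int_ge[OF v(3) v(2)] M_pos by (simp add: Z_def)
  note d = densD[OF dens_emap[OF v(3) v(2)]]
  define e where "e = emap v"
  have ei: "integrable M e" and e1: "(LINT x|M. e x) = 1"
    unfolding e_def using d by (auto intro: bdd_int)
  have ve: "v x = (LINT y|M. lker x y * e y)" for x using v(4)[of x] by (simp add: pot_def e_def)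
  have ex: "e x = exp (2 * s * v x) / Z" for x by (simp add: e_def emap_def Z_def)
  have [measurable]: "e \<in> borel_measurable borel"
    using borel_measurable_integrable[OF ei] sM by (simp cong: measurable_cong_sets)
  have W0: "0 \<le> ?W x" for x using weight_pos[of m ?b P x] by simp
  have s2: "2 * s = ?n * (2 - ?S)" by (simp add: s_def field_simps)
  show ?thesis
  proof (rule that[of v B Z "\<lambda>x. e x * ?W x"])
    show "e x * ?W x = exp (?n * (2 - ?S) * v x) / Z * ?W x" for x
      unfolding ex s2 ..
    from ei show "integrable lborel (\<lambda>x. e x * ?W x)"
      unfolding M_def using W0 by (subst (asm) integrable_density) (auto simp: mult.commute)
    have "(LINT x|M. e x) = (LINT x|lborel. e x * ?W x)"
      unfolding M_def using W0 by (subst integral_density) (auto simp: mult.commute)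
    then show "(LINT x|lborel. e x * ?W x) = 1" using e1 by simp
    show "v x = (LINT y|lborel. lker x y * (e y * ?W y))" for x
    proof -
      have "v x = (LINT y|lborel. ?W y *\<^sub>R (lker x y * e y))"
        unfolding ve M_def using W0 by (subst integral_density) auto
      also have "\<dots> = (LINT y|lborel. lker x y * (e y * ?W y))"
        by (simp add: mult_ac)
      finally show ?thesis .
    qed
  qed (use v(1) B(2) Z in auto)
qed

text \<open>\<open>lker_potential_hnl\<close> averaged over \<open>y\<close> against
  \<open>p\<close>; total mass 1 keeps the \<open>ln (bracket x)\<close> term with coefficient
  1.\<close>

lemma potential_hnl:
  fixes p v :: "real^'n \<Rightarrow> real" and f :: "real^'n \<Rightarrow> real"
  assumes f: "test_function f" and p: "integrable lborel p" "\<And>x. 0 \<le> p x" "(LINT x|lborel. p x) = 1"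
    and v: "\<And>x. v x = (LINT y|lborel. lker x y * p y)" and pf: "integrable lborel (\<lambda>x. p x * f x)"
  shows "(LINT x|lborel. of_real (v x) * hnl f x) =
    of_real (gamma_const TYPE('n) * (LINT x|lborel. p x * f x)) + (LINT x|lborel. of_real (ln (bracket x)) * hnl f x)"
proof -
  let ?A = "LINT x|lborel. of_real (ln (bracket x)) * hnl f x"
  obtain C where C: "0 \<le> C" "\<And>y. integrable lborel (\<lambda>x. lker x y * norm (hnl f x))"
    "\<And>y. (LINT x|lborel. lker x y * norm (hnl f x)) \<le> C"
    by (rule lker_hnl_bound[OF f]) (rule that)
  have [measurable]: "hnl f \<in> borel_measurable borel" by (rule hnl_meas[OF f])
  have [measurable]: "p \<in> borel_measurable borel" using borel_measurable_integrable[OF p(1)] by simp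
  let ?H = "\<lambda>y x. of_real (lker x y * p y) * hnl f x"
  have i: "integrable (lborel \<Otimes>\<^sub>M lborel) (\<lambda>q. ?H (fst q) (snd q))"
  proof (rule lborel_pair.Fubini_integrable)
    have nH: "norm (?H y x) = p y * (lker x y * norm (hnl f x))" for x y
      using p(2)[of y] lker_nonneg[of x y] by (simp add: norm_mult)
    show "integrable lborel (\<lambda>y. LINT x|lborel. norm (?H (fst (y, x)) (snd (y, x))))"
    proof (rule Bochner_Integration.integrable_bound[OF integrable_mult_left[OF p(1), of C]])
      show "AE y in lborel. norm (LINT x|lborel. norm (?H (fst (y, x)) (snd (y, x)))) \<le> norm (p y * C)"
      proof (rule AE_I2)
        fix y
        have "0 \<le> (LINT x|lborel. lker x y * norm (hnl f x))"
          by (intro Bochner_Integration.integral_nonneg mult_nonneg_nonneg lker_nonneg norm_ge_zero)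
        then show "norm (LINT x|lborel. norm (?H (fst (y, x)) (snd (y, x)))) \<le> norm (p y * C)"
          unfolding fst_conv snd_conv nH using C(1) C(3)[of y] p(2)[of y] by (simp add: abs_mult mult_left_mono)
      qed
    qed measurable
    show "AE y in lborel. integrable lborel (\<lambda>x. ?H (fst (y, x)) (snd (y, x)))"
    proof (rule AE_I2)
      fix y
      have "integrable lborel (\<lambda>x. of_real (p y) * (of_real (lker x y) * hnl f x))"
        by (intro integrable_mult_right lker_hnl_integrable f)
      then show "integrable lborel (\<lambda>x. ?H (fst (y, x)) (snd (y, x)))" by (simp add: mult_ac)
    qed
  qed measurable
  have "(LINT x|lborel. of_real (v x) * hnl f x) = (LINT x|lborel. LINT y|lborel. ?H y x)"
    unfolding v by (simp only: integral_mult_left_zero integral_complex_of_real)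
  also have "\<dots> = (LINT y|lborel. LINT x|lborel. ?H y x)"
    using i by (intro lborel_pair.Fubini_integral) (simp add: case_prod_beta')
  also have "\<dots> = (LINT y|lborel. of_real (gamma_const TYPE('n) * (p y * f y)) + of_real (p y) * ?A)"
  proof (intro Bochner_Integration.integral_cong refl)
    fix y
    have "(LINT x|lborel. ?H y x) = (LINT x|lborel. of_real (p y) * (of_real (lker x y) * hnl f x))"
      by (simp add: mult_ac)
    also have "\<dots> = of_real (p y) * (of_real (gamma_const TYPE('n) * f y) + ?A)"
      unfolding lker_potential_hnl[OF f, symmetric] by (rule integral_mult_right_zero)
    finally show "(LINT x|lborel. ?H y x) = of_real (gamma_const TYPE('n) * (p y * f y)) + of_real (p y) * ?A"
      by (simp add: algebra_simps)
  qed
  also have "\<dots> = (LINT y|lborel. of_real (gamma_const TYPE('n) * (p y * f y))) + (LINT y|lborel. of_real (p y) * ?A)"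
    using pf p(1) by (intro Bochner_Integration.integral_add integrable_of_real integrable_mult_right integrable_mult_left)
  also have "(LINT y|lborel. complex_of_real (gamma_const TYPE('n) * (p y * f y))) = of_real (gamma_const TYPE('n) * (LINT x|lborel. p x * f x))"
    by (simp only: integral_complex_of_real integral_mult_right_zero)
  also have "(LINT y|lborel. of_real (p y) * ?A) = ?A"
    using p(3) by (simp only: integral_mult_left_zero integral_complex_of_real) simp
  finally show ?thesis .
qed

text \<open>Far out, \<open>bracket x <= 2 * norm x <= 4 * norm (x - P)\<close>, hence the
  \<open>ln 4\<close>. On the sphere: the point at infinity keeps a positive distance from the
  projection of \<open>P\<close>.\<close>

lemma lker_bounded_at_infinity:
  fixes P :: "'a::real_normed_vector"
  assumes "2 * norm P + 1 \<le> norm x"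
  shows "\<bar>lker x P\<bar> \<le> ln 4 + ln (bracket P)"
proof -
  have x: "1 \<le> norm x" "norm x / 2 \<le> norm (x - P)"
    using assms norm_ge_zero[of P] norm_triangle_ineq2[of x P] by linarith+
  have "bracket x \<le> 2 * norm x" using bracket_le[of x] x by linarith
  then have "ln (bracket x) \<le> ln (2 * norm x)" using bracket_pos[of x] by (intro iffD2[OF ln_le_cancel_iff]) auto
  also have "\<dots> = ln 4 + ln (norm x / 2)"
    using x by (subst ln_mult_pos[symmetric]) (auto simp: ln_div)
  also have "ln (norm x / 2) \<le> ln (norm (x - P))" using x by (intro iffD2[OF ln_le_cancel_iff]) auto
  finally show ?thesis using lker_nonneg[of x P] by (simp add: lker_def)
qed


theorem theorem1p2:
  fixes m :: nat and \<beta> :: "nat \<Rightarrow> real" and P :: "nat \<Rightarrow> real^'n"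
  assumes "m \<ge> 3" and "CARD('n) \<ge> 2"
    and "\<And>l. l \<in> {1..m} \<Longrightarrow> \<beta> l \<in> {0<..<1}"
    and "(\<Sum>l=1..m. \<beta> l) < 2"
    and "\<And>j. j \<in> {1..m} \<Longrightarrow> (\<Sum>l\<in>{1..m} - {j}. \<beta> l) > \<beta> j"
    and "inj_on P {1..m}"
  shows "\<exists>w :: real^'n \<Rightarrow> real.
    continuous_on (UNIV - P ` {1..m}) w \<and>
    distributional_solution m \<beta> P w \<and>
    (\<lambda>x. w x - (- 2 * ln (norm x))) \<in> O[at_infinity](\<lambda>_. 1)"
proof -
  let ?n = "real CARD('n)" let ?S = "\<Sum>l=1..m. \<beta> l" let ?\<gamma> = "gamma_const TYPE('n)"
  let ?W = "weight m (\<lambda>l. ?n * \<beta> l) P"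
  have n: "0 < ?n" by simp
  have \<gamma>: "0 < ?\<gamma>" by (rule gamma_const_pos)
  have tri: "2 * \<beta> j < ?S" if "j \<in> {1..m}" for j
    using assms(5)[OF that] sum.remove[of "{1..m}" j \<beta>] that by simp
  obtain v p :: "real^'n \<Rightarrow> real" and B Z where v: "continuous_on UNIV v" "\<And>x. \<bar>v x\<bar> \<le> B" and Z: "0 < Z"
    and p: "\<And>x. p x = exp (?n * (2 - ?S) * v x) / Z * ?W x" "integrable lborel p" "(LINT x|lborel. p x) = 1"
    and vp: "\<And>x. v x = (LINT y|lborel. lker x y * p y)"
  proof (rule mean_field_existence[of m \<beta> P])
    show "0 < \<beta> l" if "l \<in> {1..m}" for l using assms(3)[OF that] by simp
    show "1 \<le> m" using assms(1) by simp
    show "?S < 2" by (rule assms(4))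
    show "2 * \<beta> j < ?S" if "j \<in> {1..m}" for j by (rule tri[OF that])
    show "inj_on P {1..m}" by (rule assms(6))
  qed (rule that)
  \<comment> \<open>Chosen so that \<open>exp (n * w)\<close> is
    \<open>gamma_const * (2 - S)\<close> times \<open>p\<close>, hence has integral
    \<open>gamma_const * (2 - S)\<close>.\<close>
  define c where "c = ln (?\<gamma> * (2 - ?S) / Z) / ?n"
  define w where "w x = (2 - ?S) * v x + (\<Sum>l=1..m. \<beta> l * lker x (P l)) + (- 2) * ln (bracket x) + c" for x
  have exp_w: "exp (?n * w x) = ?\<gamma> * (2 - ?S) * p x" for x
  proof -
    have "?n * w x = ?n * (2 - ?S) * v x + (\<Sum>l=1..m. ?n * \<beta> l * lker x (P l)) + (- 2 * ?n) * ln (bracket x) + ?n * c"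
      unfolding w_def by (simp add: algebra_simps sum_distrib_left)
    moreover have "exp (?n * c) = ?\<gamma> * (2 - ?S) / Z"
      using n \<gamma> Z assms(4) by (simp add: c_def)
    moreover have "exp ((- 2 * ?n) * ln (bracket x)) = bracket x powr (- 2 * ?n)"
      using bracket_pos[of x] by (simp add: powr_def)
    ultimately have "exp (?n * w x) = exp (?n * (2 - ?S) * v x) * exp (\<Sum>l=1..m. ?n * \<beta> l * lker x (P l)) * bracket x powr (- 2 * ?n) * (?\<gamma> * (2 - ?S) / Z)"
      by (simp only: exp_add)
    then show ?thesis unfolding p(1) weight_def by simp
  qed
  have p0: "0 \<le> p x" for x using Z weight_pos[of m "\<lambda>l. ?n * \<beta> l" P x] by (simp add: p(1))
  have vm [measurable]: "v \<in> borel_measurable borel" using v(1) by (rule borel_measurable_continuous_onI)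
  have [measurable]: "p \<in> borel_measurable borel" using borel_measurable_integrable[OF p(2)] by simp
  have "continuous_on (UNIV - P ` {1..m}) w"
  proof -
    have "continuous_on (UNIV - P ` {1..m}) (\<lambda>x. lker x (P l))" if "l \<in> {1..m}" for l
      by (rule continuous_on_subset[OF lker_continuous_on[of "P l"]]) (use that in auto)
    moreover have "continuous_on (UNIV - P ` {1..m}) v" by (rule continuous_on_subset[OF v(1)]) simp
    moreover have "bracket x \<noteq> 0" for x :: "real^'n" using bracket_pos[of x] by simp
    ultimately show ?thesis unfolding w_def by (intro continuous_intros) auto
  qed
  moreover have "distributional_solution m \<beta> P w"
    unfolding distributional_solution_def
  proof (intro conjI allI impI)
    have "bracket x \<noteq> 0" for x :: "real^'n" using bracket_pos[of x] by simp
    then have "continuous_on UNIV (\<lambda>x::real^'n. ln (bracket x))" by (intro continuous_intros) auto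
    then show "locally_integrable w" unfolding w_def
      by (intro locally_integrable_add locally_integrable_cmult locally_integrable_sum finite_atLeastAtMost
          lker_locally_integrable continuous_locally_integrable v(1) continuous_on_const)
    show "locally_integrable (\<lambda>x. exp (?n * w x))"
      unfolding exp_w by (intro integrable_locally_integrable integrable_mult_right p)
    fix \<phi> :: "real^'n \<Rightarrow> real" assume \<phi>: "test_function \<phi>"
    let ?\<Psi> = "hnl \<phi>" let ?A = "LINT x|lborel. of_real (ln (bracket x)) * hnl \<phi> x"
    have [measurable]: "?\<Psi> \<in> borel_measurable borel" by (rule hnl_meas[OF \<phi>])
    have [measurable]: "\<phi> \<in> borel_measurable borel" by (rule test_function_meas[OF \<phi>])
    obtain B' where B': "0 \<le> B'" "\<And>x. \<bar>\<phi> x\<bar> \<le> B'" by (rule test_function_bounded[OF \<phi>]) (rule that)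
    have p\<phi>: "integrable lborel (\<lambda>x. p x * \<phi> x)"
    proof (rule Bochner_Integration.integrable_bound[OF integrable_mult_left[OF p(2), of B']])
      show "AE x in lborel. norm (p x * \<phi> x) \<le> norm (p x * B')"
        using B' by (intro AE_I2) (auto simp: abs_mult intro!: mult_left_mono)
    qed measurable
    note i\<Psi> = hnl_integrable[OF \<phi>]
    have iv: "integrable lborel (\<lambda>x. of_real (v x) * ?\<Psi> x)"
    proof (rule Bochner_Integration.integrable_bound[OF integrable_mult_right[OF integrable_norm[OF i\<Psi>], of B]])
      show "AE x in lborel. norm (of_real (v x) * ?\<Psi> x) \<le> norm (B * norm (?\<Psi> x))"
        using v(2) by (intro AE_I2) (auto simp: norm_mult abs_mult intro!: mult_right_mono order_trans[OF _ abs_ge_self])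
    qed measurable
    note il = lker_hnl_integrable[OF \<phi>] and ib = ln_bracket_hnl_integrable[OF \<phi>]
    have isum: "integrable lborel (\<lambda>x. \<Sum>l=1..m. of_real (\<beta> l) * (of_real (lker x (P l)) * ?\<Psi> x))"
      by (intro Bochner_Integration.integrable_sum integrable_mult_right il)
    let ?f = "\<lambda>x. of_real (2 - ?S) * (of_real (v x) * ?\<Psi> x) + (\<Sum>l=1..m. of_real (\<beta> l) * (of_real (lker x (P l)) * ?\<Psi> x))
        + of_real (- 2) * (of_real (ln (bracket x)) * ?\<Psi> x) + of_real c * ?\<Psi> x"
    have wf: "of_real (w x) * ?\<Psi> x = ?f x" for x
      unfolding w_def of_real_add of_real_mult of_real_sum sum_distrib_right distrib_right mult.assoc ..
    have iw: "integrable lborel (\<lambda>x. of_real (w x) * ?\<Psi> x)"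
      unfolding wf by (intro Bochner_Integration.integrable_add integrable_mult_right iv isum ib i\<Psi>)
    have "(LINT x|lborel. of_real (w x) * ?\<Psi> x) = of_real (2 - ?S) * (LINT x|lborel. of_real (v x) * ?\<Psi> x)
       + (\<Sum>l=1..m. of_real (\<beta> l) * (LINT x|lborel. of_real (lker x (P l)) * ?\<Psi> x))
       + of_real (- 2) * ?A + of_real c * (LINT x|lborel. ?\<Psi> x)"
    proof -
      have "(LINT x|lborel. (\<Sum>l=1..m. of_real (\<beta> l) * (of_real (lker x (P l)) * ?\<Psi> x)))
        = (\<Sum>l=1..m. of_real (\<beta> l) * (LINT x|lborel. of_real (lker x (P l)) * ?\<Psi> x))"
        unfolding integral_mult_right_zero[symmetric]
        by (rule Bochner_Integration.integral_sum) (intro integrable_mult_right il)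
      then show ?thesis unfolding wf
        using iv isum ib i\<Psi> by (simp only: Bochner_Integration.integral_add Bochner_Integration.integrable_add
            integrable_mult_right integral_mult_right_zero)
    qed
    \<comment> \<open>The integral \<open>?A\<close> enters with total coefficient
      \<open>(2 - S) + S - 2 = 0\<close>, and \<open>c\<close> is paired with a function of zero
      mean.\<close>
    also have "\<dots> = of_real (?\<gamma> * (2 - ?S) * (LINT x|lborel. p x * \<phi> x) + ?\<gamma> * (\<Sum>l=1..m. \<beta> l * \<phi> (P l)))"
      unfolding potential_hnl[OF \<phi> p(2) p0 p(3) vp p\<phi>] lker_potential_hnl[OF \<phi>] hnl_integral_zero[OF \<phi>]
      by (simp add: algebra_simps sum.distrib sum_distrib_left sum_distrib_right)
    finally have main: "(LINT x|lborel. of_real (w x) * ?\<Psi> x) =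
      of_real (?\<gamma> * (2 - ?S) * (LINT x|lborel. p x * \<phi> x) + ?\<gamma> * (\<Sum>l=1..m. \<beta> l * \<phi> (P l)))" .
    have wh: "w x * half_n_laplacian \<phi> x = Re (of_real (w x) * ?\<Psi> x)" for x
      by (simp add: half_n_laplacian_eq[OF \<phi>])
    show "integrable lborel (\<lambda>x. w x * half_n_laplacian \<phi> x)"
      unfolding wh using iw by (rule integrable_Re)
    have "(LINT x|lborel. w x * half_n_laplacian \<phi> x) = Re (LINT x|lborel. of_real (w x) * ?\<Psi> x)"
      unfolding wh using iw by (rule integral_Re)
    also have "\<dots> = ?\<gamma> * (2 - ?S) * (LINT x|lborel. p x * \<phi> x) + ?\<gamma> * (\<Sum>l=1..m. \<beta> l * \<phi> (P l))"
      unfolding main by (rule Re_complex_of_real)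
    also have "?\<gamma> * (2 - ?S) * (LINT x|lborel. p x * \<phi> x) = (LINT x|lborel. exp (?n * w x) * \<phi> x)"
      unfolding exp_w mult.assoc by (simp only: integral_mult_right_zero)
    finally show "(LINT x|lborel. w x * half_n_laplacian \<phi> x) =
          (LINT x|lborel. exp (?n * w x) * \<phi> x) + ?\<gamma> * (\<Sum>l=1..m. \<beta> l * \<phi> (P l))" .
  qed
  moreover have "(\<lambda>x. w x - (- 2 * ln (norm x))) \<in> O[at_infinity](\<lambda>_. 1)"
  proof (rule bigoI)
    define R where "R = 1 + (\<Sum>l=1..m. 2 * norm (P l))"
    \<comment> \<open>The \<open>ln 2\<close> comes from \<open>bracket x <= 2 * norm x\<close> for
      \<open>norm x >= 1\<close>, doubled by the coefficient of \<open>ln (bracket x)\<close> in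
      \<open>w\<close>.\<close>
    define D where "D = (2 - ?S) * B + (\<Sum>l=1..m. \<bar>\<beta> l\<bar> * (ln 4 + ln (bracket (P l)))) + 2 * ln 2 + \<bar>c\<bar>"
    show "\<forall>\<^sub>F x in at_infinity. norm (w x - (- 2 * ln (norm x))) \<le> D * norm (1::real)"
      unfolding eventually_at_infinity
    proof (intro exI allI impI)
      fix x :: "real^'n" assume x: "R \<le> norm x"
      have P: "2 * norm (P l) + 1 \<le> norm x" if "l \<in> {1..m}" for l
      proof -
        have "2 * norm (P l) \<le> (\<Sum>l=1..m. 2 * norm (P l))" using that by (intro member_le_sum) auto
        then show ?thesis using x by (simp add: R_def)
      qed
      have "0 \<le> (\<Sum>l=1..m. 2 * norm (P l))" by (intro sum_nonneg) auto
      then have x1: "1 \<le> norm x" using x by (simp add: R_def)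
      have 1: "\<bar>(2 - ?S) * v x\<bar> \<le> (2 - ?S) * B"
        using v(2)[of x] assms(4) by (simp add: abs_mult mult_left_mono)
      have 2: "\<bar>\<Sum>l=1..m. \<beta> l * lker x (P l)\<bar> \<le> (\<Sum>l=1..m. \<bar>\<beta> l\<bar> * (ln 4 + ln (bracket (P l))))"
      proof (rule order_trans[OF sum_abs])
        show "(\<Sum>l=1..m. \<bar>\<beta> l * lker x (P l)\<bar>) \<le> (\<Sum>l=1..m. \<bar>\<beta> l\<bar> * (ln 4 + ln (bracket (P l))))"
          unfolding abs_mult by (intro sum_mono mult_left_mono lker_bounded_at_infinity P) auto
      qed
      have 3: "0 \<le> ln (bracket x) - ln (norm x)" "ln (bracket x) - ln (norm x) \<le> ln 2"
      proof -
        have "ln (norm x) \<le> ln (bracket x)"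
          using x1 bracket_ge_norm[of x] bracket_pos[of x] by (intro iffD2[OF ln_le_cancel_iff]) auto
        then show "0 \<le> ln (bracket x) - ln (norm x)" by simp
        have "bracket x \<le> 2 * norm x" using bracket_le[of x] x1 by linarith
        then have "ln (bracket x) \<le> ln (2 * norm x)"
          using x1 bracket_pos[of x] by (intro iffD2[OF ln_le_cancel_iff]) auto
        also have "\<dots> = ln 2 + ln (norm x)" using x1 by (intro ln_mult_pos) auto
        finally show "ln (bracket x) - ln (norm x) \<le> ln 2" by simp
      qed
      have "w x - (- 2 * ln (norm x)) = (2 - ?S) * v x + (\<Sum>l=1..m. \<beta> l * lker x (P l)) - 2 * (ln (bracket x) - ln (norm x)) + c"
        unfolding w_def by simp
      then show "norm (w x - (- 2 * ln (norm x))) \<le> D * norm (1::real)"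
        using 1 2 3 unfolding D_def real_norm_def by simp
    qed
  qed
  ultimately show ?thesis by blast
qed

end
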